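(* Let $(X,W)$ be an affine Landau-Ginzburg B-model: $X$ is a smooth affine variety over $\mathbb{C}$ with an action of $\mathbb{C}^*$ such that $-1$ acts trivially, and $W\in\mathcal{O}_X$ has weight $2$. Then there is a chain map from the Hochschild complex $C_\bullet(Br(X,W))$ of the dg-category of B-branes to the closed state space $(\Omega_X^\bullet,dW\wedge)$ (namely the restriction of $\phi\circ\mathrm{Tr}\circ T_d$), given explicitly as follows: for B-branes $(M_0,D_0),\dots,(M_k,D_k)$ and homogeneous morphisms $M_0\xrightarrow{\alpha_0}M_1\xrightarrow{\alpha_1}\cdots\xrightarrow{\alpha_{k-1}}M_k\xrightarrow{\alpha_k}M_0$, all written as matrices over $\mathcal{O}_X$, $$\alpha_0\otimes\dots\otimes\alpha_k\ \longmapsto\ \sum_{s_0,\dots, s_k \geq 0} \frac{(-1)^{\tau}}{(k+s_0+\dots+s_k)!}\; \mathrm{Tr} \Big( \alpha_0 (dD_1)^{ s_1}\, d\alpha_1\, (dD_2)^{ s_2}\cdots d\alpha_k\, (dD_0)^{ s_0} \Big),$$ where $$\tau = \left\lceil \frac{k+ \sum_{i=0}^k s_i}{2}\right\rceil + \sum_{i=1}^k (s_1+\dots+s_i + i)(|\alpha_i| +1).$$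
   Context: $\mathcal{O}_X$ denotes the algebra of global regular functions, graded by the $\mathbb{C}^*$-weights (so by even integers, with $W$ in degree 2). Shifts: $M[\sigma]^i=M^{i+\sigma}$. Categories are assumed small. Closed state space: $\bigoplus_k\Omega^k_X[k]$ (a $k$-form of weight $w$ has total degree $w-k$) with differential $\alpha\mapsto dW\wedge\alpha$. B-branes. Linear maps of $\mathcal{O}_X$-modules are written on the right: $\alpha\beta$ means first $\alpha$, then $\beta$. A B-brane is a pair $(M,D)$ with $M$ a finitely generated projective graded $\mathcal{O}_X$-module and $D$ a degree 1 $\mathcal{O}_X$-linear endomorphism with $D^2=W\,\mathrm{id}_M$. $Br(X,W)$ is the dg-category of B-branes, with morphisms the graded spaces $\mathrm{Hom}_{\mathcal{O}_X}(M,N)$ and differential $\delta(f)=D_M f-(-1)^{|f|}f D_N$. Hochschild complex of a dg-category $\mathcal{B}$: $C_\bullet(\mathcal{B})=\bigoplus_{k\ge0}\bigoplus_{a_0,\dots,a_k}\mathcal{B}(a_0,a_1)\otimes\cdots\otimes\mathcal{B}(a_k,a_0)[k]$ with differential $d_2+d_1$, $$d_2( b_0\otimes\dots\otimes b_{k}) = \sum_{i=0}^{k-1} (-1)^{|b_0|+\dots+|b_i|+i+1} b_0\otimes\dots\otimes b_i b_{i+1}\otimes\dots\otimes b_{k}+(-1)^{(|b_0|+\dots+|b_{k-1}| + k +1)(|b_k| + 1)} b_k b_0\otimes \dots\otimes b_{k-1},$$ $$d_1( b_0\otimes\dots\otimes b_k) = \sum_{i=0}^{k} (-1)^{|b_0|+\dots+|b_{i-1}|+i}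 b_0\otimes\dots\otimes \delta b_{i}\otimes\dots\otimes b_{k}.$$ Matrices. Fix for each brane $M$ a realization as a direct summand of a free module $\bigoplus_{i=1}^{r_M}\mathcal{O}_X[\sigma_i]$; every morphism (extended by zero on the complement) is then a matrix $(\alpha_{ij})$, $\alpha_{ij}:\mathcal{O}_X[\sigma_i]\to\mathcal{O}_X[\sigma_j]$, acting on the right. $dD_i$, $d\alpha_i$ denote the matrices of one-forms obtained by applying $d$ entrywise; products are matrix products over the ring $\Omega_X^\bullet$ (with wedge product). In the displayed formula $\mathrm{Tr}$ of a square matrix $B$ of forms indexed by the free module of $M_0$ is the supertrace $\sum_i(-1)^{\sigma_i}B_{ii}$. The composite $\phi\circ\mathrm{Tr}\circ T_d$: $T_d(\alpha_0\otimes\dots\otimes\alpha_k)=\sum_{s_0,\dots,s_k\ge0}\alpha_0\otimes D_1^{\otimes s_1}\otimes\alpha_1\otimes D_2^{\otimes s_2}\otimes\dots\otimes\alpha_k\otimes D_0^{\otimes s_0}$; the generalized trace is $$\mathrm{Tr}(\alpha^0\otimes\dots\otimes\alpha^t)=\sum_{i_0,\dots,i_t}(-1)^{\sigma}\alpha^0_{i_0i_1}\otimes\dots\otimes\alpha^{t-1}_{i_{t-1}i_t}\otimes\alpha^t_{i_ti_0},\quad \sigma=(|\alpha^0_{i_0i_1}|+\dots+|\alpha^t_{i_ti_0}|+t+1)\sigma_{i_0}+\sigma_{i_1}+\dots+\sigma_{i_t};$$ and $\phi(f_0\otimes\dots\otimes f_k)=\frac1{k!}f_0\,df_1\wedge\dots\wedge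 df_k$. Sums over all lengths are finite after applying $\phi$, since forms of degree above $\dim X$ vanish.
   Formalization: The matrices D_i are not D extended by zero on the complement (for non-free M the claim then fails) but matrices of an extension of D to the free module that preserves M and its complement and squares to W; every brane is shown to have such a realization. *)

theory Defs
  imports
    "HOL-Analysis.Analysis"
    "HOL-Library.Poly_Mapping"
    "HOL-Library.Function_Algebras"
    "Jordan_Normal_Form.Matrix"
begin

no_notation Matrix.vec_index (infixl "$" 100)

section \<open>Affine Landau-Ginzburg B-models\<close>

text \<open>Since \<open>\<complex>\<close> is infinite, polynomials may be identified with polynomial functions.\<close>

inductive_set polyfun :: "(complex^'n \<Rightarrow> complex) set" where
  const: "(\<lambda>x. c) \<in> polyfun"
| coord: "(\<lambda>x. x $ i) \<in> polyfun"
| add: "\<lbrakk>p \<in> polyfun; q \<in> polyfun\<rbrakk> \<Longrightarrow> (\<lambda>x. p x + q x) \<in> polyfun"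
| mult: "\<lbrakk>p \<in> polyfun; q \<in> polyfun\<rbrakk> \<Longrightarrow> (\<lambda>x. p x * q x) \<in> polyfun"

definition algebraic_set :: "(complex^'n) set \<Rightarrow> bool" where
  "algebraic_set X \<longleftrightarrow> (\<exists>P \<subseteq> polyfun. X = {x. \<forall>p\<in>P. p x = 0})"

definition irreducible_closed :: "(complex^'n) set \<Rightarrow> bool" where
  "irreducible_closed Z \<longleftrightarrow> algebraic_set Z \<and> Z \<noteq> {} \<and>
     (\<forall>A B. algebraic_set A \<and> algebraic_set B \<and> Z \<subseteq> A \<union> B \<longrightarrow> Z \<subseteq> A \<or> Z \<subseteq> B)"

text \<open>The Krull dimension of the local ring of \<open>X\<close> at \<open>x\<close>, by chains of irreducible closed
  subsets through \<open>x\<close>; lengths of such chains are bounded, so \<open>Sup\<close> on \<open>nat\<close> is a maximum.\<close>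

definition local_dim :: "(complex^'n) set \<Rightarrow> complex^'n \<Rightarrow> nat" where
  "local_dim X x = Sup {d. \<exists>Z :: nat \<Rightarrow> (complex^'n) set.
     (\<forall>i\<le>d. irreducible_closed (Z i) \<and> x \<in> Z i \<and> Z i \<subseteq> X) \<and> (\<forall>i<d. Z i \<subset> Z (Suc i))}"

definition tangent_space :: "(complex^'n) set \<Rightarrow> complex^'n \<Rightarrow> (complex^'n) set" where
  "tangent_space X x = {v. \<forall>p\<in>polyfun. (\<forall>y\<in>X. p y = 0) \<longrightarrow> deriv (\<lambda>t. p (x + t *s v)) 0 = 0}"

definition smooth_algebraic_set :: "(complex^'n) set \<Rightarrow> bool" where
  "smooth_algebraic_set X \<longleftrightarrow> algebraic_set X \<and> (\<forall>x\<in>X. vec.dim (tangent_space X x) = local_dim X x)"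

class complex_comm_algebra = comm_ring_1 +
  fixes of_complex :: "complex \<Rightarrow> 'a"
  assumes of_complex_1: "of_complex 1 = 1"
    and of_complex_add: "of_complex (a + b) = of_complex a + of_complex b"
    and of_complex_mult: "of_complex (a * b) = of_complex a * of_complex b"

text \<open>The algebra of global regular functions of \<open>X\<close> is carried by the type \<open>'a\<close>: the map \<open>ev\<close>
  (evaluation at points, only relevant on \<open>X\<close>) is an isomorphism from \<open>'a\<close> to the algebra of
  restrictions to \<open>X\<close> of polynomials.\<close>

locale smooth_affine_variety =
  fixes X :: "(complex^'n) set"
    and ev :: "'a::complex_comm_algebra \<Rightarrow> complex^'n \<Rightarrow> complex"
  assumes smooth: "smooth_algebraic_set X"
    and ev_of_complex: "x \<in> X \<Longrightarrow> ev (of_complex c) x = c"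
    and ev_add: "x \<in> X \<Longrightarrow> ev (f + g) x = ev f x + ev g x"
    and ev_mult: "x \<in> X \<Longrightarrow> ev (f * g) x = ev f x * ev g x"
    and ev_inject: "(\<And>x. x \<in> X \<Longrightarrow> ev f x = ev g x) \<Longrightarrow> f = g"
    and ev_regular: "\<exists>p\<in>polyfun. \<forall>x\<in>X. ev f x = p x"
    and ev_onto: "p \<in> polyfun \<Longrightarrow> \<exists>f. \<forall>x\<in>X. ev f x = p x"

definition has_weight ::
  "(complex^'n) set \<Rightarrow> ('a \<Rightarrow> complex^'n \<Rightarrow> complex) \<Rightarrow> (complex \<Rightarrow> complex^'n \<Rightarrow> complex^'n)
    \<Rightarrow> 'a \<Rightarrow> int \<Rightarrow> bool" where
  "has_weight X ev act f w \<longleftrightarrow> (\<forall>l x. l \<noteq> 0 \<longrightarrow> x \<in> X \<longrightarrow> ev f (act l x) = l powi w * ev f x)"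

text \<open>In \<open>act_regular\<close> the coordinates of \<open>(l, x) \<mapsto> act l x\<close> are elements of
  \<open>\<complex>[l, l\<^sup>-\<^sup>1] \<otimes> \<complex>[X]\<close>, the coordinate ring of \<open>\<complex>\<^sup>* \<times> X\<close>.\<close>

locale affine_LG_model = smooth_affine_variety X ev
  for X :: "(complex^'n) set"
    and ev :: "'a::complex_comm_algebra \<Rightarrow> complex^'n \<Rightarrow> complex" +
  fixes act :: "complex \<Rightarrow> complex^'n \<Rightarrow> complex^'n"
    and W :: 'a
  assumes act_closed: "\<lbrakk>l \<noteq> 0; x \<in> X\<rbrakk> \<Longrightarrow> act l x \<in> X"
    and act_1: "x \<in> X \<Longrightarrow> act 1 x = x"
    and act_mult: "\<lbrakk>l \<noteq> 0; m \<noteq> 0; x \<in> X\<rbrakk> \<Longrightarrow> act (l * m) x = act l (act m x)"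
    and act_regular: "\<exists>(N::int) p. (\<forall>m. p m \<in> polyfun) \<and>
       (\<forall>l x. l \<noteq> 0 \<longrightarrow> x \<in> X \<longrightarrow> act l x $ i = (\<Sum>m=-N..N. l powi m * p m x))"
    and act_minus_1: "x \<in> X \<Longrightarrow> act (-1) x = x"
    and W_weight: "has_weight X ev act W 2"

section \<open>Differential forms\<close>

text \<open>The exterior algebra over \<open>'a\<close> of the Kaehler differentials of the \<open>\<complex>\<close>-algebra \<open>'a\<close>,
  presented as the ring generated by symbols \<open>f\<close> and \<open>df\<close>.\<close>

datatype 'a form_expr =
  Fn 'a | Df 'a | Plus "'a form_expr" "'a form_expr" | Neg "'a form_expr"
| Times "'a form_expr" "'a form_expr"

inductive form_eq :: "'a::complex_comm_algebra form_expr \<Rightarrow> 'a form_expr \<Rightarrow> bool" where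
  refl: "form_eq x x"
| sym: "form_eq x y \<Longrightarrow> form_eq y x"
| trans: "form_eq x y \<Longrightarrow> form_eq y z \<Longrightarrow> form_eq x z"
| cong_Plus: "form_eq x x' \<Longrightarrow> form_eq y y' \<Longrightarrow> form_eq (Plus x y) (Plus x' y')"
| cong_Neg: "form_eq x x' \<Longrightarrow> form_eq (Neg x) (Neg x')"
| cong_Times: "form_eq x x' \<Longrightarrow> form_eq y y' \<Longrightarrow> form_eq (Times x y) (Times x' y')"
| Plus_assoc: "form_eq (Plus (Plus x y) z) (Plus x (Plus y z))"
| Plus_commute: "form_eq (Plus x y) (Plus y x)"
| Plus_0: "form_eq (Plus (Fn 0) x) x"
| Plus_Neg: "form_eq (Plus (Neg x) x) (Fn 0)"
| Times_assoc: "form_eq (Times (Times x y) z) (Times x (Times y z))"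
| Times_1_left: "form_eq (Times (Fn 1) x) x"
| Times_1_right: "form_eq (Times x (Fn 1)) x"
| distrib_right: "form_eq (Times (Plus x y) z) (Plus (Times x z) (Times y z))"
| distrib_left: "form_eq (Times x (Plus y z)) (Plus (Times x y) (Times x z))"
| Fn_add: "form_eq (Fn (f + g)) (Plus (Fn f) (Fn g))"
| Fn_mult: "form_eq (Fn (f * g)) (Times (Fn f) (Fn g))"
| Fn_Df: "form_eq (Times (Fn f) (Df g)) (Times (Df g) (Fn f))"
| Df_add: "form_eq (Df (f + g)) (Plus (Df f) (Df g))"
| Df_mult: "form_eq (Df (f * g)) (Plus (Times (Fn f) (Df g)) (Times (Fn g) (Df f)))"
| Df_const: "form_eq (Df (of_complex c)) (Fn 0)"
| Df_Df: "form_eq (Times (Df f) (Df f)) (Fn 0)"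

quotient_type (overloaded) 'a forms = "'a::complex_comm_algebra form_expr" / form_eq
  by (rule equivpI) (auto intro!: reflpI sympI transpI intro: form_eq.refl form_eq.sym form_eq.trans)

text \<open>The degree 0 part, which shows that the algebra of forms is not the zero ring.\<close>

primrec form_eval :: "'a::complex_comm_algebra form_expr \<Rightarrow> 'a" where
  "form_eval (Fn f) = f"
| "form_eval (Df f) = 0"
| "form_eval (Plus x y) = form_eval x + form_eval y"
| "form_eval (Neg x) = - form_eval x"
| "form_eval (Times x y) = form_eval x * form_eval y"

lemma form_eval_cong: "form_eq x y \<Longrightarrow> form_eval x = form_eval y"
  by (induction rule: form_eq.induct) (simp_all add: algebra_simps)

instantiation forms :: (complex_comm_algebra) ring_1
begin

lift_definition zero_forms :: "'a forms" is "Fn 0" .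
lift_definition one_forms :: "'a forms" is "Fn 1" .
lift_definition plus_forms :: "'a forms \<Rightarrow> 'a forms \<Rightarrow> 'a forms" is Plus by (rule form_eq.cong_Plus)
lift_definition uminus_forms :: "'a forms \<Rightarrow> 'a forms" is Neg by (rule form_eq.cong_Neg)
lift_definition minus_forms :: "'a forms \<Rightarrow> 'a forms \<Rightarrow> 'a forms" is "\<lambda>x y. Plus x (Neg y)"
  by (blast intro: form_eq.cong_Plus form_eq.cong_Neg)
lift_definition times_forms :: "'a forms \<Rightarrow> 'a forms \<Rightarrow> 'a forms" is Times by (rule form_eq.cong_Times)

instance
proof
  fix a b c :: "'a forms"
  show "a + b + c = a + (b + c)" by transfer (rule form_eq.Plus_assoc)
  show "a + b = b + a" by transfer (rule form_eq.Plus_commute)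
  show "0 + a = a" by transfer (rule form_eq.Plus_0)
  show "- a + a = 0" by transfer (rule form_eq.Plus_Neg)
  show "a - b = a + - b" by transfer (rule form_eq.refl)
  show "a * b * c = a * (b * c)" by transfer (rule form_eq.Times_assoc)
  show "(a + b) * c = a * c + b * c" by transfer (rule form_eq.distrib_right)
  show "a * (b + c) = a * b + a * c" by transfer (rule form_eq.distrib_left)
  show "1 * a = a" by transfer (rule form_eq.Times_1_left)
  show "a * 1 = a" by transfer (rule form_eq.Times_1_right)
  show "(0::'a forms) \<noteq> 1" by transfer (auto dest: form_eval_cong)
qed

end

lift_definition of_fn :: "'a::complex_comm_algebra \<Rightarrow> 'a forms" is Fn .
lift_definition dform :: "'a::complex_comm_algebra \<Rightarrow> 'a forms" is Df .

definition form_scale :: "complex \<Rightarrow> 'a::complex_comm_algebra forms \<Rightarrow> 'a forms" where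
  "form_scale c \<omega> = of_fn (of_complex c) * \<omega>"

text \<open>From here on \<open>wt f w\<close> says that \<open>f\<close> has weight \<open>w\<close>. The total degree \<open>n\<close> part of the closed
  state space; its differential is left multiplication by \<open>dform W\<close>.\<close>

inductive_set closed_states :: "('a::complex_comm_algebra \<Rightarrow> int \<Rightarrow> bool) \<Rightarrow> int \<Rightarrow> 'a forms set"
  for wt n where
  zero: "0 \<in> closed_states wt n"
| add: "\<lbrakk>\<omega> \<in> closed_states wt n; \<eta> \<in> closed_states wt n\<rbrakk> \<Longrightarrow> \<omega> + \<eta> \<in> closed_states wt n"
| monomial: "\<lbrakk>wt f w; list_all2 wt fs ws; w + sum_list ws - int (length fs) = n\<rbrakk>
    \<Longrightarrow> of_fn f * prod_list (map dform fs) \<in> closed_states wt n"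

section \<open>Graded modules and B-branes\<close>

text \<open>A graded module is given by its graded pieces \<open>M i\<close> inside an ambient module with scalar
  multiplication \<open>sc\<close>; its underlying module is the (direct) sum of the pieces.\<close>

definition module_of :: "(int \<Rightarrow> 'm::ab_group_add set) \<Rightarrow> 'm set" where
  "module_of M = {\<Sum>i\<in>S. x i | S x. finite S \<and> (\<forall>i\<in>S. x i \<in> M i)}"

definition graded_module ::
  "('a \<Rightarrow> int \<Rightarrow> bool) \<Rightarrow> ('a \<Rightarrow> 'm::ab_group_add \<Rightarrow> 'm) \<Rightarrow> (int \<Rightarrow> 'm set) \<Rightarrow> bool" where
  "graded_module wt sc M \<longleftrightarrow>
     (\<forall>i. 0 \<in> M i \<and> (\<forall>x\<in>M i. \<forall>y\<in>M i. x - y \<in> M i)) \<and>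
     (\<forall>f w i. \<forall>x\<in>M i. wt f w \<longrightarrow> sc f x \<in> M (i + w)) \<and>
     (\<forall>S x. finite S \<and> (\<forall>i\<in>S. x i \<in> M i) \<and> (\<Sum>i\<in>S. x i) = 0 \<longrightarrow> (\<forall>i\<in>S. x i = 0))"

text \<open>Linear maps of degree \<open>n\<close>, extended by 0 outside of \<open>M\<close> so that equality of functions is
  equality of morphisms.\<close>

definition graded_hom ::
  "('a \<Rightarrow> 'm::ab_group_add \<Rightarrow> 'm) \<Rightarrow> ('a \<Rightarrow> 'l::ab_group_add \<Rightarrow> 'l)
    \<Rightarrow> (int \<Rightarrow> 'm set) \<Rightarrow> (int \<Rightarrow> 'l set) \<Rightarrow> int \<Rightarrow> ('m \<Rightarrow> 'l) set" where
  "graded_hom s1 s2 M N n = {f.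
     (\<forall>x\<in>module_of M. \<forall>y\<in>module_of M. f (x + y) = f x + f y) \<and>
     (\<forall>a. \<forall>x\<in>module_of M. f (s1 a x) = s2 a (f x)) \<and>
     (\<forall>i. \<forall>x\<in>M i. f x \<in> N (i + n)) \<and>
     (\<forall>x. x \<notin> module_of M \<longrightarrow> f x = 0)}"

text \<open>The free module \<open>\<Oplus>i<r. \<O>[\<sigma> i]\<close> of row vectors.\<close>

definition vec_scale :: "'a::comm_ring_1 \<Rightarrow> (nat \<Rightarrow> 'a) \<Rightarrow> nat \<Rightarrow> 'a" where
  "vec_scale a v = (\<lambda>j. a * v j)"

definition free_module ::
  "('a::comm_ring_1 \<Rightarrow> int \<Rightarrow> bool) \<Rightarrow> nat \<Rightarrow> (nat \<Rightarrow> int) \<Rightarrow> int \<Rightarrow> (nat \<Rightarrow> 'a) set" where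
  "free_module wt r \<sigma> i = {v. (\<forall>j<r. wt (v j) (i + \<sigma> j)) \<and> (\<forall>j\<ge>r. v j = 0)}"

definition unit_row :: "nat \<Rightarrow> nat \<Rightarrow> 'a::comm_ring_1" where
  "unit_row i = (\<lambda>j. if j = i then 1 else 0)"

text \<open>Finitely generated projective graded modules, as direct summands of free ones.\<close>

definition fg_projective ::
  "('a::comm_ring_1 \<Rightarrow> int \<Rightarrow> bool) \<Rightarrow> ('a \<Rightarrow> 'm::ab_group_add \<Rightarrow> 'm) \<Rightarrow> (int \<Rightarrow> 'm set) \<Rightarrow> bool" where
  "fg_projective wt sc M \<longleftrightarrow> graded_module wt sc M \<and>
     (\<exists>r \<sigma>. \<exists>\<iota> \<in> graded_hom sc vec_scale M (free_module wt r \<sigma>) 0.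
        \<exists>\<pi> \<in> graded_hom vec_scale sc (free_module wt r \<sigma>) M 0. \<forall>x\<in>module_of M. \<pi> (\<iota> x) = x)"

datatype 'm brane = Brane (piece: "int \<Rightarrow> 'm set") (dif: "'m \<Rightarrow> 'm")

definition branes ::
  "('a::comm_ring_1 \<Rightarrow> int \<Rightarrow> bool) \<Rightarrow> ('a \<Rightarrow> 'm::ab_group_add \<Rightarrow> 'm) \<Rightarrow> 'a \<Rightarrow> 'm brane set" where
  "branes wt sc W = {B. fg_projective wt sc (piece B) \<and>
     dif B \<in> graded_hom sc sc (piece B) (piece B) 1 \<and>
     (\<forall>x\<in>module_of (piece B). dif B (dif B x) = sc W x)}"

definition sign :: "int \<Rightarrow> 'b::ring_1" where
  "sign n = (if even n then 1 else - 1)"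

definition brane_delta ::
  "('a::comm_ring_1 \<Rightarrow> 'm::ab_group_add \<Rightarrow> 'm) \<Rightarrow> 'm brane \<Rightarrow> 'm brane \<Rightarrow> int \<Rightarrow> ('m \<Rightarrow> 'm) \<Rightarrow> 'm \<Rightarrow> 'm" where
  "brane_delta sc M N n f = (\<lambda>x. f (dif M x) - sc (sign n) (dif N (f x)))"

section \<open>The Hochschild complex\<close>

text \<open>\<open>Arrow a n b\<close> is a morphism \<open>b\<close> of degree \<open>n\<close> out of \<open>a\<close>. The tensor
  \<open>b\<^sub>0 \<otimes> \<dots> \<otimes> b\<^sub>k\<close> is the class of the word \<open>[b\<^sub>0, \<dots>, b\<^sub>k]\<close> in the quotient
  of the vector space freely generated by words by the multilinearity relations.\<close>

datatype 'm arrow = Arrow (src: "'m brane") (deg: int) (mor: "'m \<Rightarrow> 'm")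

type_synonym 'm hchain = "'m arrow list \<Rightarrow>\<^sub>0 complex"

definition tgt :: "'m arrow list \<Rightarrow> nat \<Rightarrow> 'm brane" where
  "tgt w i = src (w ! (Suc i mod length w))"

definition words ::
  "('a::comm_ring_1 \<Rightarrow> int \<Rightarrow> bool) \<Rightarrow> ('a \<Rightarrow> 'm::ab_group_add \<Rightarrow> 'm) \<Rightarrow> 'a \<Rightarrow> 'm arrow list set" where
  "words wt sc W = {w. w \<noteq> [] \<and> (\<forall>i<length w. src (w ! i) \<in> branes wt sc W \<and>
     mor (w ! i) \<in> graded_hom sc sc (piece (src (w ! i))) (piece (tgt w i)) (deg (w ! i)))}"

definition chain_scale :: "complex \<Rightarrow> 'm hchain \<Rightarrow> 'm hchain" where
  "chain_scale c = Poly_Mapping.map ((*) c)"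

abbreviation tens :: "'m arrow list \<Rightarrow> 'm hchain" where
  "tens w \<equiv> Poly_Mapping.single w 1"

definition hchains ::
  "('a::comm_ring_1 \<Rightarrow> int \<Rightarrow> bool) \<Rightarrow> ('a \<Rightarrow> 'm::ab_group_add \<Rightarrow> 'm) \<Rightarrow> 'a \<Rightarrow> 'm hchain set" where
  "hchains wt sc W = {x. Poly_Mapping.keys x \<subseteq> words wt sc W}"

definition hchains_deg ::
  "('a::comm_ring_1 \<Rightarrow> int \<Rightarrow> bool) \<Rightarrow> ('a \<Rightarrow> 'm::ab_group_add \<Rightarrow> 'm) \<Rightarrow> 'a \<Rightarrow> int \<Rightarrow> 'm hchain set" where
  "hchains_deg wt sc W n = {x \<in> hchains wt sc W. \<forall>w\<in>Poly_Mapping.keys x.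
     sum_list (map deg w) - (int (length w) - 1) = n}"

inductive_set multilinear_rel ::
  "('a::complex_comm_algebra \<Rightarrow> int \<Rightarrow> bool) \<Rightarrow> ('a \<Rightarrow> 'm::ab_group_add \<Rightarrow> 'm) \<Rightarrow> 'a \<Rightarrow> 'm hchain set"
  for wt sc W where
  zero: "0 \<in> multilinear_rel wt sc W"
| add: "\<lbrakk>x \<in> multilinear_rel wt sc W; y \<in> multilinear_rel wt sc W\<rbrakk> \<Longrightarrow> x + y \<in> multilinear_rel wt sc W"
| scale: "x \<in> multilinear_rel wt sc W \<Longrightarrow> chain_scale c x \<in> multilinear_rel wt sc W"
| additive: "\<lbrakk>u @ Arrow a n f # v \<in> words wt sc W; u @ Arrow a n g # v \<in> words wt sc W\<rbrakk> \<Longrightarrow>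
    tens (u @ Arrow a n (\<lambda>x. f x + g x) # v) - tens (u @ Arrow a n f # v) - tens (u @ Arrow a n g # v)
      \<in> multilinear_rel wt sc W"
| homogeneous: "u @ Arrow a n f # v \<in> words wt sc W \<Longrightarrow>
    tens (u @ Arrow a n (\<lambda>x. sc (of_complex c) (f x)) # v) - chain_scale c (tens (u @ Arrow a n f # v))
      \<in> multilinear_rel wt sc W"

definition hoch_rel ::
  "('a::complex_comm_algebra \<Rightarrow> int \<Rightarrow> bool) \<Rightarrow> ('a \<Rightarrow> 'm::ab_group_add \<Rightarrow> 'm) \<Rightarrow> 'a
    \<Rightarrow> ('m hchain \<times> 'm hchain) set" where
  "hoch_rel wt sc W = {(x, y). x \<in> hchains wt sc W \<and> y \<in> hchains wt sc W \<and> x - y \<in> multilinear_rel wt sc W}"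

definition hoch_class ::
  "('a::complex_comm_algebra \<Rightarrow> int \<Rightarrow> bool) \<Rightarrow> ('a \<Rightarrow> 'm::ab_group_add \<Rightarrow> 'm) \<Rightarrow> 'a
    \<Rightarrow> 'm hchain \<Rightarrow> 'm hchain set" where
  "hoch_class wt sc W x = hoch_rel wt sc W `` {x}"

definition hochschild ::
  "('a::complex_comm_algebra \<Rightarrow> int \<Rightarrow> bool) \<Rightarrow> ('a \<Rightarrow> 'm::ab_group_add \<Rightarrow> 'm) \<Rightarrow> 'a
    \<Rightarrow> 'm hchain set set" where
  "hochschild wt sc W = hchains wt sc W // hoch_rel wt sc W"

text \<open>Composition is written on the right: \<open>b\<^sub>i b\<^sub>i\<^sub>+\<^sub>1\<close> is the function \<open>b\<^sub>i\<^sub>+\<^sub>1 \<circ> b\<^sub>i\<close>.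
  On words of length one \<open>d\<^sub>2\<close> is zero.\<close>

definition hoch_d2 :: "'m arrow list \<Rightarrow> 'm hchain" where
  "hoch_d2 w = (let k = length w - 1; e = (\<lambda>i. deg (w ! i)) in
     (\<Sum>i<k. chain_scale (sign ((\<Sum>j\<le>i. e j) + int i + 1))
        (tens (take i w @
           Arrow (src (w ! i)) (e i + e (Suc i)) (mor (w ! Suc i) \<circ> mor (w ! i)) # drop (i + 2) w))) +
     (if k = 0 then 0 else
        chain_scale (sign (((\<Sum>j<k. e j) + int k + 1) * (e k + 1)))
          (tens (Arrow (src (w ! k)) (e k + e 0) (mor (w ! 0) \<circ> mor (w ! k)) # butlast (tl w)))))"

definition hoch_d1 :: "('a::comm_ring_1 \<Rightarrow> 'm::ab_group_add \<Rightarrow> 'm) \<Rightarrow> 'm arrow list \<Rightarrow> 'm hchain" where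
  "hoch_d1 sc w = (\<Sum>i<length w. chain_scale (sign ((\<Sum>j<i. deg (w ! j)) + int i))
     (tens (w[i := Arrow (src (w ! i)) (deg (w ! i) + 1)
                     (brane_delta sc (src (w ! i)) (tgt w i) (deg (w ! i)) (mor (w ! i)))])))"

definition chain_d :: "('a::comm_ring_1 \<Rightarrow> 'm::ab_group_add \<Rightarrow> 'm) \<Rightarrow> 'm hchain \<Rightarrow> 'm hchain" where
  "chain_d sc x = (\<Sum>w\<in>Poly_Mapping.keys x.
     chain_scale (Poly_Mapping.lookup x w) (hoch_d2 w + hoch_d1 sc w))"

definition hoch_d ::
  "('a::complex_comm_algebra \<Rightarrow> int \<Rightarrow> bool) \<Rightarrow> ('a \<Rightarrow> 'm::ab_group_add \<Rightarrow> 'm) \<Rightarrow> 'a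
    \<Rightarrow> 'm hchain set \<Rightarrow> 'm hchain set" where
  "hoch_d wt sc W C = (\<Union>x\<in>C. hoch_class wt sc W (chain_d sc x))"

text \<open>Chain maps from the Hochschild complex of branes to the closed state space.\<close>

definition hoch_chain_map ::
  "('a::complex_comm_algebra \<Rightarrow> int \<Rightarrow> bool) \<Rightarrow> ('a \<Rightarrow> 'm::ab_group_add \<Rightarrow> 'm) \<Rightarrow> 'a
    \<Rightarrow> ('m hchain set \<Rightarrow> 'a forms) \<Rightarrow> bool" where
  "hoch_chain_map wt sc W \<Phi> \<longleftrightarrow>
     (\<forall>x\<in>hchains wt sc W. \<forall>y\<in>hchains wt sc W.
        \<Phi> (hoch_class wt sc W (x + y)) = \<Phi> (hoch_class wt sc W x) + \<Phi> (hoch_class wt sc W y)) \<and>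
     (\<forall>c. \<forall>x\<in>hchains wt sc W.
        \<Phi> (hoch_class wt sc W (chain_scale c x)) = form_scale c (\<Phi> (hoch_class wt sc W x))) \<and>
     (\<forall>n. \<forall>x\<in>hchains_deg wt sc W n. \<Phi> (hoch_class wt sc W x) \<in> closed_states wt n) \<and>
     (\<forall>C\<in>hochschild wt sc W. hoch_d wt sc W C \<in> hochschild wt sc W \<and>
        \<Phi> (hoch_d wt sc W C) = dform W * \<Phi> C)"

section \<open>Matrices and traces\<close>

text \<open>A realization of a brane as a direct summand of a free module. Morphisms are extended by
  zero on the complement. The differential is extended to an endomorphism \<open>bigD\<close> of the free module
  which preserves the complement and squares to \<open>W\<close> there too, i.e. the complement is a brane as
  well (if \<open>D\<close> were extended by zero, the resulting map would in general not commute with the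
  differentials unless the complement is zero). If the
  module is itself free and realized by the identity, then \<open>bigD\<close> is just its differential.\<close>

record ('a, 'm) realization =
  rank :: nat
  shift :: "nat \<Rightarrow> int"
  incl :: "'m \<Rightarrow> nat \<Rightarrow> 'a"
  proj :: "(nat \<Rightarrow> 'a) \<Rightarrow> 'm"
  bigD :: "(nat \<Rightarrow> 'a) \<Rightarrow> nat \<Rightarrow> 'a"

definition realizes ::
  "('a::comm_ring_1 \<Rightarrow> int \<Rightarrow> bool) \<Rightarrow> ('a \<Rightarrow> 'm::ab_group_add \<Rightarrow> 'm) \<Rightarrow> 'a
    \<Rightarrow> ('a, 'm) realization \<Rightarrow> 'm brane \<Rightarrow> bool" where
  "realizes wt sc W R B \<longleftrightarrow> (let F = free_module wt (rank R) (shift R); M = piece B in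
     incl R \<in> graded_hom sc vec_scale M F 0 \<and>
     proj R \<in> graded_hom vec_scale sc F M 0 \<and>
     (\<forall>x\<in>module_of M. proj R (incl R x) = x) \<and>
     bigD R \<in> graded_hom vec_scale vec_scale F F 1 \<and>
     (\<forall>v\<in>module_of F. bigD R (bigD R v) = vec_scale W v) \<and>
     (\<forall>x\<in>module_of M. bigD R (incl R x) = incl R (dif B x)) \<and>
     (\<forall>v\<in>module_of F. proj R (bigD R v) = dif B (proj R v)))"

definition mor_mat ::
  "('a::comm_ring_1, 'm) realization \<Rightarrow> ('a, 'm) realization \<Rightarrow> ('m \<Rightarrow> 'm) \<Rightarrow> 'a mat" where
  "mor_mat R S \<alpha> = mat (rank R) (rank S) (\<lambda>(i, j). incl S (\<alpha> (proj R (unit_row i))) j)"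

definition dif_mat :: "('a::comm_ring_1, 'm) realization \<Rightarrow> 'a mat" where
  "dif_mat R = mat (rank R) (rank R) (\<lambda>(i, j). bigD R (unit_row i) j)"

definition supertrace :: "(nat \<Rightarrow> int) \<Rightarrow> 'b::ring_1 mat \<Rightarrow> 'b" where
  "supertrace \<sigma> B = (\<Sum>i<dim_row B. sign (\<sigma> i) * B $$ (i, i))"

definition arrow_mat ::
  "('m brane \<Rightarrow> ('a::comm_ring_1, 'm) realization) \<Rightarrow> 'm arrow list \<Rightarrow> nat \<Rightarrow> 'a mat" where
  "arrow_mat R w i = mor_mat (R (src (w ! i))) (R (tgt w i)) (mor (w ! i))"

text \<open>The summand of the explicit formula for \<open>w = [\<alpha>\<^sub>0, \<dots>, \<alpha>\<^sub>k]\<close> and \<open>s = [s\<^sub>0, \<dots>, s\<^sub>k]\<close>.\<close>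

definition tau :: "'m arrow list \<Rightarrow> nat list \<Rightarrow> int" where
  "tau w s = (let k = length w - 1 in
     \<lceil>real (k + (\<Sum>i\<le>k. s ! i)) / 2\<rceil> +
     (\<Sum>i=1..k. (int (\<Sum>j=1..i. s ! j) + int i) * (deg (w ! i) + 1)))"

definition explicit_term ::
  "('m brane \<Rightarrow> ('a::complex_comm_algebra, 'm) realization) \<Rightarrow> 'm arrow list \<Rightarrow> nat list \<Rightarrow> 'a forms" where
  "explicit_term R w s = (let k = length w - 1;
       dD = (\<lambda>i. map_mat dform (dif_mat (R (src (w ! i)))));
       d\<alpha> = (\<lambda>i. map_mat dform (arrow_mat R w i));
       B = foldl (\<lambda>P i. P * (dD i ^\<^sub>m (s ! i)) * d\<alpha> i) (map_mat of_fn (arrow_mat R w 0)) [1..<Suc k]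
             * (dD 0 ^\<^sub>m (s ! 0))
     in form_scale (sign (tau w s) / fact (k + (\<Sum>i\<le>k. s ! i)))
          (supertrace (shift (R (src (w ! 0)))) B))"

text \<open>The composite \<open>\<phi> \<circ> Tr \<circ> T\<^sub>d\<close>. A letter consists of the shifts of the source of a matrix,
  its degree and the matrix itself.\<close>

type_synonym 'a letter = "(nat \<Rightarrow> int) \<times> int \<times> 'a mat"

definition Td_word ::
  "('m brane \<Rightarrow> ('a::comm_ring_1, 'm) realization) \<Rightarrow> 'm arrow list \<Rightarrow> nat list \<Rightarrow> 'a letter list" where
  "Td_word R w s =
     concat (map (\<lambda>i. let R' = R (tgt w i) in
         (shift (R (src (w ! i))), deg (w ! i), arrow_mat R w i)
           # replicate (s ! (Suc i mod length w)) (shift R', 1, dif_mat R'))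
       [0..<length w])"

definition generalized_trace :: "'a letter list \<Rightarrow> ('a list \<Rightarrow>\<^sub>0 complex)" where
  "generalized_trace u = (let n = length u;
       shf = (\<lambda>j. fst (u ! j)); dg = (\<lambda>j. fst (snd (u ! j))); mt = (\<lambda>j. snd (snd (u ! j))) in
     (\<Sum>is\<in>{is. length is = n \<and> (\<forall>j<n. is ! j < dim_row (mt j))}.
        Poly_Mapping.single (map (\<lambda>j. mt j $$ (is ! j, is ! (Suc j mod n))) [0..<n])
          (sign (((\<Sum>j<n. dg j) + int n) * shf 0 (is ! 0) + (\<Sum>j=1..<n. shf j (is ! j))))))"

text \<open>The linear extension of \<open>f\<^sub>0 \<otimes> \<dots> \<otimes> f\<^sub>k \<mapsto> f\<^sub>0 df\<^sub>1 \<and> \<dots> \<and> df\<^sub>k / k!\<close>.\<close>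

definition phi :: "('a::complex_comm_algebra list \<Rightarrow>\<^sub>0 complex) \<Rightarrow> 'a forms" where
  "phi x = (\<Sum>fs\<in>Poly_Mapping.keys x.
     form_scale (Poly_Mapping.lookup x fs / fact (length fs - 1))
       (of_fn (hd fs) * prod_list (map dform (tl fs))))"

definition composite_term ::
  "('m brane \<Rightarrow> ('a::complex_comm_algebra, 'm) realization) \<Rightarrow> 'm arrow list \<Rightarrow> nat list \<Rightarrow> 'a forms" where
  "composite_term R w s = phi (generalized_trace (Td_word R w s))"

text \<open>The value of \<open>\<Sum>s\<^sub>0,\<dots>,s\<^sub>k \<ge> 0. g s\<close>, a sum with finitely many nonzero terms.\<close>

definition finite_sum_is :: "nat \<Rightarrow> (nat list \<Rightarrow> 'b::comm_monoid_add) \<Rightarrow> 'b \<Rightarrow> bool" where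
  "finite_sum_is n g v \<longleftrightarrow> finite {s. length s = n \<and> g s \<noteq> 0} \<and>
     v = (\<Sum>s | length s = n \<and> g s \<noteq> 0. g s)"

end

theory Submission
  imports Defs "HOL-Computational_Algebra.Formal_Power_Series"
begin

text \<open>Collect the differentials of all branes into one odd matrix \<open>D\<close> with \<open>D\<^sup>2 = W\<close>. The signs of the
  trace turn \<open>dD\<close> into an odd matrix \<open>\<eta>\<close> of one-forms whose commutator with \<open>D\<close> is \<open>dW\<close> up to sign, and
  the sums over \<open>s\<^sub>0, \<dots>, s\<^sub>k\<close> are generated by \<open>G = (1 - t \<eta>)\<^sup>-\<^sup>1\<close>: the value of the map is the trace of
  \<open>\<alpha>\<^sub>0 G d\<alpha>\<^sub>1 G \<cdots> d\<alpha>\<^sub>k G\<close> with \<open>t\<^sup>n\<close> replaced by \<open>1 / (k + n)!\<close>. Moving \<open>D\<close> once around this product does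
  not change the trace. On its way it produces the terms with \<open>\<delta>\<alpha>\<^sub>i\<close>, further terms which
  by \<open>t \<eta> G = G - 1\<close> telescope to the products of neighbouring \<open>\<alpha>\<^sub>i\<close>, and \<open>t dW G\<^sup>2\<close> in place of each
  of the \<open>k + 1\<close> factors \<open>G\<close>. As \<open>G\<^sup>2 = G + t G'\<close>, the last ones add up to \<open>dW\<close> times
  the image of the product under \<open>t (k + 1 + t d/dt)\<close>, and the factor \<open>k + n + 1\<close> so obtained is what is
  cancelled in \<open>1 / (k + n + 1)!\<close>.

  Forms of degree above \<open>n\<close> vanish already because all \<open>1\<close>-forms on \<open>X \<subseteq> \<complex>\<^sup>n\<close> are combinations of \<open>n\<close>
  differentials.\<close>

section \<open>The ring of forms\<close>

text \<open>The weight \<open>1 / (k + n)!\<close> is not multiplicative in \<open>n\<close>, so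
  \<open>t\<close> has to stay a formal variable until the trace is taken: identities are proved
  between power series, and \<open>Psi\<close>, which inserts the factorials, is only a linear
  functional on them. The coefficients lie in one ring of row-finite matrices indexed by the basis
  vectors of all branes. Thus \<open>D\<close> is the same for a word and for every term of its
  differential, and only the trace is restricted to finitely many branes. The sign that the
  generalized trace attaches to an index is absorbed by a diagonal parity matrix \<open>eps\<close>.
  An odd matrix of one-forms, even in total parity, then obeys plain commutation rules, hence the
  commutators and the geometric series of \<open>eta\<close>. A differential extended by zero to a
  free module squares to \<open>W\<close> only on the summand. Therefore a realization contains a
  differential on the whole free module, and its existence needs a construction. The composite and
  the explicit formula are compared with the same trace; the sign given by \<tau> arises when all
  factors \<open>eps\<close> are collected at the right end.\<close>

lemma of_complex_0 [simp]: "of_complex 0 = 0"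
  using of_complex_add[of 0 0] by simp

lemma of_complex_minus: "of_complex (- c) = - of_complex c"
  using of_complex_add[of c "- c"] by (simp add: eq_neg_iff_add_eq_0 add.commute)

lemma of_fn_0 [simp]: "of_fn 0 = 0"
  by transfer (rule form_eq.refl)

lemma of_fn_1 [simp]: "of_fn 1 = 1"
  by transfer (rule form_eq.refl)

lemma of_fn_add: "of_fn (f + g) = of_fn f + of_fn g"
  by transfer (rule form_eq.Fn_add)

lemma of_fn_mult: "of_fn (f * g) = of_fn f * of_fn g"
  by transfer (rule form_eq.Fn_mult)

lemma of_fn_minus: "of_fn (- f) = - of_fn f"
  using of_fn_add[of f "- f"] by (simp add: eq_neg_iff_add_eq_0 add.commute)

lemma of_fn_commute: "of_fn f * of_fn g = of_fn g * of_fn f"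
  by (metis of_fn_mult mult.commute)

lemma of_fn_dform_commute: "of_fn f * dform g = dform g * of_fn f"
  by transfer (rule form_eq.Fn_Df)

lemma dform_add: "dform (f + g) = dform f + dform g"
  by transfer (rule form_eq.Df_add)

lemma dform_mult: "dform (f * g) = of_fn f * dform g + of_fn g * dform f"
  by transfer (rule form_eq.Df_mult)

lemma dform_of_complex [simp]: "dform (of_complex c) = 0"
  by transfer (rule form_eq.Df_const)

lemma dform_0 [simp]: "dform 0 = 0"
  using dform_of_complex[of 0] by simp

lemma dform_1 [simp]: "dform 1 = 0"
  using dform_of_complex[of 1] by (simp add: of_complex_1)

lemma dform_minus: "dform (- f) = - dform f"
  using dform_add[of f "- f"] by (simp add: eq_neg_iff_add_eq_0 add.commute)

lemma dform_square: "dform f * dform f = 0"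
  by transfer (rule form_eq.Df_Df)

text \<open>Polarization: expand the square of \<open>dform (f + g)\<close>, which is zero.\<close>

lemma dform_anticommute: "dform f * dform g = - (dform g * dform f)"
  using dform_square[of "f + g"]
  by (simp add: dform_add algebra_simps dform_square eq_neg_iff_add_eq_0)

text \<open>Centrality is checked on representatives: a form is represented by an expression in
  functions and differentials, and functions commute with both kinds of generators.\<close>

lemma of_fn_central: "of_fn f * x = x * of_fn f"
proof (transfer fixing: f)
  fix x :: "'a form_expr"
  have "of_fn f * abs_forms x = abs_forms x * of_fn f"
  proof (induction x)
    case (Fn g)
    then show ?case using of_fn_commute by (simp add: of_fn.abs_eq)
  next
    case (Df g)
    then show ?case using of_fn_dform_commute by (simp add: dform.abs_eq)
  next
    case (Plus x y)
    then show ?case by (simp flip: plus_forms.abs_eq add: algebra_simps)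
  next
    case (Neg x)
    then show ?case by (simp flip: uminus_forms.abs_eq)
  next
    case (Times x y)
    then show ?case by (simp flip: times_forms.abs_eq) (metis mult.assoc)
  qed
  then show "form_eq (Times (Fn f) x) (Times x (Fn f))"
    by (simp add: of_fn.abs_eq times_forms.abs_eq forms.abs_eq_iff)
qed

lemma form_scale_add: "form_scale c (x + y) = form_scale c x + form_scale c y"
  by (simp add: form_scale_def algebra_simps)

lemma form_scale_0 [simp]: "form_scale c 0 = 0"
  by (simp add: form_scale_def)

lemma form_scale_zero [simp]: "form_scale 0 x = 0"
  by (simp add: form_scale_def)

lemma form_scale_one [simp]: "form_scale 1 x = x"
  by (simp add: form_scale_def of_complex_1)

lemma form_scale_minus: "form_scale c (- x) = - form_scale c x"
  by (simp add: form_scale_def)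

lemma form_scale_minus_left: "form_scale (- c) x = - form_scale c x"
  by (simp add: form_scale_def of_complex_minus of_fn_minus)

lemma form_scale_add_left: "form_scale (c + d) x = form_scale c x + form_scale d x"
  by (simp add: form_scale_def of_complex_add of_fn_add algebra_simps)

lemma form_scale_scale: "form_scale c (form_scale d x) = form_scale (c * d) x"
  by (simp add: form_scale_def of_complex_mult of_fn_mult mult.assoc)

lemma form_scale_sum: "form_scale c (sum f S) = (\<Sum>i\<in>S. form_scale c (f i))"
  by (simp add: form_scale_def sum_distrib_left)

lemma form_scale_mult_right: "x * form_scale c y = form_scale c (x * y)"
  unfolding form_scale_def by (metis mult.assoc of_fn_central)

lemma sign_add: "sign (m + n) = sign m * (sign n :: 'b::ring_1)"
  by (auto simp: sign_def)

lemma sign_square [simp]: "sign n * (sign n :: 'b::ring_1) = 1"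
  by (auto simp: sign_def)

lemma sign_eq: "even (m + n) \<Longrightarrow> sign m = (sign n :: 'b::ring_1)"
  by (auto simp: sign_def)

lemma sign_Suc: "sign (n + 1) = - (sign n :: 'b::ring_1)" "sign (1 + n) = - (sign n :: 'b::ring_1)"
  by (auto simp: sign_def)

lemma sign_0 [simp]: "sign 0 = (1 :: 'b::ring_1)" and sign_1 [simp]: "sign 1 = (- 1 :: 'b::ring_1)"
  by (auto simp: sign_def)

lemma form_scale_sign: "form_scale (sign n) x = sign n * x"
  by (auto simp: sign_def form_scale_minus_left)

lemma form_scale_sign_mult: "form_scale c (sign n * x) = sign n * form_scale c x"
  by (auto simp: sign_def form_scale_minus)

section \<open>Form degree\<close>

inductive_set form_degree :: "nat \<Rightarrow> 'a::complex_comm_algebra forms set" for n where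
  zero: "0 \<in> form_degree n"
| add: "\<lbrakk>x \<in> form_degree n; y \<in> form_degree n\<rbrakk> \<Longrightarrow> x + y \<in> form_degree n"
| monomial: "length fs = n \<Longrightarrow> of_fn f * prod_list (map dform fs) \<in> form_degree n"

lemma form_degree_sum: "(\<And>i. i \<in> S \<Longrightarrow> f i \<in> form_degree n) \<Longrightarrow> sum f S \<in> form_degree n"
  by (induction S rule: infinite_finite_induct) (auto intro: form_degree.intros)

lemma form_degree_mult:
  assumes "x \<in> form_degree m" "y \<in> form_degree n"
  shows "x * y \<in> form_degree (m + n)"
  using assms(1)
proof induction
  case (monomial fs f)
  note fs = this
  show ?case using assms(2)
  proof induction
    case (monomial gs g)
    have "of_fn f * prod_list (map dform fs) * (of_fn g * prod_list (map dform gs))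
        = of_fn (f * g) * prod_list (map dform (fs @ gs))"
      by (simp add: of_fn_mult mult.assoc) (metis mult.assoc of_fn_central)
    then show ?case using form_degree.monomial[of "fs @ gs" "m + n" "f * g"] fs monomial by simp
  qed (auto simp: ring_distribs intro: form_degree.zero form_degree.add)
qed (auto simp: ring_distribs intro: form_degree.intros)

lemma of_fn_form_degree: "of_fn f \<in> form_degree 0"
  using form_degree.monomial[of "[]" 0 f] by simp

lemma dform_form_degree: "dform f \<in> form_degree 1"
  using form_degree.monomial[of "[f]" 1 1] by simp

lemma sign_form_degree: "x \<in> form_degree n \<Longrightarrow> sign m * x \<in> form_degree n"
  using form_degree_mult[OF of_fn_form_degree[of "sign m"], of x n]
  by (auto simp: sign_def of_fn_minus)

section \<open>Row-finite matrices\<close>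

text \<open>The index set will be infinite, so arbitrary matrices cannot be multiplied. Finite rows
  suffice for products and are preserved by them; unlike finite support, the condition admits the
  identity and the differentials of all branes at once.\<close>

typedef (overloaded) ('i, 'b::ring_1) rfm = "{f :: 'i \<Rightarrow> 'i \<Rightarrow> 'b. \<forall>i. finite {j. f i j \<noteq> 0}}"
  morphisms ent Abs_rfm
  by (rule exI[of _ "\<lambda>_ _. 0"]) simp

setup_lifting type_definition_rfm

lemma finite_row: "finite {j. ent X i j \<noteq> 0}"
  using ent[of X] by simp

lemma rfm_eqI: "(\<And>i j. ent X i j = ent Y i j) \<Longrightarrow> X = Y"
  by (metis ent_inject ext)

instantiation rfm :: (type, ring_1) ring_1
begin

lift_definition zero_rfm :: "('a, 'b) rfm" is "\<lambda>_ _. 0" by simp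
lift_definition one_rfm :: "('a, 'b) rfm" is "\<lambda>i j. if i = j then 1 else 0" by simp
lift_definition plus_rfm :: "('a, 'b) rfm \<Rightarrow> ('a, 'b) rfm \<Rightarrow> ('a, 'b) rfm" is "\<lambda>f g i j. f i j + g i j"
proof -
  fix f g :: "'a \<Rightarrow> 'a \<Rightarrow> 'b" and i
  assume "\<And>i. finite {j. f i j \<noteq> 0}" "\<And>i. finite {j. g i j \<noteq> 0}"
  then show "finite {j. f i j + g i j \<noteq> 0}"
    by - (rule finite_subset[of _ "{j. f i j \<noteq> 0} \<union> {j. g i j \<noteq> 0}"], auto)
qed
lift_definition uminus_rfm :: "('a, 'b) rfm \<Rightarrow> ('a, 'b) rfm" is "\<lambda>f i j. - f i j" by simp
lift_definition minus_rfm :: "('a, 'b) rfm \<Rightarrow> ('a, 'b) rfm \<Rightarrow> ('a, 'b) rfm" is "\<lambda>f g i j. f i j - g i j"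
proof -
  fix f g :: "'a \<Rightarrow> 'a \<Rightarrow> 'b" and i
  assume "\<And>i. finite {j. f i j \<noteq> 0}" "\<And>i. finite {j. g i j \<noteq> 0}"
  then show "finite {j. f i j - g i j \<noteq> 0}"
    by - (rule finite_subset[of _ "{j. f i j \<noteq> 0} \<union> {j. g i j \<noteq> 0}"], auto)
qed
lift_definition times_rfm :: "('a, 'b) rfm \<Rightarrow> ('a, 'b) rfm \<Rightarrow> ('a, 'b) rfm" is
  "\<lambda>f g i k. \<Sum>j\<in>{j. f i j \<noteq> 0}. f i j * g j k"
proof -
  fix f g :: "'a \<Rightarrow> 'a \<Rightarrow> 'b" and i
  assume *: "\<And>i. finite {j. f i j \<noteq> 0}" "\<And>i. finite {j. g i j \<noteq> 0}"
  have "{k. (\<Sum>j\<in>{j. f i j \<noteq> 0}. f i j * g j k) \<noteq> 0} \<subseteq> (\<Union>j\<in>{j. f i j \<noteq> 0}. {k. g j k \<noteq> 0})"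
  proof (rule subsetI, rule ccontr)
    fix k assume k: "k \<in> {k. (\<Sum>j\<in>{j. f i j \<noteq> 0}. f i j * g j k) \<noteq> 0}"
      "k \<notin> (\<Union>j\<in>{j. f i j \<noteq> 0}. {k. g j k \<noteq> 0})"
    then have "(\<Sum>j\<in>{j. f i j \<noteq> 0}. f i j * g j k) = 0" by (intro sum.neutral) auto
    then show False using k by simp
  qed
  then show "finite {k. (\<Sum>j\<in>{j. f i j \<noteq> 0}. f i j * g j k) \<noteq> 0}"
    by (rule finite_subset) (use * in auto)
qed

lemma ent_zero [simp]: "ent 0 i j = 0" by transfer simp
lemma ent_one: "ent 1 i j = (if i = j then 1 else 0)" by transfer simp
lemma ent_add [simp]: "ent (X + Y) i j = ent X i j + ent Y i j" by transfer simp
lemma ent_uminus [simp]: "ent (- X) i j = - ent X i j" by transfer simp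
lemma ent_minus [simp]: "ent (X - Y) i j = ent X i j - ent Y i j" by transfer simp

lemma ent_times:
  assumes "finite J" "\<And>j. ent X i j \<noteq> 0 \<Longrightarrow> j \<in> J"
  shows "ent (X * Y) i k = (\<Sum>j\<in>J. ent X i j * ent Y j k)"
proof -
  have "ent (X * Y) i k = (\<Sum>j\<in>{j. ent X i j \<noteq> 0}. ent X i j * ent Y j k)"
    by transfer simp
  also have "\<dots> = (\<Sum>j\<in>J. ent X i j * ent Y j k)"
    using assms by (intro sum.mono_neutral_left) auto
  finally show ?thesis .
qed

lemma ent_times_row: "ent (X * Y) i k = (\<Sum>j\<in>{j. ent X i j \<noteq> 0}. ent X i j * ent Y j k)"
  by (rule ent_times) (auto simp: finite_row)

instance
proof
  fix a b c :: "('a, 'b) rfm"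
  show "a + b + c = a + (b + c)" "a + b = b + a" "0 + a = a" "- a + a = 0" "a - b = a + - b"
    by (rule rfm_eqI; simp add: ac_simps)+
  show "1 * a = a"
  proof (rule rfm_eqI)
    fix i k show "ent (1 * a) i k = ent a i k"
      by (subst ent_times[where J = "{i}"]) (auto simp: ent_one split: if_splits)
  qed
  show "a * 1 = a"
    by (rule rfm_eqI, subst ent_times_row)
      (auto simp: ent_one if_distrib finite_row cong: if_cong)
  show "(0 :: ('a, 'b) rfm) \<noteq> 1"
    by (metis ent_one ent_zero zero_neq_one)
  show "a * (b + c) = a * b + a * c"
    by (rule rfm_eqI) (simp add: ent_times_row ring_distribs sum.distrib)
  show "(a + b) * c = a * c + b * c"
  proof (rule rfm_eqI)
    fix i k
    let ?J = "{j. ent a i j \<noteq> 0} \<union> {j. ent b i j \<noteq> 0}"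
    have "ent (X * c) i k = (\<Sum>j\<in>?J. ent X i j * ent c j k)" if "X \<in> {a, b, a + b}" for X
      by (rule ent_times) (use that in \<open>auto simp: finite_row\<close>)
    then show "ent ((a + b) * c) i k = ent (a * c + b * c) i k"
      by (simp add: ring_distribs sum.distrib)
  qed
  show "a * b * c = a * (b * c)"
  proof (rule rfm_eqI)
    fix i l
    let ?J = "{j. ent a i j \<noteq> 0}"
    let ?K = "\<Union>j\<in>?J. {k. ent b j k \<noteq> 0}"
    have fin: "finite ?J" "finite ?K" by (auto simp: finite_row)
    have ab: "ent (a * b) i k = (\<Sum>j\<in>?J. ent a i j * ent b j k)" for k
      by (rule ent_times_row)
    have "ent (a * b * c) i l = (\<Sum>k\<in>?K. ent (a * b) i k * ent c k l)"
    proof (rule ent_times[OF fin(2)], rule ccontr)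
      fix k assume "ent (a * b) i k \<noteq> 0" "k \<notin> ?K"
      then show False unfolding ab by (metis (mono_tags, lifting) UN_iff mem_Collect_eq mult_zero_right sum.neutral)
    qed
    also have "\<dots> = (\<Sum>j\<in>?J. \<Sum>k\<in>?K. ent a i j * ent b j k * ent c k l)"
      by (simp add: ab sum_distrib_right) (rule sum.swap)
    also have "\<dots> = (\<Sum>j\<in>?J. ent a i j * ent (b * c) j l)"
    proof (rule sum.cong[OF HOL.refl])
      fix j assume "j \<in> ?J"
      then have "ent (b * c) j l = (\<Sum>k\<in>?K. ent b j k * ent c k l)"
        by (intro ent_times[OF fin(2)]) auto
      then show "(\<Sum>k\<in>?K. ent a i j * ent b j k * ent c k l) = ent a i j * ent (b * c) j l"
        by (simp add: sum_distrib_left mult.assoc)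
    qed
    also have "\<dots> = ent (a * (b * c)) i l"
      by (rule ent_times_row[symmetric])
    finally show "ent (a * b * c) i l = ent (a * (b * c)) i l" .
  qed
qed

end

lemma ent_times_nonzeroE:
  assumes "ent (X * Y) i k \<noteq> 0"
  obtains j where "ent X i j \<noteq> 0" "ent Y j k \<noteq> 0"
proof (rule ccontr)
  assume "\<not> thesis"
  then have "(\<Sum>j\<in>{j. ent X i j \<noteq> 0}. ent X i j * ent Y j k) = 0"
    by (intro sum.neutral) (use that in fastforce)
  then show False using assms by (simp add: ent_times_row)
qed

lemma ent_sign [simp]: "ent (sign n * X) i j = sign n * ent X i j"
  by (auto simp: sign_def)

section \<open>Diagonal matrices and entrywise maps\<close>

lift_definition diag :: "('i \<Rightarrow> 'b) \<Rightarrow> ('i, 'b::ring_1) rfm" is "\<lambda>f i j. if i = j then f i else 0"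
  by simp

lemma ent_diag: "ent (diag f) i j = (if i = j then f i else 0)"
  by transfer simp

lemma ent_diag_times [simp]: "ent (diag f * X) i j = f i * ent X i j"
  by (subst ent_times[where J = "{i}"]) (auto simp: ent_diag split: if_splits)

lemma ent_times_diag [simp]: "ent (X * diag f) i j = ent X i j * f j"
proof -
  have "ent (X * diag f) i j = (\<Sum>l\<in>{l. ent X i l \<noteq> 0}. if l = j then ent X i l * f j else 0)"
    unfolding ent_times_row by (rule sum.cong) (auto simp: ent_diag)
  then show ?thesis by (auto simp: finite_row)
qed

text \<open>Zero entries go to zero whatever \<open>h\<close> is, which keeps the rows finite. For
  \<open>h 0 = 0\<close> this is plain entrywise application.\<close>

lift_definition rmap :: "('b \<Rightarrow> 'c) \<Rightarrow> ('i, 'b::ring_1) rfm \<Rightarrow> ('i, 'c::ring_1) rfm" is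
  "\<lambda>h f i j. if f i j = 0 then 0 else h (f i j)"
proof -
  fix h :: "'b \<Rightarrow> 'c" and f :: "'i \<Rightarrow> 'i \<Rightarrow> 'b" and i
  assume "\<And>i. finite {j. f i j \<noteq> 0}"
  then show "finite {j. (if f i j = 0 then 0 else h (f i j)) \<noteq> 0}"
    by - (rule finite_subset[of _ "{j. f i j \<noteq> 0}"], auto)
qed

lemma ent_rmap: "h 0 = 0 \<Longrightarrow> ent (rmap h X) i j = h (ent X i j)"
  by transfer simp

abbreviation fn_mat :: "('i, 'a::complex_comm_algebra) rfm \<Rightarrow> ('i, 'a forms) rfm" where
  "fn_mat \<equiv> rmap of_fn"

abbreviation d_mat :: "('i, 'a::complex_comm_algebra) rfm \<Rightarrow> ('i, 'a forms) rfm" where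
  "d_mat \<equiv> rmap dform"

lemma ent_fn_mat [simp]: "ent (fn_mat X) i j = of_fn (ent X i j)"
  and ent_d_mat [simp]: "ent (d_mat X) i j = dform (ent X i j)"
  by (simp_all add: ent_rmap)

lemma of_fn_sum: "of_fn (sum f S) = (\<Sum>i\<in>S. of_fn (f i))"
  by (induction S rule: infinite_finite_induct) (auto simp: of_fn_add)

lemma dform_sum: "dform (sum f S) = (\<Sum>i\<in>S. dform (f i))"
  by (induction S rule: infinite_finite_induct) (auto simp: dform_add)

lemma fn_mat_add: "fn_mat (X + Y) = fn_mat X + fn_mat Y"
  and d_mat_add: "d_mat (X + Y) = d_mat X + d_mat Y"
  by (auto intro!: rfm_eqI simp: of_fn_add dform_add)

lemma fn_mat_sign: "fn_mat (sign n * X) = sign n * fn_mat X"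
  and d_mat_sign: "d_mat (sign n * X) = sign n * d_mat X"
  by (auto intro!: rfm_eqI simp: of_fn_minus dform_minus sign_def)

lemma fn_mat_minus: "fn_mat (X - Y) = fn_mat X - fn_mat Y"
  and d_mat_minus: "d_mat (X - Y) = d_mat X - d_mat Y"
  using fn_mat_add[of "X - Y" Y] d_mat_add[of "X - Y" Y] by simp_all

lemma fn_mat_mult: "fn_mat (X * Y) = fn_mat X * fn_mat Y"
proof (rule rfm_eqI)
  fix i k
  show "ent (fn_mat (X * Y)) i k = ent (fn_mat X * fn_mat Y) i k"
    by (subst ent_times[where J = "{j. ent X i j \<noteq> 0}"])
      (auto simp: finite_row ent_times_row of_fn_sum of_fn_mult)
qed

lemma d_mat_mult: "d_mat (X * Y) = d_mat X * fn_mat Y + fn_mat X * d_mat Y"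
proof (rule rfm_eqI)
  fix i k
  let ?J = "{j. ent X i j \<noteq> 0}"
  have "ent (d_mat X * fn_mat Y) i k = (\<Sum>j\<in>?J. dform (ent X i j) * of_fn (ent Y j k))"
    by (subst ent_times[where J = ?J]) (auto simp: finite_row)
  moreover have "ent (fn_mat X * d_mat Y) i k = (\<Sum>j\<in>?J. of_fn (ent X i j) * dform (ent Y j k))"
    by (subst ent_times[where J = ?J]) (auto simp: finite_row)
  ultimately show "ent (d_mat (X * Y)) i k = ent (d_mat X * fn_mat Y + fn_mat X * d_mat Y) i k"
    by (simp add: ent_times_row dform_sum dform_mult of_fn_dform_commute sum.distrib add.commute)
qed

section \<open>Products in rings of power series\<close>

text \<open>The graded commutator with \<open>d\<close> is a derivation. Each factor carries its own
  parity as a label, so no grading of the ring itself has to be set up.\<close>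

lemma graded_commutator_prod_list:
  fixes d :: "'r::ring_1"
  shows "d * prod_list (map fst ys) - sign (sum_list (map snd ys)) * prod_list (map fst ys) * d =
    (\<Sum>i<length ys. sign (sum_list (map snd (take i ys))) * prod_list (map fst (take i ys)) *
       (d * fst (ys ! i) - sign (snd (ys ! i)) * fst (ys ! i) * d) * prod_list (map fst (drop (Suc i) ys)))"
proof (induction ys)
  case (Cons y ys)
  obtain x q where y: "y = (x, q)" by (cases y)
  let ?P = "prod_list (map fst ys)"
  have "d * (x * ?P) - sign (q + sum_list (map snd ys)) * (x * ?P) * d =
      (d * x - sign q * x * d) * ?P + sign q * x * (d * ?P - sign (sum_list (map snd ys)) * ?P * d)"
    by (auto simp: sign_def algebra_simps)
  also have "sign q * x * (d * ?P - sign (sum_list (map snd ys)) * ?P * d) =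
      (\<Sum>i<length ys. sign (q + sum_list (map snd (take i ys))) * (x * prod_list (map fst (take i ys))) *
       (d * fst (ys ! i) - sign (snd (ys ! i)) * fst (ys ! i) * d) * prod_list (map fst (drop (Suc i) ys)))"
    unfolding Cons.IH sum_distrib_left
    by (rule sum.cong[OF HOL.refl]) (auto simp: sign_def algebra_simps)
  finally show ?case by (simp add: y sum.lessThan_Suc_shift del: sum.lessThan_Suc)
qed simp

text \<open>The Euler operator \<open>t d/dt\<close>. It remains a derivation over a noncommutative
  ring because natural numbers and the series variable are central.\<close>

definition theta :: "'r::ring_1 fps \<Rightarrow> 'r fps" where
  "theta F = Abs_fps (\<lambda>m. of_nat m * fps_nth F m)"

lemma theta_nth [simp]: "fps_nth (theta F) m = of_nat m * fps_nth F m"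
  by (simp add: theta_def)

lemma of_nat_central: "of_nat m * x = x * (of_nat m :: 'r::ring_1)"
  by (rule mult_of_nat_commute)

lemma theta_mult: "theta (F * H) = theta F * H + F * theta H"
proof (rule fps_ext)
  fix n
  have "of_nat n * (fps_nth F i * fps_nth H (n - i)) =
      of_nat i * fps_nth F i * fps_nth H (n - i) + fps_nth F i * (of_nat (n - i) * fps_nth H (n - i))"
    if "i \<le> n" for i
  proof -
    have "of_nat n = (of_nat i + of_nat (n - i) :: 'a)" using that by (simp flip: of_nat_add)
    then show ?thesis by (simp add: ring_distribs mult.assoc) (metis mult.assoc of_nat_central)
  qed
  then show "fps_nth (theta (F * H)) n = fps_nth (theta F * H + F * theta H) n"
    by (simp add: fps_mult_nth sum_distrib_left sum.distrib)
qed

lemma theta_const [simp]: "theta (fps_const x) = 0"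
  by (rule fps_ext) simp

lemma theta_one [simp]: "theta 1 = 0"
  by (rule fps_ext) (simp add: fps_one_nth)

lemma theta_prod_list:
  "theta (prod_list ys) =
    (\<Sum>i<length ys. prod_list (take i ys) * theta (ys ! i) * prod_list (drop (Suc i) ys))"
proof (induction ys)
  case (Cons y ys)
  then show ?case
    by (simp add: theta_mult sum_distrib_left mult.assoc sum.lessThan_Suc_shift del: sum.lessThan_Suc)
qed simp

lemma prod_list_take_nth_drop:
  "i < length ys \<Longrightarrow> prod_list (take i ys) * ys ! i * prod_list (drop (Suc i) ys) = prod_list ys"
  by (metis id_take_nth_drop mult.assoc prod_list.Cons prod_list.append)

lemma mult_assoc_eq: "x * y = w \<Longrightarrow> x * (y * z) = w * (z :: 'b::semigroup_mult)"
  by (simp flip: mult.assoc)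

lemma sign_sign: "sign n * (sign n * x) = (x :: 'b::ring_1)"
  by (simp add: sign_def)

lemma sign_fps_nth [simp]: "fps_nth (sign n * F) m = sign n * fps_nth F m"
  by (auto simp: sign_def)

lemma sign_fps_const: "fps_const (sign n * x) = sign n * fps_const x"
  by (auto simp: sign_def)

lemma fps_X_left: "F * (fps_X * H) = fps_X * (F * (H :: 'r::ring_1 fps))"
  by (metis fps_mult_fps_X_commute mult.assoc)

section \<open>The chain map for matrix factorizations\<close>

text \<open>Only parity is recorded, but \<open>p\<close> ranges over the integers so that degrees
  of morphisms can be inserted as they are.\<close>

definition homog :: "('i \<Rightarrow> int) \<Rightarrow> int \<Rightarrow> ('i, 'b::ring_1) rfm \<Rightarrow> bool" where
  "homog par p X \<longleftrightarrow> (\<forall>i j. ent X i j \<noteq> 0 \<longrightarrow> even (p + par i + par j))"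

lemma homog_0 [simp]: "homog par p 0"
  by (simp add: homog_def)

lemma homog_1: "homog par 0 1"
  by (auto simp: homog_def ent_one)

lemma homog_add: "homog par p X \<Longrightarrow> homog par p Y \<Longrightarrow> homog par p (X + Y)"
  unfolding homog_def by (metis add.right_neutral add.commute ent_add)

lemma homog_sum: "(\<And>s. s \<in> S \<Longrightarrow> homog par p (f s)) \<Longrightarrow> homog par p (sum f S)"
  by (induction S rule: infinite_finite_induct) (auto intro: homog_add)

lemma homog_mult: "homog par p X \<Longrightarrow> homog par q Y \<Longrightarrow> homog par (p + q) (X * Y)"
proof -
  assume X: "homog par p X" and Y: "homog par q Y"
  show ?thesis unfolding homog_def
  proof (intro allI impI)
    fix i k assume "ent (X * Y) i k \<noteq> 0"
    then obtain j where "ent X i j \<noteq> 0" "ent Y j k \<noteq> 0" by (rule ent_times_nonzeroE)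
    then have "even (p + par i + par j)" "even (q + par j + par k)"
      using X Y by (auto simp: homog_def)
    then show "even (p + q + par i + par k)" by presburger
  qed
qed

lemma homog_rmap: "h 0 = 0 \<Longrightarrow> homog par p X \<Longrightarrow> homog par p (rmap h X)"
  unfolding homog_def by (metis ent_rmap)

lemma homog_diag: "homog par 0 (diag f)"
  by (auto simp: homog_def ent_diag)

lemma homog_eps_commute:
  assumes "homog par p X"
  shows "X * diag (\<lambda>i. sign (par i)) = sign p * (diag (\<lambda>i. sign (par i)) * X)"
proof (rule rfm_eqI)
  fix i j
  show "ent (X * diag (\<lambda>i. sign (par i))) i j = ent (sign p * (diag (\<lambda>i. sign (par i)) * X)) i j"
  proof (cases "ent X i j = 0")
    case False
    then have "even (p + par i + par j)" using assms by (simp add: homog_def)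
    then show ?thesis by (auto simp: sign_def)
  qed simp
qed

text \<open>The indices are the basis vectors of the free modules of all branes; \<open>I\<close> selects the
  finitely many branes over which the trace is taken. Indices outside \<open>E\<close> belong to modules which
  are not branes, hence \<open>D\<^sup>2 = W\<close> only on \<open>E\<close>.\<close>

locale matrix_factorization =
  fixes par :: "'i \<Rightarrow> int" and E :: "'i set" and D0 :: "('i, 'a::complex_comm_algebra) rfm"
    and W :: 'a and I :: "'i set" and N :: nat
  assumes D0_homog: "homog par 1 D0"
    and D0_square: "D0 * D0 = diag (\<lambda>i. if i \<in> E then W else 0)"
    and D0_E: "ent D0 i j \<noteq> 0 \<Longrightarrow> i \<in> E \<and> j \<in> E"
    and D0_I: "ent D0 i j \<noteq> 0 \<Longrightarrow> i \<in> I \<longleftrightarrow> j \<in> I"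
    and finite_I: "finite I"
    and form_degree_N: "x \<in> form_degree N \<Longrightarrow> (x :: 'a forms) = 0"
begin

text \<open>The generalized trace gives each index except the first one the sign of its shift. The
  row index of every differentiated matrix is such an index, so multiplying these matrices by
  \<open>eps\<close> from the left produces exactly these signs; this is the reason for
  \<open>eps\<close> in \<open>eta\<close> and in \<open>A\<close>.\<close>

definition eps :: "('i, 'a forms) rfm" where "eps = diag (\<lambda>i. sign (par i))"
definition D :: "('i, 'a forms) rfm" where "D = fn_mat D0"
definition eta :: "('i, 'a forms) rfm" where "eta = eps * d_mat D0"
text \<open>This is dW as an operator of parity one. With the sign of the row included it commutes
  with \<open>eta\<close>, which is even in total parity, and passes \<open>fn_mat x\<close> and
  \<open>A x\<close> with the signs of their parities \<open>a\<close> and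
  \<open>a + 1\<close>.\<close>

definition om :: "('i, 'a forms) rfm" where
  "om = diag (\<lambda>i. if i \<in> E then sign (par i) * dform W else 0)"
definition A :: "('i, 'a) rfm \<Rightarrow> ('i, 'a forms) rfm" where "A x = eps * d_mat x"
definition delta :: "('i, 'a) rfm \<Rightarrow> int \<Rightarrow> ('i, 'a) rfm" where
  "delta x a = D0 * x - sign a * (x * D0)"
text \<open>Confinement to \<open>I\<close> makes the trace cyclic; confinement to \<open>E\<close>
  lets \<open>om\<close> act as dW on all rows and columns that occur.\<close>

definition good :: "('i, 'a) rfm \<times> int \<Rightarrow> bool" where
  "good y \<longleftrightarrow> homog par (snd y) (fst y) \<and> (\<forall>i j. ent (fst y) i j \<noteq> 0 \<longrightarrow> i \<in> I \<inter> E \<and> j \<in> I \<inter> E)"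

lemma eps_commute: "homog par p X \<Longrightarrow> X * eps = sign p * (eps * X)"
  unfolding eps_def by (rule homog_eps_commute)

lemma D_homog: "homog par 1 D"
  unfolding D_def by (intro homog_rmap D0_homog) simp

lemma eta_homog: "homog par 1 eta"
  using homog_mult[OF homog_diag[of par "\<lambda>i. sign (par i)"] homog_rmap[OF _ D0_homog, of dform]]
  by (simp add: eta_def eps_def)

lemma A_homog: "homog par p x \<Longrightarrow> homog par p (A x)"
  using homog_mult[OF homog_diag[of par "\<lambda>i. sign (par i)"] homog_rmap[of dform par p x]]
  by (simp add: A_def eps_def)

text \<open>Differentiating \<open>D * D = W\<close> gives the anticommutator of \<open>D\<close>
  with its differential as dW. Since \<open>D\<close> is odd it anticommutes with
  \<open>eps\<close>, which turns the anticommutator into a commutator.\<close>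

lemma D_eta: "D * eta - eta * D = - om"
proof -
  have "eps * D = - (D * eps)" using eps_commute[OF D_homog] by simp
  from mult_assoc_eq[OF this] have "eps * (D * Z) = - (D * (eps * Z))" for Z
    by (simp add: mult.assoc)
  then have "eta * D - D * eta = eps * d_mat (D0 * D0)"
    unfolding d_mat_mult eta_def D_def[symmetric] by (simp add: ring_distribs mult.assoc)
  also have "\<dots> = om" unfolding D0_square
    by (rule rfm_eqI) (auto simp: eps_def om_def ent_diag)
  finally show ?thesis by (metis minus_diff_eq)
qed

lemma om_eta: "om * eta = eta * om"
proof (rule rfm_eqI)
  fix i j
  show "ent (om * eta) i j = ent (eta * om) i j"
  proof (cases "ent D0 i j = 0")
    case False
    then have "even (1 + par i + par j)" "i \<in> E" "j \<in> E"
      using D0_homog D0_E by (auto simp: homog_def)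
    then show ?thesis
      using dform_anticommute[of W "ent D0 i j"] by (auto simp: eta_def eps_def om_def sign_def)
  qed (simp add: eta_def eps_def om_def)
qed

lemma om_fn:
  assumes "good (x, a)"
  shows "om * fn_mat x = sign a * (fn_mat x * om)"
proof (rule rfm_eqI)
  fix i j
  show "ent (om * fn_mat x) i j = ent (sign a * (fn_mat x * om)) i j"
  proof (cases "ent x i j = 0")
    case False
    then have "even (a + par i + par j)" "i \<in> E" "j \<in> E"
      using assms by (auto simp: good_def homog_def)
    then show ?thesis by (auto simp: om_def sign_def of_fn_dform_commute)
  qed (simp add: om_def)
qed

lemma om_A:
  assumes "good (x, a)"
  shows "om * A x = sign (a + 1) * (A x * om)"
proof (rule rfm_eqI)
  fix i j
  show "ent (om * A x) i j = ent (sign (a + 1) * (A x * om)) i j"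
  proof (cases "ent x i j = 0")
    case False
    then have "even (a + par i + par j)" "i \<in> E" "j \<in> E"
      using assms by (auto simp: good_def homog_def)
    then show ?thesis
      using dform_anticommute[of W "ent x i j"] by (auto simp: A_def eps_def om_def sign_def)
  qed (simp add: A_def eps_def om_def)
qed

lemma fn_mat_delta: "fn_mat (delta x a) = D * fn_mat x - sign a * fn_mat x * D"
  unfolding delta_def D_def fn_mat_minus fn_mat_sign
  unfolding fn_mat_mult by (simp add: mult.assoc)

text \<open>Apply d to \<open>delta x a\<close>. Where d falls on \<open>x\<close> the graded
  commutator of \<open>D\<close> with \<open>A x\<close> appears; where it falls on \<open>D\<close>
  there remain \<open>eta * x\<close> and \<open>x * eta\<close>, and these are the terms that
  telescope later.\<close>

lemma D_A:
  assumes "good (x, a)"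
  shows "D * A x - sign (a + 1) * A x * D = eta * fn_mat x - fn_mat x * eta - A (delta x a)"
proof -
  have x: "fn_mat x * eps = sign a * (eps * fn_mat x)"
    using assms by (intro eps_commute homog_rmap) (auto simp: good_def)
  have D: "eps * D = - (D * eps)" using eps_commute[OF D_homog] by simp
  have "A (delta x a) = eta * fn_mat x + eps * D * d_mat x - sign a * A x * D - sign a * (eps * fn_mat x) * d_mat D0"
    unfolding A_def delta_def eta_def D_def d_mat_minus d_mat_sign
    unfolding d_mat_mult
    by (auto simp: sign_def ring_distribs mult.assoc)
  also have "\<dots> = eta * fn_mat x - D * A x - sign a * A x * D - fn_mat x * eta"
    unfolding D by (simp add: x[symmetric] A_def eta_def mult.assoc)
  finally show ?thesis by (simp add: sign_Suc algebra_simps)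
qed

text \<open>The Leibniz rule, with the sign that arises when \<open>eps\<close> moves past
  \<open>x\<close>.\<close>

lemma A_mult:
  assumes "good (x, a)"
  shows "A (x * y) = A x * fn_mat y + sign a * fn_mat x * A y"
proof -
  have x: "fn_mat x * eps = sign a * (eps * fn_mat x)"
    using assms by (intro eps_commute homog_rmap) (auto simp: good_def)
  then have "eps * fn_mat x = sign a * fn_mat x * eps"
    by (simp add: sign_sign mult.assoc)
  from mult_assoc_eq[OF this] have "eps * (fn_mat x * Z) = sign a * (fn_mat x * (eps * Z))" for Z
    by (simp add: mult.assoc)
  then show ?thesis
    unfolding A_def d_mat_mult by (simp add: ring_distribs mult.assoc)
qed

section \<open>The geometric series of the matrix of one-forms\<close>

definition G :: "('i, 'a forms) rfm fps" where "G = Abs_fps (\<lambda>m. eta ^ m)"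

lemma G_left: "fps_X * fps_const eta * G = G - 1"
proof (rule fps_ext)
  fix n show "fps_nth (fps_X * fps_const eta * G) n = fps_nth (G - 1) n"
    by (cases n) (simp_all add: G_def mult.assoc)
qed

lemma G_right: "fps_X * (G * fps_const eta) = G - 1"
proof (rule fps_ext)
  fix n show "fps_nth (fps_X * (G * fps_const eta)) n = fps_nth (G - 1) n"
    by (cases n) (simp_all add: G_def power_commutes)
qed

lemma om_power_eta: "om * eta ^ n = eta ^ n * om"
proof (induction n)
  case (Suc n)
  have "om * eta ^ Suc n = eta * (om * eta ^ n)" by (simp add: om_eta flip: mult.assoc)
  then show ?case by (simp add: Suc mult.assoc)
qed simp

lemma om_G: "fps_const om * G = G * fps_const om"
  by (rule fps_ext) (simp add: G_def om_power_eta)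

text \<open>Derivative of an inverse: for \<open>K = 1 - t eta\<close> the commutator of
  \<open>D\<close> with the inverse of \<open>K\<close> is the commutator of \<open>K\<close> with
  \<open>D\<close>, enclosed between two copies of that inverse. The middle factor is a multiple of
  \<open>om\<close>, which commutes with \<open>G\<close>.\<close>

lemma D_G: "fps_const D * G - G * fps_const D = - (fps_X * (fps_const om * (G * G)))"
proof -
  define K where "K = 1 - fps_X * fps_const eta"
  have KG: "K * G = 1" using G_left by (simp add: K_def left_diff_distrib)
  have GK: "G * K = 1" using G_right by (simp add: K_def right_diff_distrib fps_X_left)
  have "K * fps_const D - fps_const D * K = fps_X * fps_const (D * eta - eta * D)"
    by (simp add: K_def left_diff_distrib right_diff_distrib mult.assoc fps_X_left
        flip: fps_const_sub)
  also have "\<dots> = fps_X * - fps_const om" by (simp add: D_eta)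
  finally have K: "K * fps_const D - fps_const D * K = fps_X * - fps_const om" .
  have "fps_const D * G - G * fps_const D = (G * K) * fps_const D * G - G * fps_const D * (K * G)"
    by (simp add: KG GK)
  also have "\<dots> = G * (K * fps_const D - fps_const D * K) * G"
    by (simp add: left_diff_distrib right_diff_distrib mult.assoc)
  also have "\<dots> = - (fps_X * (fps_const om * (G * G)))"
    unfolding K by (simp add: mult.assoc fps_X_left om_G mult_assoc_eq[OF om_G] del: fps_const_neg)
  finally show ?thesis .
qed

text \<open>The coefficient of \<open>G * G\<close> at place n consists of n + 1 copies of the n-th
  power of \<open>eta\<close>.\<close>

lemma theta_G: "theta G = G * G - G"
proof (rule fps_ext)
  fix n show "fps_nth (theta G) n = fps_nth (G * G - G) n"
    by (simp add: fps_mult_nth G_def ring_distribs flip: power_add)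
qed

end

lemma of_nat_fps_nth: "fps_nth (of_nat m * F) n = of_nat m * fps_nth (F :: 'r::ring_1 fps) n"
proof (induction m)
  case (Suc m)
  then show ?case by (simp only: of_nat_Suc ring_distribs fps_add_nth mult_1_left)
qed simp

lemma mult_of_nat_left: "x * (of_nat m * y) = of_nat m * (x * (y :: 'r::ring_1))"
  by (induction m) (simp_all add: ring_distribs)

lemma form_scale_of_nat: "form_scale (of_nat m) x = of_nat m * x"
  by (induction m) (simp_all add: form_scale_add_left ring_distribs)

section \<open>Traces weighted by form degree\<close>

context matrix_factorization
begin

text \<open>With \<open>n\<close> one-forms there are \<open>n + 1\<close> letters. The generalized
  trace gives the starting index the exponent (sum of degrees + n + 1) times its shift, and the sum
  of degrees is even whenever the term is nonzero. So \<open>T n\<close> is the supertrace for even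
  \<open>n\<close> and the ordinary trace for odd \<open>n\<close>.\<close>

definition T :: "nat \<Rightarrow> ('i, 'a forms) rfm \<Rightarrow> 'a forms" where
  "T n X = (\<Sum>i\<in>I. sign ((int n + 1) * par i) * ent X i i)"

lemma T_0 [simp]: "T n 0 = 0"
  by (simp add: T_def)

lemma T_add: "T n (X + Y) = T n X + T n Y"
  by (simp add: T_def ring_distribs sum.distrib)

lemma T_sum: "T n (sum f S) = (\<Sum>s\<in>S. T n (f s))"
  by (induction S rule: infinite_finite_induct) (auto simp: T_add)

lemma T_sign: "T n (sign m * X) = sign m * T n X"
  unfolding T_def ent_sign sum_distrib_left
  by (rule sum.cong) (auto simp: sign_def)

lemma T_of_nat: "T n (of_nat m * X) = of_nat m * T n X"
  by (induction m) (simp_all add: ring_distribs T_add)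

text \<open>Only \<open>P\<close> has to live on the finite set \<open>I\<close>; \<open>Q\<close>
  may be \<open>D\<close>, which has nonzero entries for all branes, because multiplication by
  \<open>P\<close> on either side restricts the sums to \<open>I\<close>. The entries of
  \<open>Q\<close> are central, so no signs come from the forms.\<close>

lemma T_commute:
  assumes P: "homog par p P" "\<And>i j. ent P i j \<noteq> 0 \<Longrightarrow> i \<in> I \<and> j \<in> I"
    and Q: "homog par q Q" "\<And>i j y. ent Q i j * y = y * ent Q i j"
  shows "T n (P * Q) = sign (q * (p + int n)) * T n (Q * P)"
proof -
  let ?s = "\<lambda>i. sign ((int n + 1) * par i) :: 'a forms"
  have 1: "ent (P * Q) i i = (\<Sum>l\<in>I. ent P i l * ent Q l i)" for i
    using P(2) by (intro ent_times finite_I) auto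
  have 2: "ent (Q * P) l l = (\<Sum>i\<in>I. ent Q l i * ent P i l)" for l
  proof -
    have "ent (Q * P) l l = (\<Sum>i\<in>{i. ent Q l i \<noteq> 0} \<union> I. ent Q l i * ent P i l)"
      by (rule ent_times) (auto simp: finite_row finite_I)
    also have "\<dots> = (\<Sum>i\<in>I. ent Q l i * ent P i l)"
    proof (rule sum.mono_neutral_right)
      show "\<forall>i\<in>{i. ent Q l i \<noteq> 0} \<union> I - I. ent Q l i * ent P i l = 0"
      proof
        fix i assume "i \<in> {i. ent Q l i \<noteq> 0} \<union> I - I"
        then have "ent P i l = 0" using P(2) by blast
        then show "ent Q l i * ent P i l = 0" by simp
      qed
    qed (auto simp: finite_row finite_I)
    finally show ?thesis .
  qed
  have "T n (P * Q) = (\<Sum>i\<in>I. \<Sum>l\<in>I. ?s i * (ent P i l * ent Q l i))"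
    by (simp add: T_def 1 sum_distrib_left)
  also have "\<dots> = (\<Sum>i\<in>I. \<Sum>l\<in>I. sign (q * (p + int n)) * (?s l * (ent Q l i * ent P i l)))"
  proof (intro sum.cong HOL.refl)
    fix i l
    show "?s i * (ent P i l * ent Q l i) = sign (q * (p + int n)) * (?s l * (ent Q l i * ent P i l))"
    proof (cases "ent P i l = 0 \<or> ent Q l i = 0")
      case False
      then have "even (p + par i + par l)" "even (q + par l + par i)"
        using P(1) Q(1) by (auto simp: homog_def)
      \<comment> \<open>A nonzero contribution forces \<open>p\<close>, \<open>q\<close> and
        \<open>par i + par l\<close> to have the same parity, so \<open>q * p\<close> may be
        replaced by \<open>q\<close>.\<close>
      then have "even ((int n + 1) * par i + (q * (p + int n) + (int n + 1) * par l))"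
        unfolding even_add even_mult_iff by auto
      then have "?s i = sign (q * (p + int n)) * ?s l"
        unfolding sign_add[symmetric] by (rule sign_eq)
      then show ?thesis by (simp add: Q(2) mult.assoc)
    qed auto
  qed
  also have "\<dots> = (\<Sum>l\<in>I. \<Sum>i\<in>I. sign (q * (p + int n)) * (?s l * (ent Q l i * ent P i l)))"
    by (rule sum.swap)
  also have "\<dots> = sign (q * (p + int n)) * T n (Q * P)"
    by (simp add: T_def 2 sum_distrib_left)
  finally show ?thesis .
qed

text \<open>The sign of the row in \<open>om\<close> is the difference between the signs used by
  \<open>T n\<close> and by \<open>T (n - 1)\<close>.\<close>

lemma T_om:
  assumes "\<And>i j. ent Y i j \<noteq> 0 \<Longrightarrow> i \<in> E" "n > 0"
  shows "T n (om * Y) = dform W * T (n - 1) Y"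
  unfolding T_def sum_distrib_left
proof (rule sum.cong[OF HOL.refl])
  fix i
  show "sign ((int n + 1) * par i) * ent (om * Y) i i
    = dform W * (sign ((int (n - 1) + 1) * par i) * ent Y i i)"
  proof (cases "ent Y i i = 0")
    case False
    then have "ent (om * Y) i i = sign (par i) * dform W * ent Y i i"
      using assms(1) by (auto simp: om_def)
    then show ?thesis using assms(2) by (auto simp: sign_def)
  qed (simp add: om_def)
qed

text \<open>\<open>k\<close> counts the differentiated morphisms and the exponent of the series
  variable counts the factors dD, so \<open>n\<close> is the total form degree. The cutoff at
  \<open>N\<close> loses nothing, as forms of degree \<open>N\<close> and above vanish.\<close>

definition Psi :: "nat \<Rightarrow> ('i, 'a forms) rfm fps \<Rightarrow> 'a forms" where
  "Psi k F = (\<Sum>n\<in>{k..N}. form_scale (1 / fact n) (T n (fps_nth F (n - k))))"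

lemma Psi_0 [simp]: "Psi k 0 = 0"
  by (simp add: Psi_def)

lemma Psi_add: "Psi k (F + H) = Psi k F + Psi k H"
  by (simp add: Psi_def T_add form_scale_add sum.distrib)

lemma Psi_sign: "Psi k (sign m * F) = sign m * Psi k F"
  by (simp add: Psi_def T_sign form_scale_sign_mult sum_distrib_left)

lemma Psi_minus: "Psi k (F - H) = Psi k F - Psi k H"
  using Psi_add[of k "F - H" H] by simp

lemma Psi_sum: "Psi k (sum f S) = (\<Sum>s\<in>S. Psi k (f s))"
  by (induction S rule: infinite_finite_induct) (auto simp: Psi_add)

lemma Psi_shift: "Psi k (fps_X * F) = Psi (Suc k) F"
proof -
  have "Psi k (fps_X * F) = (\<Sum>n\<in>{Suc k..N}. form_scale (1 / fact n) (T n (fps_nth (fps_X * F) (n - k))))"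
    unfolding Psi_def by (rule sum.mono_neutral_right) auto
  also have "\<dots> = Psi (Suc k) F"
    unfolding Psi_def by (rule sum.cong) (auto simp: Suc_diff_Suc)
  finally show ?thesis .
qed

section \<open>Support, parity and form degree of products\<close>

definition supp :: "('i, 'a forms) rfm fps \<Rightarrow> bool" where
  "supp F \<longleftrightarrow> (\<forall>m i j. ent (fps_nth F m) i j \<noteq> 0 \<longrightarrow> i \<in> I \<inter> E \<and> j \<in> I)"

text \<open>A factor such as \<open>G\<close> contains the identity of an infinite matrix ring and
  cannot satisfy \<open>supp\<close>. It only never leads from inside \<open>I\<close> to outside or
  back. The leading function matrix satisfies \<open>supp\<close> and passes it on to the whole
  product.\<close>

definition pres :: "('i, 'a forms) rfm fps \<Rightarrow> bool" where
  "pres F \<longleftrightarrow> (\<forall>m i j. ent (fps_nth F m) i j \<noteq> 0 \<longrightarrow> (i \<in> I \<longleftrightarrow> j \<in> I))"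

text \<open>Each power of the series variable comes with one factor \<open>eta\<close>, an odd
  matrix; hence the shift of the parity by \<open>m\<close>.\<close>

definition tpar :: "int \<Rightarrow> ('i, 'a forms) rfm fps \<Rightarrow> bool" where
  "tpar p F \<longleftrightarrow> (\<forall>m. homog par (p + int m) (fps_nth F m))"

definition fdeg :: "nat \<Rightarrow> ('i, 'a forms) rfm fps \<Rightarrow> bool" where
  "fdeg k F \<longleftrightarrow> (\<forall>m i j. ent (fps_nth F m) i j \<in> form_degree (k + m))"

lemma ent_sum: "ent (sum f S) i j = (\<Sum>s\<in>S. ent (f s) i j)"
  by (induction S rule: infinite_finite_induct) auto

lemma ent_fps_mult_nonzeroE:
  assumes "ent (fps_nth (F * H) m) i k \<noteq> 0"
  obtains a b j where "ent (fps_nth F a) i j \<noteq> 0" "ent (fps_nth H b) j k \<noteq> 0"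
proof -
  have "(\<Sum>l=0..m. ent (fps_nth F l * fps_nth H (m - l)) i k) \<noteq> 0"
    using assms by (simp add: fps_mult_nth ent_sum)
  then obtain l where "ent (fps_nth F l * fps_nth H (m - l)) i k \<noteq> 0"
    by (rule sum.not_neutral_contains_not_neutral)
  then show thesis using that by (elim ent_times_nonzeroE)
qed

lemma supp_mult: "supp F \<Longrightarrow> pres H \<Longrightarrow> supp (F * H)"
  unfolding supp_def pres_def by (intro allI impI, elim ent_fps_mult_nonzeroE) blast

lemma pres_mult: "pres F \<Longrightarrow> pres H \<Longrightarrow> pres (F * H)"
  unfolding pres_def by (intro allI impI, elim ent_fps_mult_nonzeroE) blast

lemma tpar_mult: "tpar p F \<Longrightarrow> tpar q H \<Longrightarrow> tpar (p + q) (F * H)"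
  unfolding tpar_def fps_mult_nth
proof (intro allI homog_sum)
  fix m i :: nat
  assume *: "\<forall>m. homog par (p + int m) (fps_nth F m)" "\<forall>m. homog par (q + int m) (fps_nth H m)"
    and "i \<in> {0..m}"
  then have eq: "p + int i + (q + int (m - i)) = p + q + int m" by auto
  then show "homog par (p + q + int m) (fps_nth F i * fps_nth H (m - i))"
    using homog_mult[OF *(1)[rule_format, of i] *(2)[rule_format, of "m - i"]] by (simp only: eq)
qed

lemma fdeg_mult: "fdeg p F \<Longrightarrow> fdeg q H \<Longrightarrow> fdeg (p + q) (F * H)"
  unfolding fdeg_def fps_mult_nth ent_sum
proof (intro allI form_degree_sum)
  fix m l :: nat and i j
  assume *: "\<forall>m i j. ent (fps_nth F m) i j \<in> form_degree (p + m)"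
     "\<forall>m i j. ent (fps_nth H m) i j \<in> form_degree (q + m)" and "l \<in> {0..m}"
  then have eq: "p + l + (q + (m - l)) = p + q + m" by auto
  have "ent (fps_nth F l * fps_nth H (m - l)) i j \<in> form_degree (p + l + (q + (m - l)))"
    unfolding ent_times_row using * by (intro form_degree_sum form_degree_mult) auto
  then show "ent (fps_nth F l * fps_nth H (m - l)) i j \<in> form_degree (p + q + m)"
    unfolding eq .
qed

lemma pres_one: "pres 1"
  by (auto simp: pres_def fps_one_nth ent_one split: if_splits)

lemma tpar_one: "tpar 0 1"
  by (auto simp: tpar_def fps_one_nth homog_1)

lemma fdeg_one: "fdeg 0 1"
  using of_fn_form_degree[of 1] by (auto simp: fdeg_def fps_one_nth ent_one form_degree.zero)

lemma tpar_const: "homog par p X \<Longrightarrow> tpar p (fps_const X)"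
  by (auto simp: tpar_def)

lemma G_nth: "fps_nth G m = eta ^ m"
  by (simp add: G_def)

lemma eta_power_homog: "homog par (int m) (eta ^ m)"
proof (induction m)
  case (Suc m)
  then show ?case using homog_mult[OF eta_homog, of "int m"] by simp
qed (simp add: homog_1)

lemma tpar_G: "tpar 0 G"
  by (simp add: tpar_def G_nth eta_power_homog)

lemma eps_deg: "(\<And>i j. ent X i j \<in> form_degree n) \<Longrightarrow> ent (eps * X) i j \<in> form_degree n"
  by (simp add: eps_def sign_form_degree)

lemma fdeg_G: "fdeg 0 G"
proof -
  have eta: "ent eta i j \<in> form_degree 1" for i j
    unfolding eta_def by (rule eps_deg) (use dform_form_degree in auto)
  have "ent (eta ^ m) i j \<in> form_degree m" for m i j
  proof (induction m arbitrary: i j)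
    case 0
    then show ?case using fdeg_one by (auto simp: fdeg_def fps_one_nth dest!: spec[of _ 0])
  next
    case (Suc m)
    have "ent (eta * eta ^ m) i j \<in> form_degree (1 + m)"
      unfolding ent_times_row by (intro form_degree_sum form_degree_mult Suc eta)
    then show ?case by simp
  qed
  then show ?thesis by (simp add: fdeg_def G_nth)
qed

lemma pres_G: "pres G"
proof -
  have "ent (eta ^ m) i j \<noteq> 0 \<longrightarrow> (i \<in> I \<longleftrightarrow> j \<in> I)" for m i j
  proof (induction m arbitrary: i j)
    case (Suc m)
    show ?case
    proof
      assume "ent (eta ^ Suc m) i j \<noteq> 0"
      then have "ent (eta * eta ^ m) i j \<noteq> 0" by simp
      then obtain l where l: "ent eta i l \<noteq> 0" "ent (eta ^ m) l j \<noteq> 0"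
        by (rule ent_times_nonzeroE)
      from l(1) have "ent D0 i l \<noteq> 0" by (auto simp: eta_def eps_def)
      then show "i \<in> I \<longleftrightarrow> j \<in> I" using D0_I Suc l(2) by blast
    qed
  qed (auto simp: ent_one)
  then show ?thesis by (simp add: pres_def G_nth)
qed

text \<open>The form degree \<open>n\<close> enters the sign twice, through the parity
  \<open>p + (n - k)\<close> of the coefficient and through \<open>T n\<close>. The two occurrences
  cancel up to \<open>k\<close>, so one sign serves all coefficients and can be taken out of
  \<open>Psi\<close>.\<close>

lemma Psi_commute:
  assumes "tpar p F" "supp F" "homog par q Q" "\<And>i j y. ent Q i j * y = y * ent Q i j"
  shows "Psi k (F * fps_const Q) = sign (q * (p + int k)) * Psi k (fps_const Q * F)"
proof -
  have "T n (fps_nth F (n - k) * Q) = sign (q * (p + int k)) * T n (Q * fps_nth F (n - k))"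
    if "k \<le> n" for n
  proof -
    have "T n (fps_nth F (n - k) * Q) = sign (q * (p + int (n - k) + int n)) * T n (Q * fps_nth F (n - k))"
      using assms by (intro T_commute) (auto simp: tpar_def supp_def)
    also have "sign (q * (p + int (n - k) + int n)) = (sign (q * (p + int k)) :: 'a forms)"
      using that by (intro sign_eq) (auto simp: of_nat_diff)
    finally show ?thesis .
  qed
  then show ?thesis
    by (simp add: Psi_def form_scale_sign_mult sum_distrib_left)
qed

text \<open>In form degree \<open>n\<close> the bracket multiplies the coefficient by (k + 1) + (n -
  k - 1) = n, which turns \<open>1 / n!\<close> into \<open>1 / (n - 1)!\<close>. At the same time
  \<open>om\<close> yields the factor dW and lowers the index of \<open>T\<close> by one.\<close>

lemma Psi_om:
  assumes "supp F" "fdeg k F"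
  shows "Psi k (fps_X * (fps_const om * (of_nat (Suc k) * F + theta F))) = dform W * Psi k F"
proof -
  let ?f = "\<lambda>n. form_scale (1 / fact n) (T n (fps_nth F (n - k)))"
  have "Psi k (fps_X * (fps_const om * (of_nat (Suc k) * F + theta F))) =
    (\<Sum>n\<in>{Suc k..N}. form_scale (1 / fact n) (T n (om * (fps_nth (of_nat (Suc k) * F + theta F) (n - Suc k)))))"
    unfolding Psi_shift unfolding Psi_def fps_mult_left_const_nth ..
  also have "\<dots> = (\<Sum>n\<in>{Suc k..N}. dform W * ?f (n - 1))"
  proof (rule sum.cong[OF HOL.refl])
    fix n assume n: "n \<in> {Suc k..N}"
    let ?Y = "fps_nth F (n - Suc k)"
    have "Suc k + (n - Suc k) = n" using n by auto
    then have "of_nat (Suc k) + of_nat (n - Suc k) = (of_nat n :: ('i, 'a forms) rfm)"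
      by (metis of_nat_add)
    then have 0: "fps_nth (of_nat (Suc k) * F + theta F) (n - Suc k) = of_nat n * ?Y"
      unfolding fps_add_nth of_nat_fps_nth theta_nth ring_distribs(2)[symmetric] by (simp only:)
    have 1: "om * (of_nat n * ?Y) = of_nat n * (om * ?Y)"
      by (rule mult_of_nat_left)
    have 2: "T n (om * ?Y) = dform W * T (n - 1) ?Y"
      using n assms(1) by (intro T_om) (auto simp: supp_def)
    have 3: "1 / fact n * of_nat n = (1 / fact (n - 1) :: complex)"
      using n by (cases n) (simp_all add: fact_Suc del: of_nat_Suc)
    show "form_scale (1 / fact n) (T n (om * fps_nth (of_nat (Suc k) * F + theta F) (n - Suc k)))
        = dform W * ?f (n - 1)"
      unfolding 0 1 T_of_nat 2 form_scale_of_nat[symmetric] form_scale_scale 3 by (simp add: form_scale_mult_right)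
  qed
  also have "\<dots> = dform W * (\<Sum>n\<in>{k..<N}. ?f n)"
    unfolding sum_distrib_left by (rule sum.reindex_bij_witness[of _ Suc "\<lambda>n. n - 1"]) auto
  \<comment> \<open>At most the term \<open>n = N\<close> is missing, and its diagonal entries are
    forms of degree \<open>N\<close>.\<close>
  also have "(\<Sum>n\<in>{k..<N}. ?f n) = Psi k F"
    unfolding Psi_def
  proof (rule sum.mono_neutral_left)
    show "\<forall>n\<in>{k..N} - {k..<N}. ?f n = 0"
    proof
      fix n assume n: "n \<in> {k..N} - {k..<N}"
      then have "ent (fps_nth F (n - k)) i i = 0" for i
        using assms(2)[unfolded fdeg_def, rule_format, of "n - k" i i] by (intro form_degree_N) auto
      then show "?f n = 0" by (simp add: T_def)
    qed
  qed auto
  finally show ?thesis .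
qed

end

lemma prod_list_graded_commute:
  fixes z :: "'r::ring_1"
  assumes "\<And>y. y \<in> set ys \<Longrightarrow> z * fst y = sign (snd y) * (fst y * z)"
  shows "z * prod_list (map fst ys) = sign (sum_list (map snd ys)) * (prod_list (map fst ys) * z)"
  using assms
proof (induction ys)
  case (Cons y ys)
  have "z * (fst y * prod_list (map fst ys)) = sign (snd y) * (fst y * (z * prod_list (map fst ys)))"
    using Cons.prems[of y] by (simp add: mult.assoc mult_assoc_eq[of z "fst y"])
  also have "z * prod_list (map fst ys) = sign (sum_list (map snd ys)) * (prod_list (map fst ys) * z)"
    using Cons by simp
  finally show ?case by (auto simp: sign_def mult.assoc)
qed simp

section \<open>The value of a word of matrices and the cyclic move of D\<close>

context matrix_factorization
begin

definition TL :: "(('i, 'a) rfm \<times> int) list \<Rightarrow> ('i, 'a forms) rfm fps" where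
  "TL zs = prod_list (map (\<lambda>y. fps_const (A (fst y)) * G) zs)"

definition H :: "(('i, 'a) rfm \<times> int) list \<Rightarrow> ('i, 'a forms) rfm fps" where
  "H xs = fps_const (fn_mat (fst (hd xs))) * G * TL (tl xs)"

definition val :: "(('i, 'a) rfm \<times> int) list \<Rightarrow> 'a forms" where
  "val xs = Psi (length xs - 1) (H xs)"

text \<open>The factors of \<open>H\<close> together with the parities with which they pass
  \<open>D\<close> and \<open>om\<close>: a differentiated matrix counts one more than its degree,
  and \<open>G\<close> is even.\<close>

definition slot :: "(('i, 'a) rfm \<times> int) list \<Rightarrow> (('i, 'a forms) rfm fps \<times> int) list" where
  "slot xs = (fps_const (fn_mat (fst (hd xs))) * G, snd (hd xs)) #
     map (\<lambda>y. (fps_const (A (fst y)) * G, snd y + 1)) (tl xs)"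

lemma TL_Nil [simp]: "TL [] = 1"
  and TL_Cons: "TL (y # zs) = fps_const (A (fst y)) * G * TL zs"
  and TL_append: "TL (us @ vs) = TL us * TL vs"
  by (simp_all add: TL_def)

lemma H_Cons: "H (x # zs) = fps_const (fn_mat (fst x)) * G * TL zs"
  by (simp add: H_def)

lemma H_append: "us \<noteq> [] \<Longrightarrow> H (us @ vs) = H us * TL vs"
  by (cases us) (simp_all add: H_Cons TL_append mult.assoc)

lemma slot_Cons: "slot (x # zs) = (fps_const (fn_mat (fst x)) * G, snd x) #
     map (\<lambda>y. (fps_const (A (fst y)) * G, snd y + 1)) zs"
  by (simp add: slot_def)

lemma prod_slot: "prod_list (map fst (slot xs)) = H xs"
  unfolding slot_def H_def by (simp add: o_def TL_def)

lemma prod_drop_slot: "xs \<noteq> [] \<Longrightarrow> prod_list (map fst (drop (Suc i) (slot xs))) = TL (drop (Suc i) xs)"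
  by (cases xs) (simp_all add: slot_def TL_def drop_map o_def)

lemma prod_take_slot:
  "xs \<noteq> [] \<Longrightarrow> prod_list (map fst (take i (slot xs))) = (if i = 0 then 1 else H (take i xs))"
  by (cases xs; cases i) (simp_all add: slot_def TL_def H_def take_map o_def)

lemma sum_take_slot:
  assumes "i < length xs"
  shows "sum_list (map snd (take i (slot xs))) = (\<Sum>j<i. snd (xs ! j)) + (if i = 0 then 0 else int i - 1)"
proof (cases i)
  case (Suc n)
  obtain x zs where xs: "xs = x # zs" using assms by (cases xs) auto
  have "sum_list (map (\<lambda>y. snd y + 1) (take n zs)) = (\<Sum>j<n. snd (zs ! j) + 1)" if "n \<le> length zs"
    using that by (simp add: sum_list_sum_nth atLeast0LessThan)
  then show ?thesis using assms
    by (simp add: Suc xs slot_Cons take_map o_def sum.distrib sum.lessThan_Suc_shift del: sum.lessThan_Suc)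
qed simp

lemma slot_nth_0: "xs \<noteq> [] \<Longrightarrow> slot xs ! 0 = (fps_const (fn_mat (fst (xs ! 0))) * G, snd (xs ! 0))"
  by (cases xs) (simp_all add: slot_def)

lemma slot_nth: "0 < i \<Longrightarrow> i < length xs \<Longrightarrow>
    slot xs ! i = (fps_const (A (fst (xs ! i))) * G, snd (xs ! i) + 1)"
  by (cases xs; cases i) (simp_all add: slot_def)

lemma length_slot: "xs \<noteq> [] \<Longrightarrow> length (slot xs) = length xs"
  by (cases xs) (simp_all add: slot_def)

lemma fps_const_sub': "fps_const (x - y) = fps_const x - fps_const (y :: 'r::ring_1)"
  by simp

lemma TL_props:
  assumes "\<And>y. y \<in> set zs \<Longrightarrow> good y"
  shows "tpar (sum_list (map snd zs)) (TL zs)" "pres (TL zs)" "fdeg (length zs) (TL zs)"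
proof -
  have "tpar (sum_list (map snd zs)) (TL zs) \<and> pres (TL zs) \<and> fdeg (length zs) (TL zs)"
    using assms
  proof (induction zs)
    case Nil
    then show ?case by (simp add: tpar_one pres_one fdeg_one)
  next
    case (Cons y zs)
    have y: "good y" using Cons.prems by simp
    have IH: "tpar (sum_list (map snd zs)) (TL zs)" "pres (TL zs)" "fdeg (length zs) (TL zs)"
      using Cons by auto
    have t: "tpar (snd y) (fps_const (A (fst y)))"
      using y by (intro tpar_const A_homog) (auto simp: good_def)
    have "ent (A (fst y)) i j \<noteq> 0 \<Longrightarrow> ent (fst y) i j \<noteq> 0" for i j
      by (auto simp: A_def eps_def)
    then have p: "pres (fps_const (A (fst y)))"
      using y unfolding pres_def good_def by (auto split: if_splits)
    have "ent (A (fst y)) i j \<in> form_degree 1" for i j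
      unfolding A_def by (rule eps_deg) (use dform_form_degree in auto)
    then have f: "fdeg 1 (fps_const (A (fst y)))"
      by (auto simp: fdeg_def form_degree.zero)
    have "tpar (snd y + 0 + sum_list (map snd zs)) (TL (y # zs))"
      unfolding TL_Cons by (intro tpar_mult t tpar_G IH)
    moreover have "pres (TL (y # zs))"
      unfolding TL_Cons by (intro pres_mult p pres_G IH)
    moreover have "fdeg (1 + 0 + length zs) (TL (y # zs))"
      unfolding TL_Cons by (intro fdeg_mult f fdeg_G IH)
    ultimately show ?case by simp
  qed
  then show "tpar (sum_list (map snd zs)) (TL zs)" "pres (TL zs)" "fdeg (length zs) (TL zs)" by auto
qed

lemma H_props:
  assumes "xs \<noteq> []" "\<And>y. y \<in> set xs \<Longrightarrow> good y"
  shows "tpar (sum_list (map snd xs)) (H xs)" "supp (H xs)" "fdeg (length xs - 1) (H xs)"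
proof -
  obtain x zs where xs: "xs = x # zs" using assms by (cases xs) auto
  have x: "good x" and zs: "\<And>y. y \<in> set zs \<Longrightarrow> good y" using assms xs by auto
  note TL = TL_props[OF zs]
  have t: "tpar (snd x) (fps_const (fn_mat (fst x)))"
    using x by (intro tpar_const homog_rmap) (auto simp: good_def)
  have p: "supp (fps_const (fn_mat (fst x)))"
    unfolding supp_def
  proof (intro allI impI)
    fix m i j assume "ent (fps_nth (fps_const (fn_mat (fst x))) m) i j \<noteq> 0"
    then have "ent (fst x) i j \<noteq> 0" by (auto split: if_splits)
    then show "i \<in> I \<inter> E \<and> j \<in> I" using x by (auto simp: good_def)
  qed
  have f: "fdeg 0 (fps_const (fn_mat (fst x)))"
    by (auto simp: fdeg_def form_degree.zero of_fn_form_degree)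
  have "tpar (snd x + 0 + sum_list (map snd zs)) (H xs)"
    unfolding xs H_Cons using zs by (intro tpar_mult t tpar_G TL)
  then show "tpar (sum_list (map snd xs)) (H xs)" by (simp add: xs)
  show "supp (H xs)" unfolding xs H_Cons using zs by (intro supp_mult p pres_G TL)
  have "fdeg (0 + 0 + length zs) (H xs)"
    unfolding xs H_Cons using zs by (intro fdeg_mult f fdeg_G TL)
  then show "fdeg (length xs - 1) (H xs)" by (simp add: xs)
qed

text \<open>\<open>D\<close> passes first \<open>Y\<close> and then \<open>G\<close>, the latter by
  \<open>D_G\<close>. The assumption pulls \<open>om\<close> out to the left, so that the correction
  has the same shape for every kind of factor.\<close>

lemma commutator_const_G:
  assumes "om * Y = sign p * (Y * om)"
  shows "fps_const D * (fps_const Y * G) - sign p * (fps_const Y * G) * fps_const D =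
    fps_const (D * Y - sign p * Y * D) * G - fps_X * (fps_const om * (fps_const Y * G * G))"
proof -
  have om: "fps_const om * fps_const Y = sign p * (fps_const Y * fps_const om)"
    using assms by (simp add: sign_fps_const)
  have "fps_const D * (fps_const Y * G) - sign p * (fps_const Y * G) * fps_const D =
     fps_const (D * Y - sign p * Y * D) * G + sign p * (fps_const Y * (fps_const D * G - G * fps_const D))"
    unfolding fps_const_sub' mult.assoc sign_fps_const
    by (simp add: ring_distribs mult.assoc del: fps_const_sub flip: fps_const_mult)
  also have "sign p * (fps_const Y * (fps_const D * G - G * fps_const D))
     = - (fps_X * (sign p * (fps_const Y * fps_const om) * (G * G)))"
    unfolding D_G by (auto simp: sign_def fps_X_left mult.assoc simp del: fps_const_mult fps_const_neg)
  also have "\<dots> = - (fps_X * (fps_const om * (fps_const Y * G * G)))"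
    unfolding om[symmetric] by (simp only: mult.assoc)
  finally show ?thesis by simp
qed

definition prefix :: "(('i, 'a) rfm \<times> int) list \<Rightarrow> nat \<Rightarrow> ('i, 'a forms) rfm fps" where
  "prefix xs i = (if i = 0 then 1 else H (take i xs))"

text \<open>The graded commutator of \<open>D\<close> with the matrix in slot \<open>i\<close>; the
  first slot holds a matrix of functions, the others hold matrices of one-forms.\<close>

definition Z :: "(('i, 'a) rfm \<times> int) list \<Rightarrow> nat \<Rightarrow> ('i, 'a forms) rfm" where
  "Z xs i = (let x = fst (xs ! i); a = snd (xs ! i) in
     if i = 0 then fn_mat (delta x a) else eta * fn_mat x - fn_mat x * eta - A (delta x a))"

text \<open>The parity of everything in front of slot \<open>i\<close>; of the \<open>i\<close>
  factors there, all but the first carry a one-form.\<close>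

definition sg :: "(('i, 'a) rfm \<times> int) list \<Rightarrow> nat \<Rightarrow> int" where
  "sg xs i = (\<Sum>j<i. snd (xs ! j)) + (if i = 0 then 0 else int i - 1)"

lemma Psi_graded_Leibniz:
  assumes ne: "xs \<noteq> []" and good: "\<And>y. y \<in> set xs \<Longrightarrow> good y"
  shows "(\<Sum>i<length xs. sign (sg xs i) *
      Psi (length xs - 1) (prefix xs i * (fps_const (Z xs i) * G) * TL (drop (Suc i) xs))) = dform W * val xs"
proof -
  let ?k = "length xs - 1" and ?ys = "slot xs" and ?n = "length xs"
  let ?P = "\<lambda>i. prod_list (map fst (take i ?ys))" and ?Q = "\<lambda>i. prod_list (map fst (drop (Suc i) ?ys))"
  let ?s = "\<lambda>i. sign (sum_list (map snd (take i ?ys))) :: ('i, 'a forms) rfm fps"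
  have len: "length ?ys = ?n" using ne by (rule length_slot)
  have om: "fps_const om * fst y = sign (snd y) * (fst y * fps_const om)" if "y \<in> set ?ys" for y
  proof -
    have *: "fps_const om * (fps_const Y * G) = sign p * (fps_const Y * G * fps_const om)"
      if "om * Y = sign p * (Y * om)" for Y p
    proof -
      have "fps_const om * (fps_const Y * G) = fps_const (om * Y) * G"
        by (simp add: flip: mult.assoc)
      also have "\<dots> = sign p * (fps_const Y * (fps_const om * G))"
        unfolding that sign_fps_const by (simp add: mult.assoc flip: fps_const_mult)
      finally show ?thesis by (simp add: om_G mult.assoc)
    qed
    obtain x zs where xs: "xs = x # zs" using ne by (cases xs) auto
    have "om * fn_mat (fst x) = sign (snd x) * (fn_mat (fst x) * om)"
      by (rule om_fn) (use good[of x] xs in simp)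
    moreover have "om * A (fst z) = sign (snd z + 1) * (A (fst z) * om)" if "z \<in> set zs" for z
      by (rule om_A) (use good[of z] xs that in simp)
    ultimately show ?thesis using that * by (auto simp: xs slot_Cons)
  qed
  have theta: "theta (fst y) = fst y * G - fst y" if "y \<in> set ?ys" for y
    using that ne by (auto simp: slot_def theta_mult theta_G ring_distribs mult.assoc)
  have comm: "fps_const D * fst (?ys ! i) - sign (snd (?ys ! i)) * fst (?ys ! i) * fps_const D =
      fps_const (Z xs i) * G - fps_X * (fps_const om * (fst (?ys ! i) * G))" if "i < ?n" for i
  proof -
    have g: "good (fst (xs ! i), snd (xs ! i))" using good[of "xs ! i"] that by simp
    show ?thesis
    proof (cases "i = 0")
      case True
      then have "Z xs i = D * fn_mat (fst (xs ! i)) - sign (snd (xs ! i)) * fn_mat (fst (xs ! i)) * D"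
        by (simp add: Z_def Let_def fn_mat_delta)
      then show ?thesis
        using commutator_const_G[OF om_fn[OF g]] slot_nth_0[OF ne] True by (simp only: fst_conv snd_conv)
    next
      case False
      then have "Z xs i = D * A (fst (xs ! i)) - sign (snd (xs ! i) + 1) * A (fst (xs ! i)) * D"
        by (simp add: Z_def Let_def D_A[OF g])
      then show ?thesis
        using commutator_const_G[OF om_A[OF g]] slot_nth[of i xs] False that by (simp only: fst_conv snd_conv)
    qed
  qed
  \<comment> \<open>Replacing a factor \<open>y\<close> of \<open>H xs\<close> by
    \<open>y * G\<close> amounts to adding \<open>theta y\<close>. Summation over the slots gives
    the product once per slot plus its Euler derivative.\<close>
  have euler: "(\<Sum>i<?n. ?P i * (fst (?ys ! i) * G) * ?Q i) = of_nat (Suc ?k) * H xs + theta (H xs)"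
  proof -
    have "?P i * (fst (?ys ! i) * G) * ?Q i = H xs + ?P i * theta (fst (?ys ! i)) * ?Q i" if "i < ?n" for i
    proof -
      have "fst (?ys ! i) * G = fst (?ys ! i) + theta (fst (?ys ! i))"
        using theta[of "?ys ! i"] that len by simp
      moreover have "?P i * fst (?ys ! i) * ?Q i = H xs"
        using prod_list_take_nth_drop[of i "map fst ?ys"] that len
        by (simp add: take_map drop_map prod_slot)
      ultimately show ?thesis by (simp add: ring_distribs)
    qed
    then have "(\<Sum>i<?n. ?P i * (fst (?ys ! i) * G) * ?Q i) =
        of_nat ?n * H xs + (\<Sum>i<?n. ?P i * theta (fst (?ys ! i)) * ?Q i)"
      by (simp add: sum.distrib)
    also have "(\<Sum>i<?n. ?P i * theta (fst (?ys ! i)) * ?Q i) = theta (H xs)"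
      using theta_prod_list[of "map fst ?ys"] len by (simp add: take_map drop_map prod_slot)
    finally show ?thesis using ne by simp
  qed
  have "fps_const D * H xs - sign (sum_list (map snd ?ys)) * H xs * fps_const D =
      (\<Sum>i<?n. ?s i * ?P i * (fps_const (Z xs i) * G - fps_X * (fps_const om * (fst (?ys ! i) * G))) * ?Q i)"
    using graded_commutator_prod_list[of "fps_const D" ?ys] comm by (simp add: prod_slot len)
  also have "\<dots> = (\<Sum>i<?n. ?s i * (?P i * (fps_const (Z xs i) * G) * ?Q i)) -
      (\<Sum>i<?n. ?s i * (?P i * (fps_X * (fps_const om * (fst (?ys ! i) * G))) * ?Q i))"
    by (simp add: right_diff_distrib left_diff_distrib sum_subtractf mult.assoc)
  also have "(\<Sum>i<?n. ?s i * (?P i * (fps_X * (fps_const om * (fst (?ys ! i) * G))) * ?Q i)) =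
      (\<Sum>i<?n. fps_X * (fps_const om * (?P i * (fst (?ys ! i) * G) * ?Q i)))"
  proof (rule sum.cong[OF HOL.refl])
    fix i
    \<comment> \<open>The sign by which \<open>om\<close> passes the prefix is the one that the
      graded Leibniz rule attaches to slot \<open>i\<close>, so after the move all these terms come
      without sign.\<close>
    have "fps_const om * ?P i = ?s i * (?P i * fps_const om)"
      by (rule prod_list_graded_commute) (use om in \<open>auto dest: in_set_takeD\<close>)
    from mult_assoc_eq[OF this]
    show "?s i * (?P i * (fps_X * (fps_const om * (fst (?ys ! i) * G))) * ?Q i) =
        fps_X * (fps_const om * (?P i * (fst (?ys ! i) * G) * ?Q i))"
      by (simp add: mult.assoc fps_X_left)
  qed
  also have "\<dots> = fps_X * (fps_const om * (of_nat (Suc ?k) * H xs + theta (H xs)))"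
    unfolding euler[symmetric] by (simp add: sum_distrib_left)
  finally have eq: "fps_const D * H xs - sign (sum_list (map snd ?ys)) * H xs * fps_const D =
      (\<Sum>i<?n. ?s i * (?P i * (fps_const (Z xs i) * G) * ?Q i)) -
      fps_X * (fps_const om * (of_nat (Suc ?k) * H xs + theta (H xs)))" .
  have HP: "tpar (sum_list (map snd xs)) (H xs)" "supp (H xs)" "fdeg ?k (H xs)"
    by (rule H_props[OF ne], erule good)+
  have "Psi ?k (fps_const D * H xs - sign (sum_list (map snd ?ys)) * H xs * fps_const D) =
      (\<Sum>i<?n. Psi ?k (?s i * (?P i * (fps_const (Z xs i) * G) * ?Q i))) - dform W * Psi ?k (H xs)"
  proof -
    have "Psi ?k (fps_X * (fps_const om * (of_nat (Suc ?k) * H xs + theta (H xs)))) = dform W * Psi ?k (H xs)"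
      by (rule Psi_om[OF HP(2,3)])
    then show ?thesis unfolding eq Psi_minus Psi_sum by (simp only:)
  qed
  \<comment> \<open>Moving \<open>D\<close> around the trace costs the sum of the degrees plus
    \<open>k\<close>. The parities of the slots have the same total, since each of the
    \<open>k\<close> differentiated factors counts one more than its degree.\<close>
  moreover have "Psi ?k (fps_const D * H xs - sign (sum_list (map snd ?ys)) * H xs * fps_const D) = 0"
  proof -
    have "Psi ?k (H xs * fps_const D) = sign (1 * (sum_list (map snd xs) + int ?k)) * Psi ?k (fps_const D * H xs)"
      by (rule Psi_commute[OF HP(1,2) D_homog]) (simp add: D_def, rule of_fn_central)
    moreover have "sum_list (map snd ?ys) = sum_list (map snd xs) + int ?k"
      using ne by (cases xs) (simp_all add: slot_Cons o_def sum_list_addf sum_list_triv)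
    ultimately show ?thesis unfolding Psi_minus mult.assoc Psi_sign by (simp add: sign_sign)
  qed
  ultimately have "(\<Sum>i<?n. Psi ?k (?s i * (?P i * (fps_const (Z xs i) * G) * ?Q i))) = dform W * Psi ?k (H xs)"
    by simp
  moreover have "Psi ?k (?s i * (?P i * (fps_const (Z xs i) * G) * ?Q i)) = sign (sg xs i) *
      Psi (length xs - 1) (prefix xs i * (fps_const (Z xs i) * G) * TL (drop (Suc i) xs))" if "i < ?n" for i
    using that by (simp add: Psi_sign prod_take_slot[OF ne] prod_drop_slot[OF ne] prefix_def sum_take_slot sg_def)
  ultimately show ?thesis by (simp add: val_def)
qed

end

section \<open>From the cyclic identity to the Hochschild differential\<close>

context matrix_factorization
begin

text \<open>Put the series variable next to \<open>eta\<close> and use that \<open>t eta G\<close>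
  and \<open>G t eta\<close> equal \<open>G - 1\<close>. The difference becomes F (G - 1) x G R - F
  G x (G - 1) R, in which the terms with \<open>G\<close> on both sides of \<open>x\<close>
  cancel.\<close>

lemma Psi_telescope:
  "Psi (Suc k) (F * G * (fps_const (eta * x - x * eta) * G) * R) =
   Psi k (F * G * fps_const x * R) - Psi k (F * fps_const x * G * R)"
proof -
  have l: "fps_const eta * (fps_X * (G * S)) = G * S - S" for S
    using arg_cong[OF G_left, of "\<lambda>z. z * S"] by (simp add: fps_X_left left_diff_distrib mult.assoc)
  have r: "G * (fps_const eta * (fps_X * S)) = G * S - S" for S
    using arg_cong[OF G_right, of "\<lambda>z. z * S"] by (simp add: fps_X_left left_diff_distrib mult.assoc)
  have "fps_X * (F * G * (fps_const (eta * x - x * eta) * G) * R) =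
      F * (G * (fps_const eta * (fps_X * (fps_const x * (G * R))))) -
      F * (G * (fps_const x * (fps_const eta * (fps_X * (G * R)))))"
    unfolding fps_const_sub'
    by (simp add: left_diff_distrib right_diff_distrib mult.assoc fps_X_left del: fps_const_sub fps_const_mult
        flip: fps_const_mult)
  also have "\<dots> = F * G * fps_const x * R - F * fps_const x * G * R"
    unfolding l r by (simp add: right_diff_distrib mult.assoc)
  finally show ?thesis
    unfolding Psi_shift[symmetric] by (simp only: Psi_minus)
qed

text \<open>The two families of terms left over by the telescoping sums are exactly the summands of the
  part of the Hochschild differential which multiplies neighbouring entries.\<close>

theorem val_differential:
  fixes xs
  assumes ne: "xs \<noteq> []" and good: "\<And>y. y \<in> set xs \<Longrightarrow> good y"
  defines "k \<equiv> length xs - 1"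
  shows "dform W * val xs =
    (\<Sum>i<k. sign ((\<Sum>j\<le>i. snd (xs ! j)) + int i + 1) *
       val (take i xs @ (fst (xs ! i) * fst (xs ! Suc i), snd (xs ! i) + snd (xs ! Suc i)) # drop (i + 2) xs)) +
    (if k = 0 then 0 else sign (((\<Sum>j<k. snd (xs ! j)) + int k + 1) * (snd (xs ! k) + 1)) *
       val ((fst (xs ! k) * fst (xs ! 0), snd (xs ! k) + snd (xs ! 0)) # butlast (tl xs))) +
    (\<Sum>i<length xs. sign ((\<Sum>j<i. snd (xs ! j)) + int i) *
       val (xs[i := (delta (fst (xs ! i)) (snd (xs ! i)), snd (xs ! i) + 1)]))"
proof -
  have len: "length xs = Suc k" using ne by (simp add: k_def)
  define e x where "e i = snd (xs ! i)" and "x i = fst (xs ! i)" for i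
  define ps where "ps i = (\<Sum>j<i. e j)" for i
  define c where "c i = fps_const (fn_mat (x i))" for i
  define Y where "Y i = (if i = 0 then fn_mat (delta (x i) (e i)) else A (delta (x i) (e i)))" for i
  define R where "R i = TL (drop (Suc i) xs)" for i
  \<comment> \<open>The product for the first \<open>i + 1\<close> entries without its final
    \<open>G\<close>; it is on this \<open>G\<close> that the telescoping acts.\<close>
  define front where "front i = (if i = 0 then c 0 else H (take i xs) * fps_const (A (x i)))" for i
  define d where "d i = Psi k (prefix xs i * (fps_const (Y i) * G) * R i)" for i
  \<comment> \<open>In \<open>U i\<close> the undifferentiated entry \<open>x i\<close> stands
    directly before the following entry, in \<open>V i\<close> the undifferentiated
    \<open>x (Suc i)\<close> stands directly after the preceding one. The index \<open>k - 1\<close>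
    expresses that one differential is lost.\<close>
  define U where "U i = Psi (k - 1) (H (take i xs) * c i * R i)" for i
  define V where "V i = Psi (k - 1) (front i * c (Suc i) * G * R (Suc i))" for i

  have good_i: "good (x i, e i)" if "i \<le> k" for i
    using good[of "xs ! i"] that len by (simp add: x_def e_def)
  have H_take: "H (take (Suc i) xs) = front i * G" if "i \<le> k" for i
  proof (cases "i = 0")
    case True
    then show ?thesis using ne by (cases xs) (auto simp: front_def c_def x_def H_Cons)
  next
    case False
    have "take (Suc i) xs = take i xs @ [xs ! i]" using that len by (simp add: take_Suc_conv_app_nth)
    moreover have "take i xs \<noteq> []" using False ne by simp
    ultimately show ?thesis using False by (simp add: H_append TL_Cons front_def x_def mult.assoc)
  qed
  have R_step: "R i = fps_const (A (x (Suc i))) * G * R (Suc i)" if "i < k" for i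
    using that len by (simp add: R_def x_def TL_Cons flip: Cons_nth_drop_Suc[of "Suc i" xs])

  have d: "val (xs[i := (delta (x i) (e i), e i + 1)]) = d i" if "i \<le> k" for i
  proof (cases "i = 0")
    case True
    then show ?thesis
      using ne by (cases xs) (auto simp: val_def d_def prefix_def Y_def R_def H_Cons k_def)
  next
    case False
    then have "take i xs \<noteq> []" using ne by simp
    then have "H (xs[i := (delta (x i) (e i), e i + 1)]) = prefix xs i * (fps_const (Y i) * G) * R i"
      using False that len
      by (simp add: prefix_def Y_def R_def upd_conv_take_nth_drop H_append TL_Cons mult.assoc)
    moreover have "length (xs[i := (delta (x i) (e i), e i + 1)]) - 1 = k" using len by simp
    ultimately show ?thesis by (simp only: val_def d_def)
  qed

  have tel: "Psi k (prefix xs (Suc i) * (fps_const (Z xs (Suc i)) * G) * R (Suc i)) = U (Suc i) - V i - d (Suc i)"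
    if "i < k" for i
  proof -
    have k: "Suc (k - 1) = k" using that by simp
    let ?c = "eta * fn_mat (x (Suc i)) - fn_mat (x (Suc i)) * eta"
    have Z: "fps_const (Z xs (Suc i)) = fps_const ?c - fps_const (Y (Suc i))"
      by (simp add: Z_def Let_def Y_def x_def e_def)
    have P: "prefix xs (Suc i) = front i * G"
      using H_take[of i] that by (simp add: prefix_def)
    have "Psi k (prefix xs (Suc i) * (fps_const (Z xs (Suc i)) * G) * R (Suc i)) =
        Psi k (front i * G * (fps_const ?c * G) * R (Suc i)) - d (Suc i)"
      unfolding d_def Z P Psi_minus[symmetric] by (simp only: left_diff_distrib right_diff_distrib)
    also have "Psi k (front i * G * (fps_const ?c * G) * R (Suc i)) = U (Suc i) - V i"
      using Psi_telescope[of "k - 1" "front i" "fn_mat (x (Suc i))" "R (Suc i)"] that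
      using H_take[of i] unfolding k by (simp add: U_def V_def c_def)
    finally show ?thesis .
  qed

  have "dform W * val xs =
      (\<Sum>i<Suc k. sign (sg xs i) * Psi k (prefix xs i * (fps_const (Z xs i) * G) * R i))"
    using Psi_graded_Leibniz[OF ne good] by (simp add: len R_def)
  also have "\<dots> = d 0 + (\<Sum>i<k. sign (sg xs (Suc i)) * (U (Suc i) - V i - d (Suc i)))"
    using tel by (simp add: sum.lessThan_Suc_shift sg_def Z_def Let_def d_def Y_def x_def e_def del: sum.lessThan_Suc)
  also have "(\<Sum>i<k. sign (sg xs (Suc i)) * (U (Suc i) - V i - d (Suc i))) =
      (\<Sum>i<k. sign (sg xs (Suc i)) * (U (Suc i) - V i)) + (\<Sum>i<k. sign (ps (Suc i) + int (Suc i)) * d (Suc i))"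
    unfolding sum.distrib[symmetric]
    by (rule sum.cong) (auto simp: sg_def ps_def e_def sign_def algebra_simps)
  finally have 1: "dform W * val xs = (\<Sum>i<k. sign (sg xs (Suc i)) * (U (Suc i) - V i)) +
      (\<Sum>i<Suc k. sign (ps i + int i) * d i)"
    by (simp add: sum.lessThan_Suc_shift ps_def del: sum.lessThan_Suc)

  \<comment> \<open>By the Leibniz rule the differential of \<open>x i * x (Suc i)\<close> splits
    into the situations of \<open>V i\<close> and \<open>U i\<close>. The entry 0 is not
    differentiated, so for \<open>i = 0\<close> there is only one term.\<close>
  have m: "val (take i xs @ (x i * x (Suc i), e i + e (Suc i)) # drop (i + 2) xs) =
      V i + (if i = 0 then 0 else sign (e i) * U i)" if "i < k" for i
  proof (cases "i = 0")
    case True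
    then show ?thesis
      using that len by (simp add: val_def V_def front_def c_def R_def H_Cons fn_mat_mult numeral_2_eq_2)
  next
    case False
    then have "take i xs \<noteq> []" using ne by simp
    have l: "length (take i xs @ (x i * x (Suc i), e i + e (Suc i)) # drop (i + 2) xs) - 1 = k - 1"
      using that len by simp
    have "H (take i xs @ (x i * x (Suc i), e i + e (Suc i)) # drop (i + 2) xs) =
        H (take i xs) * (fps_const (A (x i * x (Suc i))) * G * R (Suc i))"
      using \<open>take i xs \<noteq> []\<close> by (simp add: H_append TL_Cons R_def)
    also have "fps_const (A (x i * x (Suc i))) = fps_const (A (x i)) * c (Suc i) + sign (e i) * (c i * fps_const (A (x (Suc i))))"
      using A_mult[OF good_i[of i]] that by (simp add: c_def mult.assoc flip: sign_fps_const)
    also have "H (take i xs) * ((fps_const (A (x i)) * c (Suc i) + sign (e i) * (c i * fps_const (A (x (Suc i))))) * G * R (Suc i)) =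
        front i * c (Suc i) * G * R (Suc i) + sign (e i) * (H (take i xs) * c i * R i)"
      using False R_step[OF that] by (auto simp: front_def sign_def ring_distribs mult.assoc)
    finally show ?thesis
      unfolding val_def l using False by (simp add: U_def V_def Psi_add Psi_sign)
  qed

  \<comment> \<open>In \<open>U k\<close> the entry \<open>x k\<close> has no right neighbour.
    Cyclicity of the trace brings it in front of \<open>x 0\<close>; this is permitted because its
    entries are functions, hence central.\<close>
  have last: "sign (sg xs k) * U k = sign ((ps k + int k + 1) * (e k + 1)) * val ((x k * x 0, e k + e 0) # butlast (tl xs))"
    if "k \<noteq> 0"
  proof -
    have ne': "take k xs \<noteq> []" using that ne by simp
    have b: "butlast (tl xs) = tl (take k xs)"
      using len by (simp add: butlast_conv_take tl_take)
    have hd: "hd (take k xs) = xs ! 0" using that ne by (simp add: hd_conv_nth)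
    have "H ((x k * x 0, e k + e 0) # butlast (tl xs)) = c k * H (take k xs)"
      by (simp add: H_def b hd c_def x_def fn_mat_mult mult.assoc flip: fps_const_mult)
    then have v: "val ((x k * x 0, e k + e 0) # butlast (tl xs)) = Psi (k - 1) (c k * H (take k xs))"
      using len by (simp add: val_def)
    have g: "\<And>y. y \<in> set (take k xs) \<Longrightarrow> good y" using good by (auto dest: in_set_takeD)
    have "Psi (k - 1) (H (take k xs) * fps_const (fn_mat (x k))) =
        sign (e k * (sum_list (map snd (take k xs)) + int (k - 1))) * Psi (k - 1) (fps_const (fn_mat (x k)) * H (take k xs))"
    proof (rule Psi_commute)
      show "tpar (sum_list (map snd (take k xs))) (H (take k xs))" "supp (H (take k xs))"
        by (rule H_props[OF ne'], erule g)+
      show "homog par (e k) (fn_mat (x k))"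
        using good_i[of k] by (intro homog_rmap) (auto simp: good_def)
      show "ent (fn_mat (x k)) i j * y = y * ent (fn_mat (x k)) i j" for i j y
        by (simp, rule of_fn_central)
    qed
    moreover have "sum_list (map snd (take k xs)) = ps k"
      using len by (simp add: sum_list_sum_nth atLeast0LessThan ps_def e_def)
    moreover have "R k = 1" using len by (simp add: R_def)
    ultimately have "U k = sign (e k * (ps k + int (k - 1))) * Psi (k - 1) (c k * H (take k xs))"
      by (simp add: U_def c_def)
    moreover have "sign (sg xs k) * sign (e k * (ps k + int (k - 1))) = (sign ((ps k + int k + 1) * (e k + 1)) :: 'a forms)"
      unfolding sign_add[symmetric] using that
      by (intro sign_eq) (auto simp: sg_def ps_def e_def of_nat_diff)
    ultimately show ?thesis unfolding v by (metis mult.assoc)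
  qed

  have "(\<Sum>i<k. sign ((\<Sum>j\<le>i. e j) + int i + 1) *
       val (take i xs @ (x i * x (Suc i), e i + e (Suc i)) # drop (i + 2) xs)) =
     (\<Sum>i<k. (if i = 0 then 0 else sign (sg xs i) * U i) - sign (sg xs (Suc i)) * V i)"
  proof (rule sum.cong[OF HOL.refl])
    fix i assume i: "i \<in> {..<k}"
    have "(\<Sum>j\<le>i. e j) = ps i + e i" by (simp add: ps_def lessThan_Suc_atMost[symmetric])
    then show "sign ((\<Sum>j\<le>i. e j) + int i + 1) *
       val (take i xs @ (x i * x (Suc i), e i + e (Suc i)) # drop (i + 2) xs) =
       (if i = 0 then 0 else sign (sg xs i) * U i) - sign (sg xs (Suc i)) * V i"
      using m[of i] i by (auto simp: sg_def ps_def e_def sign_def algebra_simps)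
  qed
  \<comment> \<open>\<open>U i\<close> comes from the commutator at slot \<open>i\<close> but
    belongs to the product of the entries \<open>i\<close> and \<open>i + 1\<close>. The resulting
    index shift leaves \<open>U k\<close> over, the term that is wrapped around.\<close>
  moreover have "(\<Sum>i<k. (if i = 0 then 0 else sign (sg xs i) * U i) - sign (sg xs (Suc i)) * V i) +
      (if k = 0 then 0 else sign (sg xs k) * U k) = (\<Sum>i<k. sign (sg xs (Suc i)) * (U (Suc i) - V i))"
  proof -
    have "(\<Sum>i<k. (if i = 0 then 0 else sign (sg xs i) * U i)) + (if k = 0 then 0 else sign (sg xs k) * U k)
        = (\<Sum>i<Suc k. (if i = 0 then 0 else sign (sg xs i) * U i))" by simp
    also have "\<dots> = (\<Sum>i<k. sign (sg xs (Suc i)) * U (Suc i))"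
      unfolding sum.lessThan_Suc_shift by simp
    finally show ?thesis by (simp add: sum_subtractf right_diff_distrib)
  qed
  ultimately show ?thesis
    using 1 last d len unfolding x_def[symmetric] e_def[symmetric] ps_def[symmetric]
    by (auto simp: algebra_simps)
qed

end

section \<open>Functions and forms on an affine variety\<close>

lemma sum_fun_apply: "(sum f S) x = (\<Sum>s\<in>S. f s x)"
  by (induction S rule: infinite_finite_induct) (auto simp: zero_fun_def plus_fun_def)

text \<open>Multiplication by \<open>l powi N\<close> gives a polynomial that has every nonzero
  complex number as a root.\<close>

lemma laurent_coeffs_eq_0:
  fixes c :: "int \<Rightarrow> complex"
  assumes "\<And>l. l \<noteq> 0 \<Longrightarrow> (\<Sum>m=-N..N. l powi m * c m) = 0" "m \<in> {-N..N}"
  shows "c m = 0"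
proof (rule ccontr)
  assume "c m \<noteq> 0"
  let ?n = "nat (2 * N)" and ?d = "\<lambda>i. c (int i - N)"
  have "finite {z. (\<Sum>i\<le>?n. ?d i * z ^ i) = 0}"
    using polyfun_finite_roots[of ?d ?n] \<open>c m \<noteq> 0\<close> assms(2)
    by (auto intro!: exI[of _ "nat (m + N)"])
  moreover have "- {0} \<subseteq> {z. (\<Sum>i\<le>?n. ?d i * z ^ i) = 0}"
  proof
    fix z :: complex assume z: "z \<in> - {0}"
    have "(\<Sum>i\<le>?n. ?d i * z ^ i) = (\<Sum>m=-N..N. c m * z powi (m + N))"
      by (rule sum.reindex_bij_witness[of _ "\<lambda>m. nat (m + N)" "\<lambda>i. int i - N"])
        (use assms(2) in \<open>auto simp: power_int_def\<close>)
    also have "\<dots> = z powi N * (\<Sum>m=-N..N. z powi m * c m)"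
      using z by (simp add: sum_distrib_left power_int_add mult_ac)
    finally show "z \<in> {z. (\<Sum>i\<le>?n. ?d i * z ^ i) = 0}" using z assms(1)[of z] by simp
  qed
  ultimately have "finite (- {0 :: complex})" using finite_subset by blast
  then show False using infinite_UNIV_char_0[where 'a = complex] by (metis finite_Diff_insert Compl_eq_Diff_UNIV finite_Diff2 finite.emptyI finite.insertI)
qed

section \<open>Sums of graded pieces and homogeneous maps\<close>

lemma module_of_piece: "x \<in> M i \<Longrightarrow> x \<in> module_of M"
  unfolding module_of_def by (rule CollectI, rule exI[of _ "{i}"], rule exI[of _ "\<lambda>_. x"]) auto

lemma module_of_0: "0 \<in> module_of M"
  unfolding module_of_def by (rule CollectI, rule exI[of _ "{}"]) auto

definition pieces_closed :: "(int \<Rightarrow> 'm::ab_group_add set) \<Rightarrow> bool" where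
  "pieces_closed M \<longleftrightarrow> (\<forall>i. 0 \<in> M i \<and> (\<forall>x\<in>M i. \<forall>y\<in>M i. x - y \<in> M i))"

lemma pieces_closed_add: "pieces_closed M \<Longrightarrow> x \<in> M i \<Longrightarrow> y \<in> M i \<Longrightarrow> x + y \<in> M i"
  unfolding pieces_closed_def by (metis diff_0 diff_minus_eq_add)

lemma module_of_add:
  assumes M: "pieces_closed M" and "x \<in> module_of M" "y \<in> module_of M"
  shows "x + y \<in> module_of M"
proof -
  obtain S f where S: "finite S" "\<forall>i\<in>S. f i \<in> M i" "x = sum f S"
    using assms(2) by (auto simp: module_of_def)
  obtain T g where T: "finite T" "\<forall>i\<in>T. g i \<in> M i" "y = sum g T"
    using assms(3) by (auto simp: module_of_def)
  let ?h = "\<lambda>i. (if i \<in> S then f i else 0) + (if i \<in> T then g i else 0)"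
  have "x + y = (\<Sum>i\<in>S \<union> T. ?h i)"
    using S(1) T(1) by (simp add: S(3) T(3) sum.distrib sum.If_cases Int_absorb1 Int_absorb2)
  moreover have "\<forall>i\<in>S \<union> T. ?h i \<in> M i"
    using S(2) T(2) M pieces_closed_add[OF M] by (auto simp: pieces_closed_def)
  ultimately show ?thesis using S(1) T(1) unfolding module_of_def by blast
qed

lemma module_of_sum:
  assumes "pieces_closed M" "\<And>s. s \<in> S \<Longrightarrow> f s \<in> module_of M"
  shows "sum f S \<in> module_of M"
  using assms(2) by (induction S rule: infinite_finite_induct) (auto simp: module_of_0 module_of_add[OF assms(1)])

lemma module_of_induct [consumes 1, case_names zero add]:
  assumes "x \<in> module_of M" "P 0" "\<And>x y i. x \<in> M i \<Longrightarrow> y \<in> module_of M \<Longrightarrow> P y \<Longrightarrow> P (x + y)"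
  shows "P x"
proof -
  obtain S f where S: "finite S" "\<forall>i\<in>S. f i \<in> M i" "x = sum f S"
    using assms(1) by (auto simp: module_of_def)
  have "P (sum f S) \<and> sum f S \<in> module_of M" using S(1,2)
  proof induction
    case (insert i S)
    then show ?case using assms(3)[of "f i" i "sum f S"] unfolding module_of_def
      by (auto intro!: exI[of _ "insert i S"] exI[of _ f])
  qed (simp add: assms(2) module_of_0)
  then show ?thesis by (simp add: S(3))
qed

lemma graded_hom_add: "f \<in> graded_hom s1 s2 M N n \<Longrightarrow> x \<in> module_of M \<Longrightarrow> y \<in> module_of M \<Longrightarrow> f (x + y) = f x + f y"
  by (auto simp: graded_hom_def)

lemma graded_hom_scale: "f \<in> graded_hom s1 s2 M N n \<Longrightarrow> x \<in> module_of M \<Longrightarrow> f (s1 a x) = s2 a (f x)"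
  by (auto simp: graded_hom_def)

lemma graded_hom_piece: "f \<in> graded_hom s1 s2 M N n \<Longrightarrow> x \<in> M i \<Longrightarrow> f x \<in> N (i + n)"
  by (auto simp: graded_hom_def)

lemma graded_hom_outside: "f \<in> graded_hom s1 s2 M N n \<Longrightarrow> x \<notin> module_of M \<Longrightarrow> f x = 0"
  by (auto simp: graded_hom_def)

lemma graded_hom_0: "f \<in> graded_hom s1 s2 M N n \<Longrightarrow> f 0 = 0"
  using graded_hom_add[of f s1 s2 M N n 0 0] module_of_0[of M] by simp

lemma graded_hom_sum:
  assumes "f \<in> graded_hom s1 s2 M N n" "pieces_closed M" "\<And>s. s \<in> S \<Longrightarrow> g s \<in> module_of M"
  shows "f (sum g S) = (\<Sum>s\<in>S. f (g s))"
  using assms(3)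
proof (induction S rule: infinite_finite_induct)
  case (insert s S)
  then show ?case using graded_hom_add[OF assms(1), of "g s" "sum g S"] module_of_sum[OF assms(2), of S g] by simp
qed (simp_all add: graded_hom_0[OF assms(1)])

lemma graded_hom_module:
  assumes "f \<in> graded_hom s1 s2 M N n" "pieces_closed N" "x \<in> module_of M"
  shows "f x \<in> module_of N"
  using assms(3)
proof (induction rule: module_of_induct)
  case (add x y i)
  have "f (x + y) = f x + f y"
    by (rule graded_hom_add[OF assms(1) module_of_piece]) (rule add)+
  moreover have "f x \<in> module_of N"
    by (rule module_of_piece, rule graded_hom_piece[OF assms(1) add(1)])
  ultimately show ?case using add(3) by (simp add: module_of_add[OF assms(2)])
qed (simp add: graded_hom_0[OF assms(1)] module_of_0)

lemma graded_hom_comp: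
  assumes f: "f \<in> graded_hom s1 s2 M N n" and g: "g \<in> graded_hom s2 s3 N P m" and "pieces_closed N"
  shows "g \<circ> f \<in> graded_hom s1 s3 M P (n + m)"
proof -
  note fm = graded_hom_module[OF f assms(3)]
  have "g (f x) \<in> P (i + (n + m))" if "x \<in> M i" for x i
    using graded_hom_piece[OF g graded_hom_piece[OF f that]] by (simp add: add.assoc)
  then show ?thesis
    unfolding graded_hom_def
    by (auto simp: graded_hom_add[OF f] graded_hom_add[OF g] fm graded_hom_scale[OF f] graded_hom_scale[OF g]
        graded_hom_outside[OF f] graded_hom_0[OF g])
qed

lemma of_fn_left_commute: "x * (of_fn f * y) = of_fn f * (x * y)"
  unfolding mult_assoc_eq[OF of_fn_central[of f x, symmetric]] by (rule mult.assoc)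

lemma dform_cons_vanish: "dform x * prod_list (map dform xs) * dform x = 0"
proof (induction xs)
  case (Cons y xs)
  have "dform x * (dform y * prod_list (map dform xs)) * dform x = - (dform y * (dform x * prod_list (map dform xs) * dform x))"
    using mult_assoc_eq[OF dform_anticommute[of x y]] by (simp add: mult.assoc)
  then show ?case using Cons by simp
qed (simp add: dform_square)

lemma prod_dform_not_distinct: "\<not> distinct xs \<Longrightarrow> prod_list (map dform xs) = 0"
proof -
  assume "\<not> distinct xs"
  then obtain as bs cs y where "xs = as @ [y] @ bs @ [y] @ cs" using not_distinct_decomp by blast
  then show ?thesis using dform_cons_vanish[of y bs] by (simp flip: mult.assoc)
qed

section \<open>Consequences of the torus action\<close>

context affine_LG_model
begin

abbreviation wt :: "'a \<Rightarrow> int \<Rightarrow> bool" where "wt \<equiv> has_weight X ev act"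

lemma ev_0: "x \<in> X \<Longrightarrow> ev 0 x = 0"
  using ev_of_complex[of x 0] by simp

lemma ev_minus: "x \<in> X \<Longrightarrow> ev (f - g) x = ev f x - ev g x"
  using ev_add[of x "f - g" g] by simp

lemma wt_0: "wt 0 w"
  by (simp add: has_weight_def ev_0 act_closed)

lemma wt_const: "wt (of_complex c) 0"
  by (simp add: has_weight_def ev_of_complex act_closed)

lemma wt_1: "wt 1 0"
  using wt_const[of 1] by (simp add: of_complex_1)

lemma wt_minus: "wt f w \<Longrightarrow> wt g w \<Longrightarrow> wt (f - g) w"
  by (simp add: has_weight_def ev_minus act_closed right_diff_distrib)

lemma wt_mult: "wt f v \<Longrightarrow> wt g w \<Longrightarrow> wt (f * g) (v + w)"
  by (simp add: has_weight_def ev_mult act_closed power_int_add mult_ac)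

lemma wt_scale: "wt f w \<Longrightarrow> wt (of_complex c * f) w"
  using wt_mult[OF wt_const, of f w c] by simp

text \<open>The element -1 acts trivially but multiplies a function of odd weight by -1. All
  statements on parities of matrices rest on this: a nonzero entry has even weight, which ties the
  degree of a map to the shifts of row and column.\<close>

lemma wt_odd: "wt f w \<Longrightarrow> odd w \<Longrightarrow> f = 0"
proof (rule ev_inject)
  fix x assume f: "wt f w" "odd w" and x: "x \<in> X"
  have "ev f x = (-1) powi w * ev f x"
    using f(1) x act_minus_1[OF x] by (auto simp: has_weight_def dest!: spec[of _ "-1 :: complex"])
  also have "(-1 :: complex) powi w = -1" using f(2) by simp
  finally show "ev f x = ev 0 x" using x by (simp add: ev_0)
qed

lemma free_closed: "pieces_closed (free_module wt r \<sigma>)"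
  by (auto simp: pieces_closed_def free_module_def wt_0 wt_minus zero_fun_def fun_diff_def)

lemma free_scale_homogeneous:
  assumes "v \<in> free_module wt r \<sigma> i" "wt a w"
  shows "vec_scale a v \<in> free_module wt r \<sigma> (i + w)"
proof -
  have "wt (a * v j) (i + w + \<sigma> j)" if "j < r" for j
    using wt_mult[of a w "v j" "i + \<sigma> j"] assms that by (simp add: free_module_def add_ac)
  then show ?thesis using assms(1) by (auto simp: free_module_def vec_scale_def)
qed

lemma vec_scale_add: "vec_scale a (u + v) = vec_scale a u + vec_scale a v"
  by (auto simp: vec_scale_def plus_fun_def ring_distribs)

lemma module_of_free_scale_homogeneous:
  assumes "v \<in> module_of (free_module wt r \<sigma>)" "wt a w"
  shows "vec_scale a v \<in> module_of (free_module wt r \<sigma>)"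
  using assms(1)
proof (induction rule: module_of_induct)
  case zero
  have "vec_scale a 0 = 0" by (auto simp: vec_scale_def zero_fun_def)
  show ?case unfolding \<open>vec_scale a 0 = 0\<close> by (rule module_of_0)
next
  case (add x y i)
  have "vec_scale a x \<in> module_of (free_module wt r \<sigma>)"
    by (rule module_of_piece, rule free_scale_homogeneous[OF add(1) assms(2)])
  then show ?case
    unfolding vec_scale_add by (rule module_of_add[OF free_closed _ add(3)])
qed

text \<open>Expand the coordinate at \<open>act (k * l) x = act k (act l x)\<close> as a Laurent
  polynomial in \<open>k\<close> in two ways. Comparison of coefficients says that the
  \<open>m\<close>-th coefficient function has weight \<open>m\<close>.\<close>

lemma coordinate_weight:
  assumes "\<And>l x. l \<noteq> 0 \<Longrightarrow> x \<in> X \<Longrightarrow> act l x $ i = (\<Sum>m=-N..N. l powi m * p m x)"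
    and "m \<in> {-N..N}" "\<forall>x\<in>X. ev g x = p m x"
  shows "wt g m"
  unfolding has_weight_def
proof (intro allI impI)
  fix l x assume l: "l \<noteq> (0 :: complex)" and x: "x \<in> X"
  have "l powi m * p m x - p m (act l x) = 0"
  proof (rule laurent_coeffs_eq_0[OF _ assms(2)])
    fix k :: complex assume k: "k \<noteq> 0"
    have "(\<Sum>m=-N..N. k powi m * (l powi m * p m x)) = act (k * l) x $ i"
      using assms(1)[of "k * l" x] k l x by (simp add: power_int_mult_distrib mult_ac)
    also have "act (k * l) x = act k (act l x)" using act_mult k l x by blast
    also have "act k (act l x) $ i = (\<Sum>m=-N..N. k powi m * p m (act l x))"
      using assms(1)[of k "act l x"] k act_closed[OF l x] by simp
    finally show "(\<Sum>m=-N..N. k powi m * (l powi m * p m x - p m (act l x))) = 0"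
      by (simp add: right_diff_distrib sum_subtractf)
  qed
  then show "ev g (act l x) = l powi m * ev g x"
    using assms(3) act_closed[OF l x] x by simp
qed

text \<open>By definition \<open>module_of\<close> consists of sums of homogeneous vectors, so
  scalars of mixed weight need an argument: functions are sums of homogeneous ones. For a coordinate
  this is its Laurent expansion under the action, evaluated at \<open>l = 1\<close>; sums and
  products then give all polynomials.\<close>

lemma module_of_free_scale:
  assumes "v \<in> module_of (free_module wt r \<sigma>)"
  shows "vec_scale a v \<in> module_of (free_module wt r \<sigma>)"
proof -
  let ?F = "module_of (free_module wt r \<sigma>)"
  have "\<forall>a. (\<forall>x\<in>X. ev a x = p x) \<longrightarrow> (\<forall>v\<in>?F. vec_scale a v \<in> ?F)" if "p \<in> polyfun" for p
    using that
  proof induction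
    case (const c)
    show ?case
    proof (intro allI impI)
      fix a assume "\<forall>x\<in>X. ev a x = c"
      then have "a = of_complex c" by (intro ev_inject) (simp add: ev_of_complex)
      then show "\<forall>v\<in>?F. vec_scale a v \<in> ?F"
        using module_of_free_scale_homogeneous wt_const by blast
    qed
  next
    case (coord i)
    obtain N p where Np: "\<forall>m. p m \<in> polyfun"
      "\<forall>l x. l \<noteq> 0 \<longrightarrow> x \<in> X \<longrightarrow> act l x $ i = (\<Sum>m=-N..N. l powi m * p m x)"
      using act_regular[of i] by (elim exE conjE) (rule that)
    note p = Np(1)[rule_format] Np(2)[rule_format]
    have "\<forall>m. \<exists>f. \<forall>x\<in>X. ev f x = p m x" using ev_onto[OF p(1)] by (rule allI)
    from choice[OF this] obtain g where "\<forall>m. \<forall>x\<in>X. ev (g m) x = p m x" by (elim exE)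
    note g = this[rule_format]
    have w: "wt (g m) m" if "m \<in> {-N..N}" for m
      using coordinate_weight[OF p(2) that] g by simp
    show ?case
    proof (intro allI impI ballI)
      fix a v assume a: "\<forall>x\<in>X. ev a x = x $ i" and v: "v \<in> ?F"
      have "a = (\<Sum>m=-N..N. g m)"
      proof (rule ev_inject)
        fix x assume x: "x \<in> X"
        have "ev (\<Sum>m\<in>S. g m) x = (\<Sum>m\<in>S. ev (g m) x)" for S
          by (induction S rule: infinite_finite_induct) (auto simp: ev_0 ev_add x)
        then show "ev a x = ev (\<Sum>m=-N..N. g m) x"
          using a x g p(2)[of 1 x] act_1[OF x] by simp
      qed
      then have eq: "vec_scale a v = (\<Sum>m=-N..N. vec_scale (g m) v)"
        by (auto simp: vec_scale_def sum_fun_apply sum_distrib_right)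
      show "vec_scale a v \<in> ?F"
        unfolding eq by (intro module_of_sum free_closed) (rule module_of_free_scale_homogeneous[OF v w])
    qed
  next
    case (add p q)
    show ?case
    proof (intro allI impI ballI)
      fix a v assume a: "\<forall>x\<in>X. ev a x = p x + q x" and v: "v \<in> ?F"
      obtain b where "\<forall>x\<in>X. ev b x = p x" using ev_onto[OF add.hyps(1)] by blast
      moreover obtain c where "\<forall>x\<in>X. ev c x = q x" using ev_onto[OF add.hyps(2)] by blast
      ultimately have bc: "\<forall>x\<in>X. ev b x = p x" "\<forall>x\<in>X. ev c x = q x" .
      from bc have "a = b + c" using a by (intro ev_inject) (simp add: ev_add)
      then have "vec_scale a v = vec_scale b v + vec_scale c v"
        by (auto simp: vec_scale_def plus_fun_def ring_distribs)
      then show "vec_scale a v \<in> ?F" using bc add.IH v by (simp add: module_of_add free_closed)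
    qed
  next
    case (mult p q)
    show ?case
    proof (intro allI impI ballI)
      fix a v assume a: "\<forall>x\<in>X. ev a x = p x * q x" and v: "v \<in> ?F"
      obtain b where "\<forall>x\<in>X. ev b x = p x" using ev_onto[OF mult.hyps(1)] by blast
      moreover obtain c where "\<forall>x\<in>X. ev c x = q x" using ev_onto[OF mult.hyps(2)] by blast
      ultimately have bc: "\<forall>x\<in>X. ev b x = p x" "\<forall>x\<in>X. ev c x = q x" .
      from bc have "a = b * c" using a by (intro ev_inject) (simp add: ev_mult)
      then have "vec_scale a v = vec_scale b (vec_scale c v)"
        by (auto simp: vec_scale_def mult_ac)
      then show "vec_scale a v \<in> ?F" using bc mult.IH v by simp
    qed
  qed
  then show ?thesis using ev_regular[of a] assms by blast
qed

text \<open>The chain rule for polynomials, by induction on a polynomial that represents the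
  function. Evaluation on \<open>X\<close> is injective, so each step determines the element of the
  coordinate ring.\<close>

lemma dform_coordinates:
  obtains x :: "'n \<Rightarrow> 'a" where "\<And>f. \<exists>g. dform f = (\<Sum>i\<in>UNIV. of_fn (g i) * dform (x i))"
proof -
  have "\<forall>i. \<exists>f. \<forall>y\<in>X. ev f y = y $ i" using ev_onto[OF polyfun.coord] by (rule allI)
  from choice[OF this] obtain c where "\<forall>i. \<forall>y\<in>X. ev (c i) y = y $ i" by (elim exE)
  note c = this[rule_format]
  have "\<forall>f. (\<forall>x\<in>X. ev f x = p x) \<longrightarrow> (\<exists>g. dform f = (\<Sum>i\<in>UNIV. of_fn (g i) * dform (c i)))"
    if "p \<in> polyfun" for p
    using that
  proof induction
    case (const k)
    show ?case
    proof (intro allI impI)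
      fix f assume "\<forall>x\<in>X. ev f x = k"
      then have "f = of_complex k" by (intro ev_inject) (simp add: ev_of_complex)
      then show "\<exists>g. dform f = (\<Sum>i\<in>UNIV. of_fn (g i) * dform (c i))"
        by (intro exI[of _ "\<lambda>_. 0"]) simp
    qed
  next
    case (coord i)
    show ?case
    proof (intro allI impI)
      fix f assume "\<forall>x\<in>X. ev f x = x $ i"
      then have "f = c i" using c by (intro ev_inject) simp
      then show "\<exists>g. dform f = (\<Sum>i\<in>UNIV. of_fn (g i) * dform (c i))"
        by (intro exI[of _ "\<lambda>j. if j = i then 1 else 0"]) (simp add: if_distrib[of of_fn] mult_delta_left cong: if_cong)
    qed
  next
    case (add p q)
    show ?case
    proof (intro allI impI)
      fix a assume a: "\<forall>x\<in>X. ev a x = p x + q x"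
      obtain b where "\<forall>x\<in>X. ev b x = p x" using ev_onto[OF add.hyps(1)] by blast
      moreover obtain b' where "\<forall>x\<in>X. ev b' x = q x" using ev_onto[OF add.hyps(2)] by blast
      ultimately have bc: "\<forall>x\<in>X. ev b x = p x" "\<forall>x\<in>X. ev b' x = q x" .
      from bc have eq: "a = b + b'" using a by (intro ev_inject) (simp add: ev_add)
      obtain g h where "dform b = (\<Sum>i\<in>UNIV. of_fn (g i) * dform (c i))"
          "dform b' = (\<Sum>i\<in>UNIV. of_fn (h i) * dform (c i))"
        using add.IH bc by blast
      then have "dform a = (\<Sum>i\<in>UNIV. of_fn (g i + h i) * dform (c i))"
        by (simp add: eq dform_add of_fn_add ring_distribs sum.distrib)
      then show "\<exists>g. dform a = (\<Sum>i\<in>UNIV. of_fn (g i) * dform (c i))"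
        by (rule exI[of _ "\<lambda>i. g i + h i"])
    qed
  next
    case (mult p q)
    show ?case
    proof (intro allI impI)
      fix a assume a: "\<forall>x\<in>X. ev a x = p x * q x"
      obtain b where "\<forall>x\<in>X. ev b x = p x" using ev_onto[OF mult.hyps(1)] by blast
      moreover obtain b' where "\<forall>x\<in>X. ev b' x = q x" using ev_onto[OF mult.hyps(2)] by blast
      ultimately have bc: "\<forall>x\<in>X. ev b x = p x" "\<forall>x\<in>X. ev b' x = q x" .
      from bc have eq: "a = b * b'" using a by (intro ev_inject) (simp add: ev_mult)
      obtain g h where "dform b = (\<Sum>i\<in>UNIV. of_fn (g i) * dform (c i))"
          "dform b' = (\<Sum>i\<in>UNIV. of_fn (h i) * dform (c i))"
        using mult.IH bc by blast
      then have "dform a = (\<Sum>i\<in>UNIV. of_fn (b * h i + b' * g i) * dform (c i))"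
        by (simp add: eq dform_mult of_fn_add of_fn_mult ring_distribs sum.distrib sum_distrib_left mult.assoc)
      then show "\<exists>g. dform a = (\<Sum>i\<in>UNIV. of_fn (g i) * dform (c i))"
        by (rule exI[of _ "\<lambda>i. b * h i + b' * g i"])
    qed
  qed
  then show thesis using that[of c] ev_regular by blast
qed

lemma form_degree_vanish:
  assumes "x \<in> form_degree (Suc CARD('n))"
  shows "(x :: 'a forms) = 0"
proof -
  obtain c :: "'n \<Rightarrow> 'a" where c: "\<And>f. \<exists>g. dform f = (\<Sum>i\<in>UNIV. of_fn (g i) * dform (c i))"
    using dform_coordinates by blast
  \<comment> \<open>Combinations, with functions as coefficients, of products of \<open>n\<close>
    coordinate differentials. One coefficient per list of coordinates makes products a mere
    reindexing; a list longer than the number of coordinates repeats one of them.\<close>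
  define M where "M n = {\<Sum>is\<in>{is. length is = n}. of_fn (g is) * prod_list (map dform (map c is)) | g. True}" for n
  have fin: "finite {is :: 'n list. length is = n}" for n
    using finite_lists_length_eq[of "UNIV :: 'n set" n] by simp
  have "prod_list (map dform fs) \<in> M (length fs)" for fs
  proof (induction fs)
    case Nil
    have "prod_list (map dform []) = (\<Sum>is\<in>{is. length is = 0}. of_fn 1 * prod_list (map dform (map c is)))"
      by simp
    then show ?case unfolding M_def by (intro CollectI exI[of _ "\<lambda>_. 1"]) auto
  next
    case (Cons f fs)
    then obtain g where g: "prod_list (map dform fs) =
        (\<Sum>is\<in>{is. length is = length fs}. of_fn (g is) * prod_list (map dform (map c is)))"
      unfolding M_def by blast
    obtain h where h: "dform f = (\<Sum>i\<in>UNIV. of_fn (h i) * dform (c i))" using c by blast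
    have "prod_list (map dform (f # fs)) =
        (\<Sum>i\<in>UNIV. \<Sum>is\<in>{is. length is = length fs}. of_fn (h i) * dform (c i) * (of_fn (g is) * prod_list (map dform (map c is))))"
      by (simp add: g h sum_product)
    also have "\<dots> = (\<Sum>(i, is)\<in>UNIV \<times> {is. length is = length fs}. of_fn (h i * g is) * prod_list (map dform (map c (i # is))))"
      unfolding sum.cartesian_product
    proof (rule sum.cong[OF HOL.refl], clarify)
      fix i "is"
      have "dform (c i) * (of_fn (g is) * Y) = of_fn (g is) * (dform (c i) * Y)" for Y
        by (rule of_fn_left_commute)
      then show "of_fn (h i) * dform (c i) * (of_fn (g is) * prod_list (map dform (map c is))) =
        of_fn (h i * g is) * prod_list (map dform (map c (i # is)))"
        by (simp add: of_fn_mult mult.assoc)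
    qed
    also have "\<dots> = (\<Sum>is\<in>{is. length is = Suc (length fs)}. of_fn (h (hd is) * g (tl is)) * prod_list (map dform (map c is)))"
      by (rule sum.reindex_bij_witness[of _ "\<lambda>is. (hd is, tl is)" "\<lambda>(i, is). i # is"])
        (auto simp: length_Suc_conv)
    finally show ?case unfolding M_def by auto
  qed
  moreover have "M (Suc CARD('n)) = {0}"
  proof -
    have "prod_list (map dform (map c is)) = 0" if "length is = Suc CARD('n)" for "is"
    proof (rule prod_dform_not_distinct)
      have "\<not> distinct is"
      proof
        assume "distinct is"
        then have "card (set is) = Suc CARD('n)" using that distinct_card by metis
        moreover have "card (set is) \<le> CARD('n)" by (rule card_mono) auto
        ultimately show False by simp
      qed
      then show "\<not> distinct (map c is)" by (simp add: distinct_map)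
    qed
    then show ?thesis unfolding M_def by auto
  qed
  ultimately have 0: "prod_list (map dform fs) = 0" if "length fs = Suc CARD('n)" for fs :: "'a list"
    using that by (metis singletonD)
  show ?thesis using assms by induction (simp_all add: 0)
qed

end

section \<open>Block matrices of morphisms between branes\<close>

text \<open>Indices are pairs of a brane and a row number. A morphism from \<open>B\<close> to
  \<open>C\<close> occupies the block at row \<open>B\<close> and column \<open>C\<close>, so
  composition in a category with many objects becomes multiplication in one ring.\<close>

definition blk :: "'o \<Rightarrow> 'o \<Rightarrow> 'b::ring_1 mat \<Rightarrow> ('o \<times> nat, 'b) rfm" where
  "blk B C M = Abs_rfm (\<lambda>p q. if fst p = B \<and> fst q = C \<and> snd p < dim_row M \<and> snd q < dim_col M
    then M $$ (snd p, snd q) else 0)"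

lemma ent_blk: "ent (blk B C M) p q =
    (if fst p = B \<and> fst q = C \<and> snd p < dim_row M \<and> snd q < dim_col M then M $$ (snd p, snd q) else 0)"
proof -
  let ?f = "\<lambda>p q. if fst p = B \<and> fst q = C \<and> snd p < dim_row M \<and> snd q < dim_col M
    then M $$ (snd p, snd q) else 0"
  have "finite {q. ?f p q \<noteq> 0}" for p
  proof (rule finite_subset)
    show "{q. ?f p q \<noteq> 0} \<subseteq> Pair C ` {..<dim_col M}"
    proof
      fix q assume "q \<in> {q. ?f p q \<noteq> 0}"
      then have "fst q = C" "snd q < dim_col M" by (auto split: if_splits)
      then show "q \<in> Pair C ` {..<dim_col M}" by (intro image_eqI[of _ _ "snd q"]) auto
    qed
  qed simp
  then have "?f \<in> {f. \<forall>i. finite {j. f i j \<noteq> 0}}" by (intro CollectI allI)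
  then have "ent (Abs_rfm ?f) = ?f" by (rule Abs_rfm_inverse)
  then show ?thesis by (simp only: blk_def)
qed

lemma rmap_blk: "h 0 = 0 \<Longrightarrow> rmap h (blk B C M) = blk B C (map_mat h M)"
  by (rule rfm_eqI) (auto simp: ent_rmap ent_blk)

lemma ent_blk_times:
  "ent (blk B C M * Y) p q =
    (if fst p = B \<and> snd p < dim_row M then \<Sum>l<dim_col M. M $$ (snd p, l) * ent Y (C, l) q else 0)"
proof -
  have "ent (blk B C M * Y) p q = (\<Sum>r\<in>Pair C ` {..<dim_col M}. ent (blk B C M) p r * ent Y r q)"
    by (rule ent_times) (auto simp: ent_blk split: if_splits)
  also have "\<dots> = (\<Sum>l<dim_col M. ent (blk B C M) p (C, l) * ent Y (C, l) q)"
    by (subst sum.reindex) (auto simp: inj_on_def o_def)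
  finally show ?thesis by (auto simp: ent_blk)
qed

lemma blk_mult:
  assumes "dim_col M = dim_row N"
  shows "blk B C M * blk C D N = blk B D (M * N)"
  by (rule rfm_eqI) (auto simp: ent_blk_times ent_blk assms scalar_prod_def atLeast0LessThan)

lemma blk_add:
  "dim_row M = dim_row N \<Longrightarrow> dim_col M = dim_col N \<Longrightarrow> blk B C (M + N) = blk B C M + blk B C N"
  by (rule rfm_eqI) (auto simp: ent_blk)

section \<open>Matrices of maps between free modules\<close>

definition hom_mat :: "nat \<Rightarrow> nat \<Rightarrow> ((nat \<Rightarrow> 'a::comm_ring_1) \<Rightarrow> nat \<Rightarrow> 'a) \<Rightarrow> 'a mat" where
  "hom_mat r s h = mat r s (\<lambda>(i, j). h (unit_row i) j)"

lemma hom_mat_dims [simp]: "dim_row (hom_mat r s h) = r" "dim_col (hom_mat r s h) = s"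
  by (simp_all add: hom_mat_def)

lemma hom_mat_cong: "(\<And>i. i < r \<Longrightarrow> h (unit_row i) = g (unit_row i)) \<Longrightarrow> hom_mat r s h = hom_mat r s g"
  by (rule eq_matI) (auto simp: hom_mat_def)

lemma mor_mat_hom_mat: "mor_mat R S \<alpha> = hom_mat (rank R) (rank S) (incl S \<circ> \<alpha> \<circ> proj R)"
  by (simp add: mor_mat_def hom_mat_def)

lemma dif_mat_hom_mat: "dif_mat R = hom_mat (rank R) (rank R) (bigD R)"
  by (simp add: dif_mat_def hom_mat_def)

context affine_LG_model
begin

lemma unit_row_free: "i < r \<Longrightarrow> unit_row i \<in> free_module wt r \<sigma> (- \<sigma> i)"
  by (auto simp: free_module_def unit_row_def wt_0 wt_1)

lemma unit_row_module: "i < r \<Longrightarrow> unit_row i \<in> module_of (free_module wt r \<sigma>)"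
  by (rule module_of_piece, erule unit_row_free)

lemma free_expand:
  assumes h: "h \<in> graded_hom vec_scale s2 (free_module wt r \<sigma>) N n" and v: "v \<in> free_module wt r \<sigma> i"
  shows "h v = (\<Sum>l<r. s2 (v l) (h (unit_row l)))"
proof -
  have u: "unit_row l \<in> module_of (free_module wt r \<sigma>)" if "l < r" for l
    using unit_row_free[OF that] by (rule module_of_piece)
  have *: "(\<Sum>l<r. vec_scale (v l) (unit_row l)) j = v j" for j
    using v by (auto simp: sum_fun_apply vec_scale_def unit_row_def free_module_def if_distrib not_less cong: if_cong)
  have "v = (\<Sum>l<r. vec_scale (v l) (unit_row l))"
    by (rule ext) (rule *[symmetric])
  then have "h v = h (\<Sum>l<r. vec_scale (v l) (unit_row l))" by (rule arg_cong)
  also have "\<dots> = (\<Sum>l<r. h (vec_scale (v l) (unit_row l)))"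
    by (rule graded_hom_sum[OF h free_closed]) (use u in \<open>auto intro: module_of_free_scale\<close>)
  also have "\<dots> = (\<Sum>l<r. s2 (v l) (h (unit_row l)))"
    using graded_hom_scale[OF h u] by simp
  finally show ?thesis .
qed

text \<open>Matrices act on row vectors from the right, hence the order of the factors is opposite
  to that of function composition.\<close>

lemma hom_mat_comp:
  assumes h: "h \<in> graded_hom vec_scale vec_scale (free_module wt r \<sigma>) (free_module wt s \<rho>) n"
    and g: "g \<in> graded_hom vec_scale vec_scale (free_module wt s \<rho>) N m"
  shows "hom_mat r t (g \<circ> h) = hom_mat r s h * hom_mat s t g"
proof (rule eq_matI)
  fix i j assume "i < dim_row (hom_mat r s h * hom_mat s t g)" "j < dim_col (hom_mat r s h * hom_mat s t g)"
  then have ij: "i < r" "j < t" by simp_all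
  have "g (h (unit_row i)) j = (\<Sum>l<s. h (unit_row i) l * g (unit_row l) j)"
    unfolding free_expand[OF g graded_hom_piece[OF h unit_row_free[OF ij(1)]]]
    by (simp add: sum_fun_apply vec_scale_def)
  then show "hom_mat r t (g \<circ> h) $$ (i, j) = (hom_mat r s h * hom_mat s t g) $$ (i, j)"
    using ij by (simp add: hom_mat_def scalar_prod_def atLeast0LessThan)
qed simp_all

lemma hom_mat_weight:
  assumes "h \<in> graded_hom vec_scale vec_scale (free_module wt r \<sigma>) (free_module wt s \<rho>) n" "i < r" "j < s"
  shows "wt (hom_mat r s h $$ (i, j)) (n - \<sigma> i + \<rho> j)"
  using graded_hom_piece[OF assms(1) unit_row_free[OF assms(2)]] assms(2,3)
  by (simp add: hom_mat_def free_module_def)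

end

section \<open>Branes with chosen realizations\<close>

locale brane_category = affine_LG_model X ev act W
  for X :: "(complex^'n) set" and ev :: "'a::complex_comm_algebra \<Rightarrow> complex^'n \<Rightarrow> complex"
    and act W +
  fixes sc :: "'a \<Rightarrow> 'm::ab_group_add \<Rightarrow> 'm"
    and R :: "'m brane \<Rightarrow> ('a, 'm) realization"
  assumes module_sc: "Modules.module sc"
    and realized: "B \<in> branes wt sc W \<Longrightarrow> realizes wt sc W (R B) B"
begin

sublocale scale: Modules.module sc
  by (rule module_sc)

abbreviation Br :: "'m brane set" where "Br \<equiv> branes wt sc W"
abbreviation rk :: "'m brane \<Rightarrow> nat" where "rk B \<equiv> rank (R B)"
abbreviation sh :: "'m brane \<Rightarrow> nat \<Rightarrow> int" where "sh B \<equiv> shift (R B)"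
abbreviation F :: "'m brane \<Rightarrow> int \<Rightarrow> (nat \<Rightarrow> 'a) set" where "F B \<equiv> free_module wt (rk B) (sh B)"
abbreviation hom :: "'m brane \<Rightarrow> 'm brane \<Rightarrow> int \<Rightarrow> ('m \<Rightarrow> 'm) set" where
  "hom B C n \<equiv> graded_hom sc sc (piece B) (piece C) n"

lemma brane_closed: "B \<in> Br \<Longrightarrow> pieces_closed (piece B)"
  by (simp add: branes_def fg_projective_def graded_module_def pieces_closed_def)

lemma brane_graded: "B \<in> Br \<Longrightarrow> graded_module wt sc (piece B)"
  by (simp add: branes_def fg_projective_def)

lemma brane_dif: "B \<in> Br \<Longrightarrow> dif B \<in> hom B B 1"
  by (simp add: branes_def)

lemma realization:
  assumes "B \<in> Br"
  shows "incl (R B) \<in> graded_hom sc vec_scale (piece B) (F B) 0"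
    and "proj (R B) \<in> graded_hom vec_scale sc (F B) (piece B) 0"
    and "x \<in> module_of (piece B) \<Longrightarrow> proj (R B) (incl (R B) x) = x"
    and "bigD (R B) \<in> graded_hom vec_scale vec_scale (F B) (F B) 1"
    and "v \<in> module_of (F B) \<Longrightarrow> bigD (R B) (bigD (R B) v) = vec_scale W v"
    and "x \<in> module_of (piece B) \<Longrightarrow> bigD (R B) (incl (R B) x) = incl (R B) (dif B x)"
    and "v \<in> module_of (F B) \<Longrightarrow> proj (R B) (bigD (R B) v) = dif B (proj (R B) v)"
  using realized[OF assms] by (auto simp: realizes_def Let_def)

definition ext :: "'m brane \<Rightarrow> 'm brane \<Rightarrow> ('m \<Rightarrow> 'm) \<Rightarrow> (nat \<Rightarrow> 'a) \<Rightarrow> nat \<Rightarrow> 'a" where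
  "ext B C f = incl (R C) \<circ> f \<circ> proj (R B)"

lemma ext_hom:
  assumes "B \<in> Br" "C \<in> Br" "f \<in> hom B C n"
  shows "ext B C f \<in> graded_hom vec_scale vec_scale (F B) (F C) n"
  using graded_hom_comp[OF graded_hom_comp[OF realization(2)[OF assms(1)] assms(3) brane_closed[OF assms(1)]]
      realization(1)[OF assms(2)] brane_closed[OF assms(2)]]
  by (simp add: ext_def comp_assoc)

lemma mor_mat_ext: "mor_mat (R B) (R C) f = hom_mat (rk B) (rk C) (ext B C f)"
  by (simp add: mor_mat_hom_mat ext_def)

lemma mor_mat_dims [simp]: "dim_row (mor_mat (R B) (R C) f) = rk B" "dim_col (mor_mat (R B) (R C) f) = rk C"
  by (simp_all add: mor_mat_ext)

lemma dif_mat_dims [simp]: "dim_row (dif_mat (R B)) = rk B" "dim_col (dif_mat (R B)) = rk B"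
  by (simp_all add: dif_mat_hom_mat)

lemma proj_unit_row: "B \<in> Br \<Longrightarrow> i < rk B \<Longrightarrow> proj (R B) (unit_row i) \<in> module_of (piece B)"
  by (rule graded_hom_module[OF realization(2) brane_closed unit_row_module])

text \<open>Between the two extended maps stands \<open>proj\<close> after \<open>incl\<close> for
  the middle brane, which is the identity on its module.\<close>

lemma mor_mat_comp:
  assumes "B \<in> Br" "C \<in> Br" "K \<in> Br" "f \<in> hom B C n" "g \<in> hom C K m"
  shows "mor_mat (R B) (R K) (g \<circ> f) = mor_mat (R B) (R C) f * mor_mat (R C) (R K) g"
proof -
  have "hom_mat (rk B) (rk K) (ext B K (g \<circ> f)) = hom_mat (rk B) (rk K) (ext C K g \<circ> ext B C f)"
  proof (rule hom_mat_cong)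
    fix i assume "i < rk B"
    then have "f (proj (R B) (unit_row i)) \<in> module_of (piece C)"
      using assms by (intro graded_hom_module[OF assms(4)] brane_closed proj_unit_row)
    then show "ext B K (g \<circ> f) (unit_row i) = (ext C K g \<circ> ext B C f) (unit_row i)"
      using realization(3)[OF assms(2)] by (simp add: ext_def)
  qed
  then show ?thesis
    unfolding mor_mat_ext by (simp add: hom_mat_comp[OF ext_hom[OF assms(1,2,4)] ext_hom[OF assms(2,3,5)]])
qed

lemma sc_sign: "sc (sign n) x = (if even n then x else - x)"
  by (simp add: sign_def)

lemma module_of_uminus: "pieces_closed M \<Longrightarrow> x \<in> module_of M \<Longrightarrow> - x \<in> module_of M"
proof -
  assume M: "pieces_closed M" and "x \<in> module_of M"
  then obtain S f where S: "finite S" "\<forall>i\<in>S. f i \<in> M i" "x = sum f S"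
    by (auto simp: module_of_def)
  have "- f i \<in> module_of M" if "i \<in> S" for i
    by (rule module_of_piece[of _ _ i]) (use M S that in \<open>metis diff_0 pieces_closed_def\<close>)
  then show ?thesis using module_of_sum[OF M, of S "\<lambda>i. - f i"] by (simp add: S sum_negf)
qed

lemma graded_hom_uminus:
  "f \<in> graded_hom s1 s2 M N n \<Longrightarrow> pieces_closed M \<Longrightarrow> x \<in> module_of M \<Longrightarrow> f (- x) = - f x"
  using graded_hom_add[of f s1 s2 M N n x "- x"] graded_hom_0[of f s1 s2 M N n]
  by (simp add: module_of_uminus eq_neg_iff_add_eq_0 add.commute)

lemma brane_delta_hom:
  assumes "B \<in> Br" "C \<in> Br" "f \<in> hom B C n"
  shows "brane_delta sc B C n f \<in> hom B C (n + 1)"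
proof -
  have 1: "f \<circ> dif B \<in> hom B C (1 + n)"
    by (rule graded_hom_comp[OF brane_dif assms(3) brane_closed]) (use assms in auto)
  have 2: "dif C \<circ> f \<in> hom B C (n + 1)"
    by (rule graded_hom_comp[OF assms(3) brane_dif brane_closed]) (use assms in auto)
  have c: "pieces_closed (piece C)" using assms(2) by (rule brane_closed)
  have "f (dif B x) - sc (sign n) (dif C (f x)) \<in> piece C (i + (n + 1))" if "x \<in> piece B i" for x i
    using graded_hom_piece[OF 1 that] graded_hom_piece[OF 2 that] c
    by (auto simp: sc_sign pieces_closed_def add_ac) (metis diff_0 diff_minus_eq_add)
  moreover have "f (dif B (x + y)) - sc (sign n) (dif C (f (x + y))) =
      f (dif B x) - sc (sign n) (dif C (f x)) + (f (dif B y) - sc (sign n) (dif C (f y)))"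
    if "x \<in> module_of (piece B)" "y \<in> module_of (piece B)" for x y
    using graded_hom_add[OF 1 that] graded_hom_add[OF 2 that] by (simp add: sc_sign)
  moreover have "f (dif B (sc a x)) - sc (sign n) (dif C (f (sc a x))) =
      sc a (f (dif B x) - sc (sign n) (dif C (f x)))" if "x \<in> module_of (piece B)" for x a
    using graded_hom_scale[OF 1 that] graded_hom_scale[OF 2 that]
    by (cases "even n") (simp_all add: sign_def scale.scale_right_diff_distrib scale.scale_right_distrib)
  moreover have "f (dif B x) - sc (sign n) (dif C (f x)) = 0" if "x \<notin> module_of (piece B)" for x
    using graded_hom_outside[OF 1 that] graded_hom_outside[OF 2 that] by (simp add: sc_sign)
  ultimately show ?thesis by (auto simp: graded_hom_def brane_delta_def)
qed

text \<open>\<open>incl\<close> and \<open>proj\<close> intertwine the differential of the brane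
  with \<open>bigD\<close>. Therefore the matrix of the differential of a morphism, which is
  extended by zero, is still the graded commutator with the matrices of \<open>bigD\<close>,
  whatever \<open>bigD\<close> does on the complement.\<close>

lemma mor_mat_delta:
  assumes "B \<in> Br" "C \<in> Br" "f \<in> hom B C n"
  shows "mor_mat (R B) (R C) (brane_delta sc B C n f) =
    dif_mat (R B) * mor_mat (R B) (R C) f + (- sign n) \<cdot>\<^sub>m (mor_mat (R B) (R C) f * dif_mat (R C))"
proof -
  note e = ext_hom[OF assms]
  have 1: "hom_mat (rk B) (rk C) (ext B C f \<circ> bigD (R B)) = dif_mat (R B) * mor_mat (R B) (R C) f"
    unfolding mor_mat_ext dif_mat_hom_mat by (rule hom_mat_comp[OF realization(4)[OF assms(1)] e])
  have 2: "hom_mat (rk B) (rk C) (bigD (R C) \<circ> ext B C f) = mor_mat (R B) (R C) f * dif_mat (R C)"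
    unfolding mor_mat_ext dif_mat_hom_mat by (rule hom_mat_comp[OF e realization(4)[OF assms(2)]])
  have delta: "ext B C (brane_delta sc B C n f) (unit_row i) j =
      ext B C f (bigD (R B) (unit_row i)) j + (- sign n) * bigD (R C) (ext B C f (unit_row i)) j"
    if i: "i < rk B" for i j
  proof -
    let ?x = "proj (R B) (unit_row i)"
    have x: "?x \<in> module_of (piece B)" using assms(1) i by (rule proj_unit_row)
    have fx: "f ?x \<in> module_of (piece C)"
      using assms x by (intro graded_hom_module[OF assms(3)] brane_closed)
    have d: "dif C (f ?x) \<in> module_of (piece C)"
      using assms fx by (intro graded_hom_module[OF brane_dif] brane_closed)
    have fd: "f (dif B ?x) \<in> module_of (piece C)"
      using assms x by (intro graded_hom_module[OF assms(3)] graded_hom_module[OF brane_dif] brane_closed)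
    note I = realization(1)[OF assms(2)]
    have "incl (R C) (f (dif B ?x) - sc (sign n) (dif C (f ?x))) =
        incl (R C) (f (dif B ?x)) + vec_scale (- sign n) (incl (R C) (dif C (f ?x)))"
      using graded_hom_add[OF I fd, of "- sc (sign n) (dif C (f ?x))"] d
        graded_hom_uminus[OF I brane_closed[OF assms(2)] d] module_of_uminus[OF brane_closed[OF assms(2)] d]
      by (auto simp: sc_sign sign_def vec_scale_def)
    moreover have "bigD (R C) (incl (R C) (f ?x)) = incl (R C) (dif C (f ?x))"
      by (rule realization(6)[OF assms(2) fx])
    moreover have "proj (R B) (bigD (R B) (unit_row i)) = dif B ?x"
      by (rule realization(7)[OF assms(1) unit_row_module[OF i]])
    ultimately show ?thesis by (simp add: ext_def brane_delta_def vec_scale_def)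
  qed
  show ?thesis
  proof (rule eq_matI)
    fix i j assume "i < dim_row (dif_mat (R B) * mor_mat (R B) (R C) f + (- sign n) \<cdot>\<^sub>m (mor_mat (R B) (R C) f * dif_mat (R C)))"
      "j < dim_col (dif_mat (R B) * mor_mat (R B) (R C) f + (- sign n) \<cdot>\<^sub>m (mor_mat (R B) (R C) f * dif_mat (R C)))"
    then have ij: "i < rk B" "j < rk C" by simp_all
    have "(dif_mat (R B) * mor_mat (R B) (R C) f) $$ (i, j) = ext B C f (bigD (R B) (unit_row i)) j"
      unfolding 1[symmetric] using ij by (simp add: hom_mat_def)
    moreover have "(mor_mat (R B) (R C) f * dif_mat (R C)) $$ (i, j) = bigD (R C) (ext B C f (unit_row i)) j"
      unfolding 2[symmetric] using ij by (simp add: hom_mat_def)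
    moreover have "mor_mat (R B) (R C) (brane_delta sc B C n f) $$ (i, j) =
        ext B C (brane_delta sc B C n f) (unit_row i) j"
      unfolding mor_mat_ext using ij by (simp add: hom_mat_def)
    ultimately show "mor_mat (R B) (R C) (brane_delta sc B C n f) $$ (i, j) =
        (dif_mat (R B) * mor_mat (R B) (R C) f + (- sign n) \<cdot>\<^sub>m (mor_mat (R B) (R C) f * dif_mat (R C))) $$ (i, j)"
      using ij delta[OF ij(1), of j] by (simp del: index_mult_mat(1))
  qed simp_all
qed

lemma dif_mat_square: "B \<in> Br \<Longrightarrow> dif_mat (R B) * dif_mat (R B) = W \<cdot>\<^sub>m 1\<^sub>m (rk B)"
proof -
  assume B: "B \<in> Br"
  have "bigD (R B) (bigD (R B) (unit_row i)) j = W * unit_row i j" if "i < rk B" for i j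
    using realization(5)[OF B unit_row_module[OF that]] by (simp add: vec_scale_def)
  then show ?thesis
    unfolding dif_mat_hom_mat hom_mat_comp[OF realization(4)[OF B] realization(4)[OF B], symmetric]
    by (intro eq_matI) (auto simp: hom_mat_def unit_row_def)
qed

end

section \<open>Words of branes\<close>

lemma tgt_eq: "i < length w \<Longrightarrow> tgt w i = (if Suc i < length w then src (w ! Suc i) else src (w ! 0))"
  by (auto simp: tgt_def) (metis Suc_lessI mod_self)

definition arrow_data :: "'m arrow list \<Rightarrow> nat \<Rightarrow> 'm brane \<times> 'm brane \<times> int \<times> ('m \<Rightarrow> 'm)" where
  "arrow_data w i = (src (w ! i), tgt w i, deg (w ! i), mor (w ! i))"

text \<open>The target of a letter is implicit in a word: it is the source of the cyclically next
  letter. Once it is stored in each entry, merging, wrapping around and replacing a morphism change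
  single entries and leave the others alone.\<close>

definition arrows :: "'m arrow list \<Rightarrow> ('m brane \<times> 'm brane \<times> int \<times> ('m \<Rightarrow> 'm)) list" where
  "arrows w = map (arrow_data w) [0..<length w]"

lemma length_arrows [simp]: "length (arrows w) = length w"
  by (simp add: arrows_def)

lemma nth_arrows [simp]: "i < length w \<Longrightarrow> arrows w ! i = arrow_data w i"
  by (simp add: arrows_def)

definition merge_at :: "nat \<Rightarrow> 'm arrow list \<Rightarrow> 'm arrow list" where
  "merge_at i w = take i w @
     Arrow (src (w ! i)) (deg (w ! i) + deg (w ! Suc i)) (mor (w ! Suc i) \<circ> mor (w ! i)) # drop (i + 2) w"

definition wrap :: "'m arrow list \<Rightarrow> 'm arrow list" where
  "wrap w = (let k = length w - 1 in
     Arrow (src (w ! k)) (deg (w ! k) + deg (w ! 0)) (mor (w ! 0) \<circ> mor (w ! k)) # butlast (tl w))"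

definition set_mor :: "nat \<Rightarrow> int \<Rightarrow> ('m \<Rightarrow> 'm) \<Rightarrow> 'm arrow list \<Rightarrow> 'm arrow list" where
  "set_mor i n f w = w[i := Arrow (src (w ! i)) n f]"

lemma arrows_merge:
  assumes "Suc i < length w"
  shows "arrows (merge_at i w) = take i (arrows w) @
    (src (w ! i), tgt w (Suc i), deg (w ! i) + deg (w ! Suc i), mor (w ! Suc i) \<circ> mor (w ! i)) # drop (i + 2) (arrows w)"
proof (rule nth_equalityI)
  have len: "length (merge_at i w) = length w - 1" using assms by (simp add: merge_at_def)
  show "length (arrows (merge_at i w)) = length (take i (arrows w) @
    (src (w ! i), tgt w (Suc i), deg (w ! i) + deg (w ! Suc i), mor (w ! Suc i) \<circ> mor (w ! i)) # drop (i + 2) (arrows w))"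
    using assms len by simp
  fix j assume "j < length (arrows (merge_at i w))"
  then have j: "j < length w - 1" using len by simp
  have nth: "merge_at i w ! l = (if l < i then w ! l else if l = i then
      Arrow (src (w ! i)) (deg (w ! i) + deg (w ! Suc i)) (mor (w ! Suc i) \<circ> mor (w ! i)) else w ! Suc l)"
    if "l < length w - 1" for l
    using assms that by (auto simp: merge_at_def nth_append nth_Cons' Suc_diff_le)
  have srcs: "src (merge_at i w ! l) = (if l \<le> i then src (w ! l) else src (w ! Suc l))"
    if "l < length w - 1" for l
    using nth[OF that] by auto
  have t: "tgt (merge_at i w) j = (if j < i then tgt w j else tgt w (Suc j))"
    using j assms srcs[of "Suc j"] srcs[of 0] by (auto simp: tgt_eq len)
  show "arrows (merge_at i w) ! j = (take i (arrows w) @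
    (src (w ! i), tgt w (Suc i), deg (w ! i) + deg (w ! Suc i), mor (w ! Suc i) \<circ> mor (w ! i)) # drop (i + 2) (arrows w)) ! j"
    using j assms nth[OF j] t by (auto simp: nth_append nth_Cons' arrow_data_def len Suc_diff_le)
qed

lemma arrows_wrap:
  assumes "length w = Suc k" "k > 0"
  shows "arrows (wrap w) =
    (src (w ! k), tgt w 0, deg (w ! k) + deg (w ! 0), mor (w ! 0) \<circ> mor (w ! k)) # butlast (tl (arrows w))"
proof (rule nth_equalityI)
  have len: "length (wrap w) = k" using assms by (simp add: wrap_def Let_def)
  show "length (arrows (wrap w)) = length ((src (w ! k), tgt w 0, deg (w ! k) + deg (w ! 0),
      mor (w ! 0) \<circ> mor (w ! k)) # butlast (tl (arrows w)))"
    using assms len by simp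
  fix j assume "j < length (arrows (wrap w))"
  then have j: "j < k" using len by simp
  have nth: "wrap w ! l = (if l = 0 then
      Arrow (src (w ! k)) (deg (w ! k) + deg (w ! 0)) (mor (w ! 0) \<circ> mor (w ! k)) else w ! l)"
    if "l < k" for l
    using assms that by (auto simp: wrap_def Let_def nth_Cons' nth_butlast nth_tl)
  have t: "tgt (wrap w) j = tgt w j"
    using j assms nth[of "Suc j"] nth[of 0] by (auto simp: tgt_eq len) (metis Suc_lessI)
  show "arrows (wrap w) ! j = ((src (w ! k), tgt w 0, deg (w ! k) + deg (w ! 0),
      mor (w ! 0) \<circ> mor (w ! k)) # butlast (tl (arrows w))) ! j"
    using j assms nth[OF j] t by (auto simp: nth_Cons' arrow_data_def len nth_butlast nth_tl)
qed

lemma arrows_set_mor: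
  assumes "i < length w"
  shows "arrows (set_mor i n f w) = (arrows w)[i := (src (w ! i), tgt w i, n, f)]"
proof (rule nth_equalityI)
  fix j assume "j < length (arrows (set_mor i n f w))"
  then have j: "j < length w" by (simp add: set_mor_def)
  have "src (set_mor i n f w ! l) = src (w ! l)" if "l < length w" for l
    using that assms by (auto simp: set_mor_def nth_list_update)
  note srcs = this
  have len: "length (set_mor i n f w) = length w" "0 < length w" using j by (auto simp: set_mor_def)
  have "tgt (set_mor i n f w) j = tgt w j"
    using j srcs[of "Suc j"] srcs[OF len(2)] by (simp add: tgt_eq len)
  then show "arrows (set_mor i n f w) ! j = (arrows w)[i := (src (w ! i), tgt w i, n, f)] ! j"
    using j assms by (auto simp: arrow_data_def set_mor_def nth_list_update)
qed (simp add: set_mor_def)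

section \<open>All branes as one matrix factorization\<close>

context brane_category
begin

definition E :: "('m brane \<times> nat) set" where "E = {p. fst p \<in> Br \<and> snd p < rk (fst p)}"

definition par :: "'m brane \<times> nat \<Rightarrow> int" where "par p = sh (fst p) (snd p)"

definition D0 :: "('m brane \<times> nat, 'a) rfm" where
  "D0 = Abs_rfm (\<lambda>p q. if fst p = fst q \<and> p \<in> E \<and> q \<in> E then dif_mat (R (fst p)) $$ (snd p, snd q) else 0)"

definition index_set :: "'m brane set \<Rightarrow> ('m brane \<times> nat) set" where
  "index_set S = {p. fst p \<in> S \<and> snd p < rk (fst p)}"

definition mat_of :: "'m brane \<times> 'm brane \<times> int \<times> ('m \<Rightarrow> 'm) \<Rightarrow> ('m brane \<times> nat, 'a) rfm \<times> int" where
  "mat_of = (\<lambda>(B, C, n, f). (blk B C (mor_mat (R B) (R C) f), n))"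

definition mats :: "'m arrow list \<Rightarrow> (('m brane \<times> nat, 'a) rfm \<times> int) list" where
  "mats w = map mat_of (arrows w)"

definition valid :: "'m brane \<times> 'm brane \<times> int \<times> ('m \<Rightarrow> 'm) \<Rightarrow> bool" where
  "valid = (\<lambda>(B, C, n, f). B \<in> Br \<and> C \<in> Br \<and> f \<in> hom B C n)"

lemma ent_D0: "ent D0 p q =
    (if fst p = fst q \<and> p \<in> E \<and> q \<in> E then dif_mat (R (fst p)) $$ (snd p, snd q) else 0)"
proof -
  let ?f = "\<lambda>p q. if fst p = fst q \<and> p \<in> E \<and> q \<in> E then dif_mat (R (fst p)) $$ (snd p, snd q) else 0"
  have "finite {q. ?f p q \<noteq> 0}" for p
  proof (rule finite_subset)
    show "{q. ?f p q \<noteq> 0} \<subseteq> Pair (fst p) ` {..<rk (fst p)}"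
    proof
      fix q assume "q \<in> {q. ?f p q \<noteq> 0}"
      then have "fst q = fst p" "snd q < rk (fst p)" by (auto simp: E_def split: if_splits)
      then show "q \<in> Pair (fst p) ` {..<rk (fst p)}" by (intro image_eqI[of _ _ "snd q"]) (auto simp: prod_eq_iff)
    qed
  qed simp
  then have "?f \<in> {f. \<forall>i. finite {j. f i j \<noteq> 0}}" by (intro CollectI allI)
  then have "ent (Abs_rfm ?f) = ?f" by (rule Abs_rfm_inverse)
  then show ?thesis by (simp only: D0_def)
qed

lemma ent_D0_times:
  "ent (D0 * Y) p q = (if p \<in> E then \<Sum>l<rk (fst p). dif_mat (R (fst p)) $$ (snd p, l) * ent Y (fst p, l) q else 0)"
proof -
  have "ent (D0 * Y) p q = (\<Sum>r\<in>Pair (fst p) ` {..<rk (fst p)}. ent D0 p r * ent Y r q)"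
  proof (rule ent_times)
    fix r assume "ent D0 p r \<noteq> 0"
    then have "fst r = fst p" "snd r < rk (fst p)" by (auto simp: ent_D0 E_def split: if_splits)
    then show "r \<in> Pair (fst p) ` {..<rk (fst p)}" by (intro image_eqI[of _ _ "snd r"]) (auto simp: prod_eq_iff)
  qed simp
  also have "\<dots> = (\<Sum>l<rk (fst p). ent D0 p (fst p, l) * ent Y (fst p, l) q)"
    by (subst sum.reindex) (auto simp: inj_on_def o_def)
  finally show ?thesis by (auto simp: ent_D0 E_def)
qed

lemma D0_blk: "B \<in> Br \<Longrightarrow> dim_row M = rk B \<Longrightarrow> D0 * blk B C M = blk B C (dif_mat (R B) * M)"
  by (rule rfm_eqI) (auto simp: ent_D0_times ent_blk E_def scalar_prod_def atLeast0LessThan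
      intro!: sum.neutral)

lemma blk_D0: "C \<in> Br \<Longrightarrow> dim_col M = rk C \<Longrightarrow> blk B C M * D0 = blk B C (M * dif_mat (R C))"
  by (rule rfm_eqI) (auto simp: ent_blk_times ent_D0 ent_blk E_def scalar_prod_def atLeast0LessThan
      intro!: sum.neutral)

lemma odd_weight_0: "wt f (n - s + t) \<Longrightarrow> f \<noteq> 0 \<Longrightarrow> even (n + s + t)"
  using wt_odd[of f "n - s + t"] by (cases "even (n - s + t)") auto

text \<open>Oddness of \<open>D0\<close> is a statement on weights: an entry of a map of degree 1
  has weight \<open>1 - sh i + sh j\<close>, and a nonzero function has even weight. The bound is
  one more than the number of coordinates, since longer products of coordinate differentials repeat
  a factor.\<close>

lemma matrix_factorization:
  assumes "finite S" "S \<subseteq> Br"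
  shows "matrix_factorization par E D0 W (index_set S) (Suc CARD('n))"
proof
  show "homog par 1 D0"
    unfolding homog_def
  proof (intro allI impI)
    fix p q assume "ent D0 p q \<noteq> 0"
    then have *: "fst p = fst q" "p \<in> E" "q \<in> E" "dif_mat (R (fst p)) $$ (snd p, snd q) \<noteq> 0"
      by (auto simp: ent_D0 split: if_splits)
    then have "wt (dif_mat (R (fst p)) $$ (snd p, snd q)) (1 - sh (fst p) (snd p) + sh (fst p) (snd q))"
      unfolding dif_mat_hom_mat by (intro hom_mat_weight realization(4)) (auto simp: E_def)
    from odd_weight_0[OF this *(4)] show "even (1 + par p + par q)"
      using *(1) by (simp add: par_def)
  qed
  show "D0 * D0 = diag (\<lambda>i. if i \<in> E then W else 0)"
  proof (rule rfm_eqI)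
    fix p q
    show "ent (D0 * D0) p q = ent (diag (\<lambda>i. if i \<in> E then W else 0)) p q"
    proof (cases "p \<in> E \<and> fst q = fst p \<and> snd q < rk (fst p)")
      case True
      then have "ent (D0 * D0) p q = (dif_mat (R (fst p)) * dif_mat (R (fst p))) $$ (snd p, snd q)"
        by (auto simp: ent_D0_times ent_D0 E_def scalar_prod_def atLeast0LessThan)
      also have "\<dots> = (W \<cdot>\<^sub>m 1\<^sub>m (rk (fst p))) $$ (snd p, snd q)"
        using True by (subst dif_mat_square) (auto simp: E_def)
      finally show ?thesis using True by (auto simp: ent_diag E_def prod_eq_iff)
    next
      case False
      then show ?thesis by (auto simp: ent_D0_times ent_D0 ent_diag E_def intro!: sum.neutral)
    qed
  qed
  show "ent D0 p q \<noteq> 0 \<Longrightarrow> p \<in> E \<and> q \<in> E" for p q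
    by (auto simp: ent_D0 split: if_splits)
  show "ent D0 p q \<noteq> 0 \<Longrightarrow> p \<in> index_set S \<longleftrightarrow> q \<in> index_set S" for p q
    by (auto simp: ent_D0 E_def index_set_def split: if_splits)
  show "finite (index_set S)"
  proof (rule finite_subset)
    show "index_set S \<subseteq> (SIGMA B:S. {..<rk B})" by (auto simp: index_set_def)
  qed (use assms in auto)
  show "x \<in> form_degree (Suc CARD('n)) \<Longrightarrow> x = 0" for x :: "'a forms"
    by (rule form_degree_vanish)
qed

lemma words_valid: "w \<in> words wt sc W \<longleftrightarrow> w \<noteq> [] \<and> (\<forall>a\<in>set (arrows w). valid a)"
proof
  assume w: "w \<in> words wt sc W"
  have "tgt w i \<in> Br" if "i < length w" for i
    using w that by (auto simp: words_def tgt_eq)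
  then show "w \<noteq> [] \<and> (\<forall>a\<in>set (arrows w). valid a)"
    using w by (auto simp: words_def arrows_def arrow_data_def valid_def)
next
  assume "w \<noteq> [] \<and> (\<forall>a\<in>set (arrows w). valid a)"
  then show "w \<in> words wt sc W"
    by (auto simp: words_def arrows_def arrow_data_def valid_def)
qed

lemma words_nth:
  assumes "w \<in> words wt sc W" "i < length w"
  shows "src (w ! i) \<in> Br" "tgt w i \<in> Br" "mor (w ! i) \<in> hom (src (w ! i)) (tgt w i) (deg (w ! i))"
proof -
  have "arrow_data w i \<in> set (arrows w)" using assms(2) by (auto simp: arrows_def)
  then have "valid (arrow_data w i)" using assms(1) words_valid by blast
  then show "src (w ! i) \<in> Br" "tgt w i \<in> Br" "mor (w ! i) \<in> hom (src (w ! i)) (tgt w i) (deg (w ! i))"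
    by (auto simp: valid_def arrow_data_def)
qed

lemma valid_comp:
  assumes "w \<in> words wt sc W" "i < length w" "j < length w" "tgt w i = src (w ! j)"
  shows "valid (src (w ! i), tgt w j, deg (w ! i) + deg (w ! j), mor (w ! j) \<circ> mor (w ! i))"
    and "mat_of (src (w ! i), tgt w j, deg (w ! i) + deg (w ! j), mor (w ! j) \<circ> mor (w ! i)) =
      (fst (mat_of (arrow_data w i)) * fst (mat_of (arrow_data w j)),
       snd (mat_of (arrow_data w i)) + snd (mat_of (arrow_data w j)))"
proof -
  note i = words_nth[OF assms(1,2)] and j = words_nth[OF assms(1,3)]
  show "valid (src (w ! i), tgt w j, deg (w ! i) + deg (w ! j), mor (w ! j) \<circ> mor (w ! i))"
    unfolding valid_def using i j assms(4) by (auto intro!: graded_hom_comp brane_closed)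
  have "mor_mat (R (src (w ! i))) (R (tgt w j)) (mor (w ! j) \<circ> mor (w ! i)) =
     mor_mat (R (src (w ! i))) (R (tgt w i)) (mor (w ! i)) * mor_mat (R (tgt w i)) (R (tgt w j)) (mor (w ! j))"
    using i j assms(4) by (intro mor_mat_comp) auto
  then show "mat_of (src (w ! i), tgt w j, deg (w ! i) + deg (w ! j), mor (w ! j) \<circ> mor (w ! i)) =
      (fst (mat_of (arrow_data w i)) * fst (mat_of (arrow_data w j)),
       snd (mat_of (arrow_data w i)) + snd (mat_of (arrow_data w j)))"
    using assms(4) by (simp add: mat_of_def arrow_data_def blk_mult)
qed

lemma length_mats [simp]: "length (mats w) = length w"
  by (simp add: mats_def)

lemma mats_nth: "i < length w \<Longrightarrow> mats w ! i = mat_of (arrow_data w i)"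
  by (simp add: mats_def)

lemma merge_words:
  assumes w: "w \<in> words wt sc W" and i: "Suc i < length w"
  shows "merge_at i w \<in> words wt sc W"
    and "mats (merge_at i w) = take i (mats w) @ (fst (mats w ! i) * fst (mats w ! Suc i),
      snd (mats w ! i) + snd (mats w ! Suc i)) # drop (i + 2) (mats w)"
proof -
  have t: "tgt w i = src (w ! Suc i)" using i by (simp add: tgt_eq)
  note v = valid_comp[OF w Suc_lessD[OF i] i t]
  have "merge_at i w \<noteq> []" by (simp add: merge_at_def)
  then show "merge_at i w \<in> words wt sc W"
    using w v(1) unfolding words_valid arrows_merge[OF i]
    by (auto dest: in_set_takeD in_set_dropD)
  show "mats (merge_at i w) = take i (mats w) @ (fst (mats w ! i) * fst (mats w ! Suc i),
      snd (mats w ! i) + snd (mats w ! Suc i)) # drop (i + 2) (mats w)"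
    using v(2) i by (simp add: mats_def arrows_merge take_map drop_map)
qed

lemma wrap_words:
  assumes w: "w \<in> words wt sc W" and k: "length w = Suc k" "k > 0"
  shows "wrap w \<in> words wt sc W"
    and "mats (wrap w) = (fst (mats w ! k) * fst (mats w ! 0),
      snd (mats w ! k) + snd (mats w ! 0)) # butlast (tl (mats w))"
proof -
  have t: "tgt w k = src (w ! 0)" using k by (simp add: tgt_eq)
  have lt: "k < length w" "0 < length w" using k by auto
  note v = valid_comp[OF w lt t]
  have "set (butlast (tl (arrows w))) \<subseteq> set (arrows w)"
    by (cases "arrows w") (auto dest: in_set_butlastD)
  moreover have "wrap w \<noteq> []" by (simp add: wrap_def Let_def)
  ultimately show "wrap w \<in> words wt sc W"
    using w v(1) unfolding words_valid arrows_wrap[OF k]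
    by auto
  show "mats (wrap w) = (fst (mats w ! k) * fst (mats w ! 0),
      snd (mats w ! k) + snd (mats w ! 0)) # butlast (tl (mats w))"
    using v(2) k by (simp add: mats_def arrows_wrap map_butlast map_tl)
qed

lemma set_mor_words:
  assumes w: "w \<in> words wt sc W" and i: "i < length w" and f: "f \<in> hom (src (w ! i)) (tgt w i) n"
  shows "set_mor i n f w \<in> words wt sc W"
    and "mats (set_mor i n f w) = (mats w)[i := mat_of (src (w ! i), tgt w i, n, f)]"
proof -
  have "set_mor i n f w \<noteq> []" using i by (auto simp: set_mor_def)
  moreover have "valid (src (w ! i), tgt w i, n, f)" using words_nth[OF w i] f by (simp add: valid_def)
  ultimately show "set_mor i n f w \<in> words wt sc W"
    using w unfolding words_valid arrows_set_mor[OF i] by (auto dest!: subsetD[OF set_update_subset_insert])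
  show "mats (set_mor i n f w) = (mats w)[i := mat_of (src (w ! i), tgt w i, n, f)]"
    by (simp add: mats_def arrows_set_mor[OF i] map_update)
qed

lemma mats_good:
  assumes "w \<in> words wt sc W" "src ` set w \<subseteq> S" "finite S" "S \<subseteq> Br" "y \<in> set (mats w)"
  shows "matrix_factorization.good par E (index_set S) y"
proof -
  interpret matrix_factorization par E D0 W "index_set S" "Suc CARD('n)"
    by (rule matrix_factorization) fact+
  obtain i where i: "i < length w" "y = mat_of (arrow_data w i)"
    using assms(5) by (auto simp: in_set_conv_nth mats_nth)
  note wi = words_nth[OF assms(1) i(1)]
  have src: "src (w ! l) \<in> S" if "l < length w" for l
    using assms(2) nth_mem[OF that] by blast
  have "0 < length w" by (rule le_less_trans[OF le0 i(1)])
  then have S: "src (w ! i) \<in> S" "tgt w i \<in> S"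
    using src i(1) by (simp_all add: tgt_eq)
  let ?M = "mor_mat (R (src (w ! i))) (R (tgt w i)) (mor (w ! i))"
  have y: "y = (blk (src (w ! i)) (tgt w i) ?M, deg (w ! i))"
    by (simp add: i mat_of_def arrow_data_def)
  have "even (deg (w ! i) + par p + par q)" if "ent (fst y) p q \<noteq> 0" for p q
  proof -
    from that have *: "fst p = src (w ! i)" "fst q = tgt w i" "snd p < rk (src (w ! i))" "snd q < rk (tgt w i)"
      "?M $$ (snd p, snd q) \<noteq> 0"
      by (auto simp: y ent_blk split: if_splits)
    then have "wt (?M $$ (snd p, snd q)) (deg (w ! i) - sh (fst p) (snd p) + sh (fst q) (snd q))"
      unfolding mor_mat_ext using wi by (simp add: hom_mat_weight[OF ext_hom])
    from odd_weight_0[OF this *(5)] show ?thesis by (simp add: par_def)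
  qed
  moreover have "p \<in> index_set S \<inter> E \<and> q \<in> index_set S \<inter> E" if "ent (fst y) p q \<noteq> 0" for p q
    using that S wi by (auto simp: y ent_blk index_set_def E_def split: if_splits)
  ultimately show ?thesis unfolding good_def homog_def by (simp add: y)
qed

lemma set_mor_delta:
  assumes w: "w \<in> words wt sc W" and i: "i < length w" and S: "finite S" "S \<subseteq> Br"
  shows "mat_of (src (w ! i), tgt w i, deg (w ! i) + 1, brane_delta sc (src (w ! i)) (tgt w i) (deg (w ! i)) (mor (w ! i))) =
    (matrix_factorization.delta D0 (fst (mats w ! i)) (snd (mats w ! i)), snd (mats w ! i) + 1)"
proof -
  interpret matrix_factorization par E D0 W "index_set S" "Suc CARD('n)"
    by (rule matrix_factorization) fact+
  note wi = words_nth[OF w i]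
  let ?M = "mor_mat (R (src (w ! i))) (R (tgt w i)) (mor (w ! i))"
  have "blk B C ((- sign n) \<cdot>\<^sub>m K) = - (sign n * blk B C K)" for B C :: "'m brane" and n and K :: "'a mat"
    by (rule rfm_eqI) (auto simp: ent_blk)
  then show ?thesis
    using wi by (simp add: mats_nth i arrow_data_def mat_of_def mor_mat_delta blk_add D0_blk blk_D0 delta_def)
qed

end

section \<open>The value of the chain map on words\<close>

definition lin :: "('k \<Rightarrow> 'a::complex_comm_algebra forms) \<Rightarrow> ('k \<Rightarrow>\<^sub>0 complex) \<Rightarrow> 'a forms" where
  "lin g x = (\<Sum>k\<in>Poly_Mapping.keys x. form_scale (Poly_Mapping.lookup x k) (g k))"

lemma lin_superset:
  "finite K \<Longrightarrow> Poly_Mapping.keys x \<subseteq> K \<Longrightarrow> lin g x = (\<Sum>k\<in>K. form_scale (Poly_Mapping.lookup x k) (g k))"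
  unfolding lin_def by (rule sum.mono_neutral_left) (auto simp: in_keys_iff)

lemma lin_0 [simp]: "lin g 0 = 0"
  by (simp add: lin_def)

lemma lin_add: "lin g (x + y) = lin g x + lin g y"
proof -
  let ?K = "Poly_Mapping.keys x \<union> Poly_Mapping.keys y"
  have K: "finite ?K" "Poly_Mapping.keys (x + y) \<subseteq> ?K" by (auto simp: Poly_Mapping.keys_add)
  show ?thesis
    unfolding lin_superset[OF K] lin_superset[OF K(1) Un_upper1] lin_superset[OF K(1) Un_upper2]
    by (simp add: lookup_add form_scale_add_left sum.distrib)
qed

lemma lin_sum: "lin g (sum f S) = (\<Sum>s\<in>S. lin g (f s))"
  by (induction S rule: infinite_finite_induct) (auto simp: lin_add)

lemma lin_single: "lin g (Poly_Mapping.single k c) = form_scale c (g k)"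
  by (subst lin_superset[of "{k}"]) auto

lemma lin_map_times: "lin g (Poly_Mapping.map ((*) c) x) = form_scale c (lin g x)"
proof -
  have "Poly_Mapping.keys (Poly_Mapping.map ((*) c) x) \<subseteq> Poly_Mapping.keys x"
    by (auto simp: in_keys_iff Poly_Mapping.map.rep_eq when_def split: if_splits)
  then have "lin g (Poly_Mapping.map ((*) c) x) =
      (\<Sum>k\<in>Poly_Mapping.keys x. form_scale (Poly_Mapping.lookup (Poly_Mapping.map ((*) c) x) k) (g k))"
    by (intro lin_superset) auto
  also have "\<dots> = form_scale c (lin g x)"
    unfolding lin_def form_scale_sum
    by (rule sum.cong) (auto simp: form_scale_scale Poly_Mapping.map.rep_eq when_def in_keys_iff)
  finally show ?thesis .
qed

lemma phi_lin: "phi x = lin (\<lambda>fs. form_scale (1 / fact (length fs - 1)) (of_fn (hd fs) * prod_list (map dform (tl fs)))) x"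
  by (simp add: phi_def lin_def form_scale_scale)

lemma form_degree_ge_vanish:
  assumes "\<And>x. x \<in> form_degree N \<Longrightarrow> x = (0 :: 'a::complex_comm_algebra forms)"
    and "x \<in> form_degree n" "n \<ge> N"
  shows "(x :: 'a forms) = 0"
  using assms(2)
proof induction
  case (monomial fs f)
  have "of_fn f * prod_list (map dform fs) =
      (of_fn f * prod_list (map dform (take N fs))) * prod_list (map dform (drop N fs))"
    by (simp add: mult.assoc flip: prod_list.append map_append)
  moreover have "of_fn f * prod_list (map dform (take N fs)) = 0"
    by (rule assms(1), rule form_degree.monomial) (use assms(3) monomial in simp)
  ultimately show ?case by simp
qed simp_all

lemma finite_compositions: "finite {t :: nat list. length t = n \<and> sum_list t = m}"
proof (rule finite_subset)
  show "{t :: nat list. length t = n \<and> sum_list t = m} \<subseteq> {t. set t \<subseteq> {..m} \<and> length t = n}"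
    by (auto simp: member_le_sum_list)
qed (simp add: finite_lists_length_eq)

lemma finite_compositions_le: "finite {t :: nat list. length t = n \<and> sum_list t \<le> m}"
proof (rule finite_subset)
  show "{t :: nat list. length t = n \<and> sum_list t \<le> m} \<subseteq> {t. set t \<subseteq> {..m} \<and> length t = n}"
    using member_le_sum_list order_trans by fastforce
qed (simp add: finite_lists_length_eq)

section \<open>Expansion into sums over exponents\<close>

context matrix_factorization
begin

text \<open>Choosing the power \<open>eta ^ j\<close> from the \<open>G\<close> after each factor,
  the coefficient of a product collects all choices with total exponent \<open>m\<close>.\<close>

lemma fps_nth_prod_list:
  "fps_nth (prod_list (map (\<lambda>c. fps_const c * G) cs)) m =
    (\<Sum>t\<in>{t. length t = length cs \<and> sum_list t = m}. prod_list (map2 (\<lambda>c j. c * eta ^ j) cs t))"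
proof (induction cs arbitrary: m)
  case Nil
  have "{t :: nat list. length t = 0 \<and> sum_list t = m} = (if m = 0 then {[]} else {})" by auto
  then show ?case by (simp add: fps_one_nth)
next
  case (Cons c cs)
  let ?n = "length cs"
  let ?f = "\<lambda>cs t. prod_list (map2 (\<lambda>c j. c * eta ^ j) cs t)"
  have cG: "fps_nth (fps_const c * G) i = c * eta ^ i" for i by (simp add: G_nth)
  have "fps_nth (prod_list (map (\<lambda>c. fps_const c * G) (c # cs))) m =
      (\<Sum>i=0..m. \<Sum>t\<in>{t. length t = ?n \<and> sum_list t = m - i}. c * eta ^ i * ?f cs t)"
    unfolding list.map prod_list.Cons fps_mult_nth[of "fps_const c * G"] cG Cons.IH sum_distrib_left ..
  also have "\<dots> = (\<Sum>(i, t)\<in>(SIGMA i:{0..m}. {t. length t = ?n \<and> sum_list t = m - i}). c * eta ^ i * ?f cs t)"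
    by (rule sum.Sigma) (auto simp: finite_compositions)
  also have "\<dots> = (\<Sum>t\<in>{t. length t = Suc ?n \<and> sum_list t = m}. ?f (c # cs) t)"
    by (rule sum.reindex_bij_witness[of _ "\<lambda>t. (hd t, tl t)" "\<lambda>(i, t). i # t"])
      (auto simp: length_Suc_conv)
  finally show ?case by simp
qed

definition summand :: "(('i, 'a) rfm \<times> int) list \<Rightarrow> nat list \<Rightarrow> ('i, 'a forms) rfm" where
  "summand xs t = prod_list (map2 (\<lambda>c j. c * eta ^ j) (fn_mat (fst (hd xs)) # map (\<lambda>y. A (fst y)) (tl xs)) t)"

lemma val_sum:
  assumes "xs \<noteq> []"
  shows "val xs = (\<Sum>t\<in>{t. length t = length xs \<and> length xs - 1 + sum_list t \<le> N}.
    form_scale (1 / fact (length xs - 1 + sum_list t)) (T (length xs - 1 + sum_list t) (summand xs t)))"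
proof -
  let ?k = "length xs - 1" and ?L = "length xs"
  let ?g = "\<lambda>n t. form_scale (1 / fact n) (T n (summand xs t))"
  have "H xs = prod_list (map (\<lambda>c. fps_const c * G) (fn_mat (fst (hd xs)) # map (\<lambda>y. A (fst y)) (tl xs)))"
    by (simp add: H_def TL_def o_def)
  moreover have "length (fn_mat (fst (hd xs)) # map (\<lambda>y. A (fst y)) (tl xs)) = ?L"
    using assms by simp
  ultimately have nth: "fps_nth (H xs) m = (\<Sum>t\<in>{t. length t = ?L \<and> sum_list t = m}. summand xs t)" for m
    by (simp only: fps_nth_prod_list summand_def)
  have "val xs = (\<Sum>n\<in>{?k..N}. \<Sum>t\<in>{t. length t = ?L \<and> sum_list t = n - ?k}. ?g n t)"
    unfolding val_def Psi_def nth T_sum form_scale_sum ..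
  also have "\<dots> = (\<Sum>(n, t)\<in>(SIGMA n:{?k..N}. {t. length t = ?L \<and> sum_list t = n - ?k}). ?g n t)"
    by (rule sum.Sigma) (auto simp: finite_compositions)
  also have "\<dots> = (\<Sum>t\<in>{t. length t = ?L \<and> ?k + sum_list t \<le> N}. ?g (?k + sum_list t) t)"
    by (rule sum.reindex_bij_witness[of _ "\<lambda>t. (?k + sum_list t, t)" snd]) auto
  finally show ?thesis .
qed

end

text \<open>A letter \<open>(B, C, n, M)\<close> is a matrix \<open>M\<close> of degree \<open>n\<close> from \<open>B\<close> to \<open>C\<close>.\<close>

type_synonym ('m, 'a) item = "'m brane \<times> 'm brane \<times> int \<times> 'a mat"

section \<open>Matrix products as sums over index paths\<close>

fun chain :: "'m brane \<Rightarrow> ('m, 'a) item list \<Rightarrow> 'm brane \<Rightarrow> bool" where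
  "chain B [] C \<longleftrightarrow> B = C"
| "chain B ((B', C', n, M) # us) C \<longleftrightarrow> B' = B \<and> chain C' us C"

lemma chain_append: "chain B (us @ vs) C \<longleftrightarrow> (\<exists>K. chain B us K \<and> chain K vs C)"
  by (induction us arbitrary: B) auto

lemma chain_replicate: "chain B (replicate n (B, B, d, M)) B"
  by (induction n) auto

definition mat_item :: "('m, 'a) item \<Rightarrow> 'a mat" where "mat_item u = snd (snd (snd u))"

definition paths :: "('m, 'a) item list \<Rightarrow> nat list set" where
  "paths us = {is. length is = length us \<and> (\<forall>j<length us. is ! j < dim_row (mat_item (us ! j)))}"

text \<open>The argument \<open>e\<close> is the column index of the last matrix; a closed path is
  obtained by taking for \<open>e\<close> its own first index.\<close>

fun entries :: "('m, 'a) item list \<Rightarrow> nat list \<Rightarrow> nat \<Rightarrow> 'a list" where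
  "entries (u # us) (i # is) e = mat_item u $$ (i, hd (is @ [e])) # entries us is e"
| "entries _ _ e = []"

lemma paths_Nil [simp]: "paths [] = {[]}"
  by (auto simp: paths_def)

lemma paths_Cons: "paths (u # us) = (\<lambda>(i, is). i # is) ` ({..<dim_row (mat_item u)} \<times> paths us)"
proof
  show "paths (u # us) \<subseteq> (\<lambda>(i, is). i # is) ` ({..<dim_row (mat_item u)} \<times> paths us)"
  proof
    fix js assume js: "js \<in> paths (u # us)"
    then obtain i "is" where eq: "js = i # is" by (auto simp: paths_def length_Suc_conv)
    have "i < dim_row (mat_item u)" using js eq by (auto simp: paths_def)
    moreover have "is ! j < dim_row (mat_item (us ! j))" if "j < length us" for j
      using js that unfolding eq paths_def by (auto dest!: spec[of _ "Suc j"])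
    ultimately show "js \<in> (\<lambda>(i, is). i # is) ` ({..<dim_row (mat_item u)} \<times> paths us)"
      using js eq by (auto simp: paths_def)
  qed
qed (auto simp: paths_def nth_Cons split: nat.splits)

lemma sum_paths_Cons:
  "(\<Sum>is\<in>paths (u # us). f is) = (\<Sum>i<dim_row (mat_item u). \<Sum>is\<in>paths us. f (i # is))"
  unfolding paths_Cons by (subst sum.reindex) (auto simp: inj_on_def sum.cartesian_product o_def split_def)

lemma sum_paths_hd:
  fixes f :: "nat list \<Rightarrow> 'b::comm_monoid_add"
  shows "(\<Sum>js\<in>paths (u # us). if hd (js @ [e]) = i then f js else 0) =
    (\<Sum>is\<in>paths us. if i < dim_row (mat_item u) then f (i # is) else 0)"
proof -
  have "(\<Sum>is\<in>paths us. if l = i then f (l # is) else 0) = (if l = i then \<Sum>is\<in>paths us. f (i # is) else 0)" for l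
    by simp
  then show ?thesis by (simp add: sum_paths_Cons)
qed

lemma length_entries: "length is = length us \<Longrightarrow> length (entries us is e) = length us"
  by (induction us "is" e rule: entries.induct) auto

lemma entries_nth:
  "length is = length us \<Longrightarrow> j < length us \<Longrightarrow> entries us is e ! j = mat_item (us ! j) $$ (is ! j, (is @ [e]) ! Suc j)"
proof (induction us "is" e arbitrary: j rule: entries.induct)
  case (1 u us i "is" e)
  then show ?case by (cases j) (auto simp: hd_conv_nth hd_append nth_append)
qed auto

lemma hd_path_bound:
  assumes "chain C us B" "is \<in> paths us" "e < rank (R B)"
    "\<And>u. u \<in> set us \<Longrightarrow> dim_row (mat_item u) = rank (R (fst u))"
  shows "hd (is @ [e]) < rank (R C)"
proof (cases us)
  case Nil
  then show ?thesis using assms by simp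
next
  case (Cons u us')
  then obtain i js where "is = i # js" "i < dim_row (mat_item u)"
    using assms(2) by (auto simp: paths_Cons)
  then show ?thesis using assms(1,4) Cons by (cases u) auto
qed

context brane_category
begin

text \<open>The first components of \<open>zs\<close> need to agree with the matrices of the items only in the rows
  that belong to their sources, because the other rows do not contribute to the product.\<close>

lemma ent_prod_paths:
  assumes "chain B (map snd zs) C" "e < rk C"
    and "\<And>X u p q. (X, u) \<in> set zs \<Longrightarrow> fst p = fst u \<Longrightarrow> ent X p q =
      (if fst q = fst (snd u) \<and> snd p < dim_row (mat_item u) \<and> snd q < dim_col (mat_item u)
       then sign (sh (fst p) (snd p)) * dform (mat_item u $$ (snd p, snd q)) else 0)"
    and "\<And>X u. (X, u) \<in> set zs \<Longrightarrow> dim_row (mat_item u) = rk (fst u) \<and> dim_col (mat_item u) = rk (fst (snd u))"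
  shows "ent (prod_list (map fst zs)) (B, i) (C, e) =
    (\<Sum>is\<in>paths (map snd zs). if hd (is @ [e]) = i then
       sign (\<Sum>j<length zs. sh (fst (snd (zs ! j))) (is ! j)) * prod_list (map dform (entries (map snd zs) is e)) else 0)"
  using assms
proof (induction zs arbitrary: B i)
  case Nil
  then show ?case by (auto simp: ent_one)
next
  case (Cons z zs)
  obtain X B' K n M where z: "z = (X, B', K, n, M)" by (cases z) auto
  have B': "B' = B" and ch: "chain K (map snd zs) C" using Cons.prems(1) z by auto
  have X: "ent X (B, i) q = (if fst q = K \<and> i < rk B \<and> snd q < rk K
       then sign (sh B i) * dform (M $$ (i, snd q)) else 0)" for q
    using Cons.prems(3)[of X "(B', K, n, M)" "(B, i)" q] Cons.prems(4)[of X "(B', K, n, M)"]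
    by (auto simp: z B' mat_item_def)
  have dM: "dim_row M = rk B" using Cons.prems(4)[of X "(B', K, n, M)"] by (auto simp: z B' mat_item_def)
  let ?P = "prod_list (map fst zs)" and ?us = "map snd zs"
  let ?w = "\<lambda>is. sign (\<Sum>j<length zs. sh (fst (snd (zs ! j))) (is ! j)) * prod_list (map dform (entries ?us is e))"
  have IH: "ent ?P (K, l) (C, e) = (\<Sum>is\<in>paths ?us. if hd (is @ [e]) = l then ?w is else 0)" for l
  proof (rule Cons.IH[OF ch Cons.prems(2)])
    fix X u and p q :: "'m brane \<times> nat" assume "(X, u) \<in> set zs" "fst p = fst u"
    then show "ent X p q = (if fst q = fst (snd u) \<and> snd p < dim_row (mat_item u) \<and> snd q < dim_col (mat_item u)
       then sign (sh (fst p) (snd p)) * dform (mat_item u $$ (snd p, snd q)) else 0)"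
      by (intro Cons.prems(3)) simp_all
  next
    fix X u assume "(X, u) \<in> set zs"
    then show "dim_row (mat_item u) = rk (fst u) \<and> dim_col (mat_item u) = rk (fst (snd u))"
      by (intro Cons.prems(4)[of X]) simp
  qed
  have hd: "hd (is @ [e]) < rk K" if "is \<in> paths ?us" for "is"
  proof (rule hd_path_bound[where R = R, OF ch that Cons.prems(2)])
    fix u assume "u \<in> set ?us"
    then obtain X where "(X, u) \<in> set zs" by auto
    then show "dim_row (mat_item u) = rk (fst u)" using Cons.prems(4)[of X u] by simp
  qed
  have "ent (X * ?P) (B, i) (C, e) = (\<Sum>r\<in>Pair K ` {..<rk K}. ent X (B, i) r * ent ?P r (C, e))"
  proof (rule ent_times)
    fix r assume "ent X (B, i) r \<noteq> 0"
    then have "fst r = K" "snd r < rk K" by (auto simp: X split: if_splits)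
    then show "r \<in> Pair K ` {..<rk K}" by (intro image_eqI[of _ _ "snd r"]) (auto simp: prod_eq_iff)
  qed simp
  also have "\<dots> = (\<Sum>l<rk K. ent X (B, i) (K, l) * ent ?P (K, l) (C, e))"
    by (subst sum.reindex) (auto simp: inj_on_def o_def)
  also have "\<dots> = (\<Sum>l<rk K. \<Sum>is\<in>paths ?us. if hd (is @ [e]) = l then ent X (B, i) (K, l) * ?w is else 0)"
    by (simp add: IH sum_distrib_left if_distrib cong: if_cong)
  also have "\<dots> = (\<Sum>is\<in>paths ?us. \<Sum>l<rk K. if hd (is @ [e]) = l then ent X (B, i) (K, l) * ?w is else 0)"
    by (rule sum.swap)
  also have "\<dots> = (\<Sum>is\<in>paths ?us. ent X (B, i) (K, hd (is @ [e])) * ?w is)"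
    by (rule sum.cong[OF HOL.refl]) (use hd in \<open>simp add: sum.delta\<close>)
  also have "\<dots> = (\<Sum>is\<in>paths ?us. if i < rk B then
       sign (\<Sum>j<length (z # zs). sh (fst (snd ((z # zs) ! j))) ((i # is) ! j)) *
       prod_list (map dform (entries (map snd (z # zs)) (i # is) e)) else 0)"
  proof (rule sum.cong[OF HOL.refl])
    fix "is" assume "is \<in> paths ?us"
    from hd[OF this] show "ent X (B, i) (K, hd (is @ [e])) * ?w is = (if i < rk B then
       sign (\<Sum>j<length (z # zs). sh (fst (snd ((z # zs) ! j))) ((i # is) ! j)) *
       prod_list (map dform (entries (map snd (z # zs)) (i # is) e)) else 0)"
      by (auto simp: X z B' mat_item_def sum.lessThan_Suc_shift sign_def simp del: sum.lessThan_Suc)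
  qed
  also have "\<dots> = (\<Sum>is\<in>paths (map snd (z # zs)). if hd (is @ [e]) = i then
       sign (\<Sum>j<length (z # zs). sh (fst (snd ((z # zs) ! j))) (is ! j)) *
       prod_list (map dform (entries (map snd (z # zs)) is e)) else 0)"
  proof -
    have "dim_row (mat_item (snd z)) = rk B" by (simp add: z mat_item_def dM)
    then show ?thesis
      unfolding list.map sum_paths_hd by simp
  qed
  finally show ?case by (simp add: z)
qed

end

lemma prod_list_0_member: "0 \<in> set xs \<Longrightarrow> prod_list xs = (0 :: 'b::ring_1)"
  by (induction xs) auto

lemma chain_nth:
  assumes "chain B us C" "j < length us"
  shows "fst (snd (us ! j)) = (if Suc j < length us then fst (us ! Suc j) else C)"
  using assms
proof (induction us arbitrary: B j)
  case (Cons u us)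
  obtain B' C' n M where u: "u = (B', C', n, M)" by (cases u) auto
  show ?case
  proof (cases j)
    case 0
    then show ?thesis using Cons.prems by (cases us) (auto simp: u)
  next
    case (Suc i)
    then show ?thesis using Cons.IH[of C' i] Cons.prems by (auto simp: u)
  qed
qed simp

lemma sum_rotate: "(\<Sum>j<Suc n. f (Suc j mod Suc n)) = (\<Sum>j<Suc n. f j :: 'b::comm_monoid_add)"
  unfolding sum.lessThan_Suc_shift[of f] by (simp add: add.commute)

definition forget :: "('m brane \<Rightarrow> ('a, 'm) realization) \<Rightarrow> ('m, 'a) item \<Rightarrow> 'a letter" where
  "forget R = (\<lambda>(B, C, n, M). (shift (R B), n, M))"

lemma forget_simps: "fst (forget R u) = shift (R (fst u))" "fst (snd (forget R u)) = fst (snd (snd u))"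
    "snd (snd (forget R u)) = mat_item u"
  by (auto simp: forget_def mat_item_def split: prod.splits)

definition deg_item :: "('m, 'a) item \<Rightarrow> int" where "deg_item u = fst (snd (snd u))"

definition trace_sign :: "('m brane \<Rightarrow> ('a, 'm) realization) \<Rightarrow> ('m, 'a) item list \<Rightarrow> nat list \<Rightarrow> int" where
  "trace_sign R us is = ((\<Sum>j<length us. deg_item (us ! j)) + int (length us)) * shift (R (fst (us ! 0))) (is ! 0) +
     (\<Sum>j=1..<length us. shift (R (fst (us ! j))) (is ! j))"

lemma generalized_trace_forget:
  "us \<noteq> [] \<Longrightarrow> generalized_trace (map (forget R) us) =
    (\<Sum>is\<in>paths us. Poly_Mapping.single (entries us is (hd is)) (sign (trace_sign R us is)))"
proof -
  assume ne: "us \<noteq> []"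
  have "generalized_trace (map (forget R) us) =
    (\<Sum>is\<in>{is. length is = length us \<and> (\<forall>j<length us. is ! j < dim_row (mat_item (us ! j)))}.
       Poly_Mapping.single (map (\<lambda>j. mat_item (us ! j) $$ (is ! j, is ! (Suc j mod length us))) [0..<length us])
         (sign (trace_sign R us is)))"
    unfolding generalized_trace_def Let_def length_map
  proof (rule sum.cong)
    fix "is" :: "nat list"
    have "map (\<lambda>j. snd (snd (map (forget R) us ! j)) $$ (is ! j, is ! (Suc j mod length us))) [0..<length us] =
        map (\<lambda>j. mat_item (us ! j) $$ (is ! j, is ! (Suc j mod length us))) [0..<length us]"
      by (intro map_cong HOL.refl) (simp add: forget_simps)
    moreover have "(\<Sum>j<length us. fst (snd (map (forget R) us ! j))) = (\<Sum>j<length us. deg_item (us ! j))"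
      by (intro sum.cong HOL.refl) (simp add: forget_simps deg_item_def)
    moreover have "(\<Sum>j=1..<length us. fst (map (forget R) us ! j) (is ! j)) =
        (\<Sum>j=1..<length us. shift (R (fst (us ! j))) (is ! j))"
      by (intro sum.cong HOL.refl) (simp add: forget_simps)
    moreover have "fst (map (forget R) us ! 0) = shift (R (fst (us ! 0)))"
      using ne by (simp add: forget_simps)
    ultimately show "Poly_Mapping.single
         (map (\<lambda>j. snd (snd (map (forget R) us ! j)) $$ (is ! j, is ! (Suc j mod length us))) [0..<length us])
         (sign (((\<Sum>j<length us. fst (snd (map (forget R) us ! j))) + int (length us)) *
            fst (map (forget R) us ! 0) (is ! 0) + (\<Sum>j=1..<length us. fst (map (forget R) us ! j) (is ! j)))) =
       Poly_Mapping.single (map (\<lambda>j. mat_item (us ! j) $$ (is ! j, is ! (Suc j mod length us))) [0..<length us])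
         (sign (trace_sign R us is))"
      by (simp only: trace_sign_def)
  qed (auto simp: forget_simps)
  also have "\<dots> = (\<Sum>is\<in>paths us. Poly_Mapping.single (entries us is (hd is)) (sign (trace_sign R us is)))"
  proof (rule sum.cong)
    fix "is" assume "is \<in> paths us"
    then have len: "length is = length us" by (simp add: paths_def)
    have "entries us is (hd is) = map (\<lambda>j. mat_item (us ! j) $$ (is ! j, is ! (Suc j mod length us))) [0..<length us]"
    proof (rule nth_equalityI)
      fix j assume "j < length (entries us is (hd is))"
      then have j: "j < length us" by (simp add: length_entries[OF len])
      have "(is @ [hd is]) ! Suc j = is ! (Suc j mod length us)"
      proof (cases "Suc j < length us")
        case False
        then have "Suc j = length us" using j by simp
        moreover have "is \<noteq> []" using len ne by auto
        ultimately show ?thesis using len by (simp add: nth_append hd_conv_nth)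
      qed (simp add: nth_append len)
      then show "entries us is (hd is) ! j = map (\<lambda>j. mat_item (us ! j) $$ (is ! j, is ! (Suc j mod length us))) [0..<length us] ! j"
        using j by (simp add: entries_nth[OF len])
    qed (simp add: length_entries[OF len])
    then show "Poly_Mapping.single (map (\<lambda>j. mat_item (us ! j) $$ (is ! j, is ! (Suc j mod length us))) [0..<length us])
         (sign (trace_sign R us is)) =
       Poly_Mapping.single (entries us is (hd is)) (sign (trace_sign R us is))" by simp
  qed (simp add: paths_def)
  finally show ?thesis .
qed

lemma phi_trace_forget:
  assumes "us \<noteq> []"
  shows "phi (generalized_trace (map (forget R) us)) = (\<Sum>is\<in>paths us.
    form_scale (1 / fact (length us - 1)) (sign (trace_sign R us is) *
      (of_fn (hd (entries us is (hd is))) * prod_list (map dform (tl (entries us is (hd is)))))))"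
  unfolding phi_lin generalized_trace_forget[OF assms] lin_sum lin_single
proof (rule sum.cong[OF HOL.refl])
  fix "is" assume "is \<in> paths us"
  then have "length (entries us is (hd is)) = length us"
    by (intro length_entries) (simp add: paths_def)
  then show "form_scale (sign (trace_sign R us is)) (form_scale (1 / fact (length (entries us is (hd is)) - 1))
        (of_fn (hd (entries us is (hd is))) * prod_list (map dform (tl (entries us is (hd is)))))) =
      form_scale (1 / fact (length us - 1)) (sign (trace_sign R us is) *
        (of_fn (hd (entries us is (hd is))) * prod_list (map dform (tl (entries us is (hd is))))))"
    by (simp add: form_scale_sign form_scale_sign_mult)
qed

lemma closed_states_sum: "(\<And>i. i \<in> S \<Longrightarrow> f i \<in> closed_states wt n) \<Longrightarrow> sum f S \<in> closed_states wt n"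
  by (induction S rule: infinite_finite_induct) (auto intro: closed_states.zero closed_states.add)

section \<open>Weights and signs along closed paths\<close>

context brane_category
begin

definition item_ok :: "('m, 'a) item \<Rightarrow> bool" where
  "item_ok u \<longleftrightarrow> dim_row (mat_item u) = rk (fst u) \<and> dim_col (mat_item u) = rk (fst (snd u)) \<and>
    (\<forall>i<rk (fst u). \<forall>j<rk (fst (snd u)).
       wt (mat_item u $$ (i, j)) (deg_item u - sh (fst u) i + sh (fst (snd u)) j))"

lemma path_weights:
  assumes ne: "us \<noteq> []" and ch: "chain B us B" and ok: "\<And>u. u \<in> set us \<Longrightarrow> item_ok u"
    and "is": "is \<in> paths us" and j: "j < length us"
  defines "a \<equiv> \<lambda>j. sh (fst (us ! j)) (is ! j)"
  shows "wt (entries us is (hd is) ! j) (deg_item (us ! j) - a j + a (Suc j mod length us))"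
proof -
  have len: "length is = length us" using "is" by (simp add: paths_def)
  have first: "fst (us ! 0) = B" using ch ne by (cases us) auto
  have step: "(is @ [hd is]) ! Suc j = is ! (Suc j mod length us) \<and> fst (snd (us ! j)) = fst (us ! (Suc j mod length us))"
  proof (cases "Suc j < length us")
    case True
    then show ?thesis using chain_nth[OF ch j] by (simp add: nth_append len)
  next
    case False
    then have "Suc j = length us" using j by simp
    moreover have "is \<noteq> []" using len ne by auto
    ultimately show ?thesis using len chain_nth[OF ch j] first by (simp add: nth_append hd_conv_nth)
  qed
  have lt: "Suc j mod length us < length us" using ne by simp
  have d: "is ! l < rk (fst (us ! l))" if "l < length us" for l
    using "is" ok[of "us ! l"] that by (auto simp: paths_def item_ok_def)
  have "item_ok (us ! j)" using ok j by simp
  then show ?thesis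
    using d[OF j] d[OF lt] step unfolding entries_nth[OF len j] a_def by (simp add: item_ok_def)
qed

text \<open>The shifts telescope around a closed path.\<close>

lemma path_sum_weights:
  assumes "us \<noteq> []"
  shows "(\<Sum>j<length us. d j - a j + a (Suc j mod length us)) = (\<Sum>j<length us. d j :: int)"
proof -
  obtain n where n: "length us = Suc n" using assms by (cases us) auto
  show ?thesis using sum_rotate[of a n] unfolding n by (simp only: sum.distrib sum_subtractf)
qed

text \<open>A nonzero entry has even weight, namely the degree of its letter corrected by the shifts
  at both ends. Around a closed path the corrections cancel, so the degrees of the letters have an
  even sum and drop out of the exponent at the starting index.\<close>

lemma trace_sign_path:
  assumes ne: "us \<noteq> []" and ch: "chain B us B" and ok: "\<And>u. u \<in> set us \<Longrightarrow> item_ok u"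
    and "is": "is \<in> paths us" and nz: "\<And>j. j < length us \<Longrightarrow> entries us is (hd is) ! j \<noteq> 0"
  shows "sign (trace_sign R us is) =
    (sign (int (length us) * sh B (hd is) + (\<Sum>j=1..<length us. sh (fst (us ! j)) (is ! j))) :: 'a forms)"
proof (rule sign_eq)
  define a where "a j = sh (fst (us ! j)) (is ! j)" for j
  have "even (deg_item (us ! j) - a j + a (Suc j mod length us))" if "j < length us" for j
    using wt_odd[OF path_weights[OF ne ch ok "is" that]] nz[OF that] unfolding a_def by blast
  then have "even (\<Sum>j<length us. deg_item (us ! j) - a j + a (Suc j mod length us))"
    by (intro dvd_sum) auto
  then have "even (\<Sum>j<length us. deg_item (us ! j))"
    using path_sum_weights[OF ne, of "\<lambda>j. deg_item (us ! j)" a] by simp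
  moreover have "fst (us ! 0) = B" using ch ne by (cases us) auto
  moreover have "hd is = is ! 0" using ne "is" by (intro hd_conv_nth) (auto simp: paths_def)
  ultimately show "even (trace_sign R us is +
      (int (length us) * sh B (hd is) + (\<Sum>j=1..<length us. sh (fst (us ! j)) (is ! j))))"
    by (simp add: trace_sign_def ring_distribs)
qed

text \<open>Around a closed path the weights of the entries add up to the sum of the degrees of the
  letters. Every letter but the first becomes a one-form and so lowers the total degree by
  one.\<close>

lemma phi_trace_closed_states:
  assumes ne: "us \<noteq> []" and ch: "chain B us B" and ok: "\<And>u. u \<in> set us \<Longrightarrow> item_ok u"
  shows "phi (generalized_trace (map (forget R) us)) \<in>
    closed_states wt ((\<Sum>j<length us. deg_item (us ! j)) - int (length us - 1))"
  unfolding phi_trace_forget[OF ne]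
proof -
  let ?N = "(\<Sum>j<length us. deg_item (us ! j)) - int (length us - 1)"
  have "form_scale c (sign m * (of_fn (hd (entries us is (hd is))) * prod_list (map dform (tl (entries us is (hd is))))))
      \<in> closed_states wt ?N" if "is \<in> paths us" for c m "is"
  proof -
    let ?fs = "entries us is (hd is)"
    have len: "length ?fs = length us" using that by (intro length_entries) (simp add: paths_def)
    define ws where "ws = map (\<lambda>j. deg_item (us ! j) - sh (fst (us ! j)) (is ! j) +
      sh (fst (us ! (Suc j mod length us))) (is ! (Suc j mod length us))) [0..<length us]"
    have all: "list_all2 wt ?fs ws"
      using path_weights[OF ne ch ok that] by (simp add: list_all2_conv_all_nth len ws_def)
    have "sum_list ws = (\<Sum>j<length us. deg_item (us ! j))"
      using path_sum_weights[OF ne, of "\<lambda>j. deg_item (us ! j)" "\<lambda>j. sh (fst (us ! j)) (is ! j)"]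
      by (simp add: ws_def interv_sum_list_conv_sum_set_nat atLeast0LessThan)
    moreover obtain f fs where fs: "?fs = f # fs" using len ne by (cases ?fs) auto
    moreover obtain v vs where ws: "ws = v # vs" using all fs by (cases ws) auto
    ultimately have N: "v + sum_list vs - int (length fs) = ?N" using len by simp
    have wts: "wt f v" "list_all2 wt fs vs" using all fs ws by auto
    have "of_fn (of_complex (c * sign m) * f) * prod_list (map dform fs) \<in> closed_states wt ?N"
      by (rule closed_states.monomial[OF _ wts(2) N], rule wt_scale[OF wts(1)])
    moreover have "form_scale c (sign m * (of_fn f * Z)) = of_fn (of_complex (c * sign m) * f) * Z" for Z
      by (simp add: form_scale_sign[symmetric] form_scale_scale) (simp add: form_scale_def of_fn_mult mult.assoc)
    ultimately show ?thesis unfolding fs by simp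
  qed
  then show "(\<Sum>is\<in>paths us. form_scale (1 / fact (length us - 1)) (sign (trace_sign R us is) *
      (of_fn (hd (entries us is (hd is))) * prod_list (map dform (tl (entries us is (hd is))))))) \<in> closed_states wt ?N"
    by (intro closed_states_sum)
qed

end

definition items :: "('m brane \<Rightarrow> ('a::comm_ring_1, 'm) realization) \<Rightarrow> 'm arrow list \<Rightarrow> nat list \<Rightarrow> ('m, 'a) item list" where
  "items R w t = concat (map (\<lambda>i. (src (w ! i), tgt w i, deg (w ! i), arrow_mat R w i) #
     replicate (t ! i) (tgt w i, tgt w i, 1, dif_mat (R (tgt w i)))) [0..<length w])"

lemma Td_word_items: "length s = length w \<Longrightarrow> Td_word R w s = map (forget R) (items R w (rotate1 s))"
  unfolding Td_word_def items_def map_concat map_map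
  by (intro arg_cong[of _ _ concat] map_cong HOL.refl) (simp add: Let_def forget_def nth_rotate1 o_def)

lemma chain_items:
  assumes "w \<noteq> []"
  shows "chain (src (w ! 0)) (items R w t) (src (w ! 0))"
proof -
  let ?b = "\<lambda>i. (src (w ! i), tgt w i, deg (w ! i), arrow_mat R w i) #
     replicate (t ! i) (tgt w i, tgt w i, 1, dif_mat (R (tgt w i)))"
  have "chain (src (w ! 0)) (concat (map ?b [0..<m])) (if m = 0 then src (w ! 0) else tgt w (m - 1))"
    if "m \<le> length w" for m
    using that
  proof (induction m)
    case (Suc m)
    have "src (w ! m) = (if m = 0 then src (w ! 0) else tgt w (m - 1))"
      using Suc.prems by (auto simp: tgt_eq)
    then have "chain (if m = 0 then src (w ! 0) else tgt w (m - 1)) (?b m) (tgt w m)"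
      by (simp add: chain_replicate)
    then show ?case using Suc by (auto simp: chain_append simp del: chain.simps)
  qed simp
  from this[of "length w"] show ?thesis
    unfolding items_def using assms by (cases "length w") (auto simp: tgt_eq)
qed

lemma sum_list_rotate1: "sum_list (rotate1 xs) = sum_list (xs :: nat list)"
  by (cases xs) auto

lemma sum_list_concat_map: "sum_list (concat xss) = sum_list (map sum_list xss)"
  by (induction xss) auto

lemma sum_list_items:
  "length t = length w \<Longrightarrow> sum_list (map deg_item (items R w t)) = sum_list (map deg w) + int (sum_list t)"
proof -
  assume len: "length t = length w"
  have "sum_list (map deg_item (items R w t)) = (\<Sum>i\<leftarrow>[0..<length w]. deg (w ! i) + int (t ! i))"
    unfolding items_def
    by (simp add: map_concat sum_list_concat_map o_def deg_item_def sum_list_replicate)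
  also have "\<dots> = (\<Sum>i<length w. deg (w ! i)) + int (\<Sum>i<length t. t ! i)"
    by (simp add: interv_sum_list_conv_sum_set_nat atLeast0LessThan sum.distrib len)
  finally show ?thesis by (simp add: sum_list_sum_nth atLeast0LessThan)
qed

lemma length_items: "length t = length w \<Longrightarrow> length (items R w t) = length w + sum_list t"
proof -
  assume len: "length t = length w"
  have "length (items R w t) = (\<Sum>i\<leftarrow>[0..<length w]. 1 + t ! i)"
    unfolding items_def by (simp add: length_concat o_def)
  then show ?thesis
    by (simp add: interv_sum_list_conv_sum_set_nat atLeast0LessThan sum_Suc len sum_list_sum_nth)
qed

lemma phi_trace_form_degree:
  assumes "us \<noteq> []"
  shows "phi (generalized_trace (map (forget R) us)) \<in> form_degree (length us - 1)"
  unfolding phi_trace_forget[OF assms] form_scale_def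
proof (intro form_degree_sum)
  fix "is" assume "is \<in> paths us"
  then have "length (tl (entries us is (hd is))) = length us - 1"
    by (subst length_tl, subst length_entries) (auto simp: paths_def)
  from form_degree_mult[OF of_fn_form_degree sign_form_degree[OF form_degree.monomial[OF this]]]
  show "of_fn (of_complex (1 / fact (length us - 1))) * (sign (trace_sign R us is) *
     (of_fn (hd (entries us is (hd is))) * prod_list (map dform (tl (entries us is (hd is))))))
     \<in> form_degree (length us - 1)"
    by simp
qed

section \<open>The composite map as a trace\<close>

context brane_category
begin

lemma items_ok:
  assumes "w \<in> words wt sc W" "u \<in> set (items R w t)"
  shows "item_ok u"
proof -
  obtain i where i: "i < length w" "u = (src (w ! i), tgt w i, deg (w ! i), arrow_mat R w i) \<or>
      u = (tgt w i, tgt w i, 1, dif_mat (R (tgt w i)))"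
    using assms(2) by (auto simp: items_def)
  note wi = words_nth[OF assms(1) i(1)]
  from i(2) show ?thesis
  proof
    assume u: "u = (src (w ! i), tgt w i, deg (w ! i), arrow_mat R w i)"
    show ?thesis using hom_mat_weight[OF ext_hom[OF wi]]
      by (simp add: u item_ok_def mat_item_def deg_item_def arrow_mat_def) (simp add: mor_mat_ext)
  next
    assume u: "u = (tgt w i, tgt w i, 1, dif_mat (R (tgt w i)))"
    show ?thesis using hom_mat_weight[OF realization(4)[OF wi(2)]]
      by (simp add: u item_ok_def mat_item_def deg_item_def) (simp add: dif_mat_hom_mat)
  qed
qed

text \<open>Both sides are sums over closed index paths. The factors \<open>eps\<close> inside the
  rows of the matrices give the signs at the inner indices, and \<open>T\<close> gives the sign at
  the starting index.\<close>

lemma T_paths: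
  assumes S: "finite S" "S \<subseteq> Br" "B \<in> S"
    and ch: "chain B ((B, K, d, M) # map snd zs) B"
    and ok: "\<And>u. u \<in> set ((B, K, d, M) # map snd zs) \<Longrightarrow> item_ok u"
    and rows: "\<And>X u p q. (X, u) \<in> set zs \<Longrightarrow> fst p = fst u \<Longrightarrow> ent X p q =
      (if fst q = fst (snd u) \<and> snd p < dim_row (mat_item u) \<and> snd q < dim_col (mat_item u)
       then sign (sh (fst p) (snd p)) * dform (mat_item u $$ (snd p, snd q)) else 0)"
  shows "form_scale (1 / fact (length zs))
      (matrix_factorization.T par (index_set S) (length zs) (fn_mat (blk B K M) * prod_list (map fst zs))) =
    phi (generalized_trace (map (forget R) ((B, K, d, M) # map snd zs)))"
proof -
  interpret matrix_factorization par E D0 W "index_set S" "Suc CARD('n)"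
    by (rule matrix_factorization[OF S(1,2)])
  let ?n = "length zs" and ?us' = "map snd zs" and ?us = "(B, K, d, M) # map snd zs" and ?P = "prod_list (map fst zs)"
  have ne: "?us \<noteq> []" by simp
  have dims: "dim_row M = rk B" "dim_col M = rk K"
    using ok[of "(B, K, d, M)"] by (auto simp: item_ok_def mat_item_def)
  have ch': "chain K ?us' B" using ch by simp
  have okz: "dim_row (mat_item u) = rk (fst u) \<and> dim_col (mat_item u) = rk (fst (snd u))" if "(X, u) \<in> set zs" for X u
  proof -
    have "u \<in> set ?us'" using that by force
    then show ?thesis using ok by (simp add: item_ok_def)
  qed
  let ?g = "\<lambda>js i. sign (\<Sum>j<?n. sh (fst (snd (zs ! j))) (js ! j)) * prod_list (map dform (entries ?us' js i))"
  have P: "ent ?P (K, l) (B, i) = (\<Sum>js\<in>paths ?us'. if hd (js @ [i]) = l then ?g js i else 0)" if "i < rk B" for i l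
    by (rule ent_prod_paths[OF ch' that rows okz])
  have hd: "hd (js @ [i]) < rk K" if "js \<in> paths ?us'" "i < rk B" for js i
  proof (rule hd_path_bound[where R = R, OF ch' that])
    fix u assume "u \<in> set ?us'"
    then show "dim_row (mat_item u) = rk (fst u)" using ok by (simp add: item_ok_def)
  qed
  have diag: "ent (fn_mat (blk B K M) * ?P) (B, i) (B, i) = (\<Sum>js\<in>paths ?us'. of_fn (M $$ (i, hd (js @ [i]))) * ?g js i)"
    if i: "i < rk B" for i
  proof -
    have "ent (fn_mat (blk B K M) * ?P) (B, i) (B, i) = (\<Sum>l<rk K. of_fn (M $$ (i, l)) * ent ?P (K, l) (B, i))"
      using i dims by (simp add: rmap_blk ent_blk_times)
    also have "\<dots> = (\<Sum>l<rk K. \<Sum>js\<in>paths ?us'. if hd (js @ [i]) = l then of_fn (M $$ (i, l)) * ?g js i else 0)"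
      by (simp add: P[OF i] sum_distrib_left if_distrib cong: if_cong)
    also have "\<dots> = (\<Sum>js\<in>paths ?us'. \<Sum>l<rk K. if hd (js @ [i]) = l then of_fn (M $$ (i, l)) * ?g js i else 0)"
      by (rule sum.swap)
    also have "\<dots> = (\<Sum>js\<in>paths ?us'. of_fn (M $$ (i, hd (js @ [i]))) * ?g js i)"
      by (rule sum.cong[OF HOL.refl]) (use hd i in \<open>simp add: sum.delta\<close>)
    finally show ?thesis .
  qed
  have "T ?n (fn_mat (blk B K M) * ?P) =
      (\<Sum>p\<in>Pair B ` {..<rk B}. sign ((int ?n + 1) * par p) * ent (fn_mat (blk B K M) * ?P) p p)"
    unfolding T_def
  proof (rule sum.mono_neutral_right)
    show "\<forall>p\<in>index_set S - Pair B ` {..<rk B}. sign ((int ?n + 1) * par p) * ent (fn_mat (blk B K M) * ?P) p p = 0"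
    proof
      fix p assume p: "p \<in> index_set S - Pair B ` {..<rk B}"
      have "fst p \<noteq> B"
      proof
        assume "fst p = B"
        then have "p = (B, snd p)" "snd p < rk B" using p by (auto simp: prod_eq_iff index_set_def)
        then show False using p by blast
      qed
      then show "sign ((int ?n + 1) * par p) * ent (fn_mat (blk B K M) * ?P) p p = 0"
        by (simp add: rmap_blk ent_blk_times)
    qed
  qed (use S finite_I in \<open>auto simp: index_set_def\<close>)
  also have "\<dots> = (\<Sum>i<rk B. sign ((int ?n + 1) * sh B i) * ent (fn_mat (blk B K M) * ?P) (B, i) (B, i))"
    by (subst sum.reindex) (auto simp: inj_on_def o_def par_def)
  also have "\<dots> = (\<Sum>i<rk B. \<Sum>js\<in>paths ?us'. sign ((int ?n + 1) * sh B i) * (of_fn (M $$ (i, hd (js @ [i]))) * ?g js i))"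
    by (intro sum.cong HOL.refl) (simp add: diag sum_distrib_left)
  also have "\<dots> = (\<Sum>i<rk B. \<Sum>js\<in>paths ?us'. sign (trace_sign R ?us (i # js)) *
      (of_fn (M $$ (i, hd (js @ [i]))) * prod_list (map dform (entries ?us' js i))))"
  proof (intro sum.cong HOL.refl)
    fix i js assume i: "i \<in> {..<rk B}" and js: "js \<in> paths ?us'"
    let ?x = "M $$ (i, hd (js @ [i]))" and ?fs = "entries ?us' js i"
    show "sign ((int ?n + 1) * sh B i) * (of_fn ?x * ?g js i) =
        sign (trace_sign R ?us (i # js)) * (of_fn ?x * prod_list (map dform ?fs))"
    \<comment> \<open>The signs agree only along paths without zero entries; on the other paths both
      terms vanish.\<close>
    proof (cases "\<forall>f\<in>set (?x # ?fs). f \<noteq> 0")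
      case True
      have "i # js \<in> paths ?us"
        unfolding paths_Cons by (rule image_eqI[of _ _ "(i, js)"]) (use i js dims in \<open>auto simp: mat_item_def\<close>)
      moreover have "entries ?us (i # js) (hd (i # js)) ! j \<noteq> 0" if "j < length ?us" for j
      proof -
        have "length (entries ?us (i # js) (hd (i # js))) = length ?us"
          by (rule length_entries) (use js in \<open>simp add: paths_def\<close>)
        then have "entries ?us (i # js) (hd (i # js)) ! j \<in> set (entries ?us (i # js) (hd (i # js)))"
          using that by (metis nth_mem)
        then show ?thesis using True by (auto simp: mat_item_def)
      qed
      ultimately have "sign (trace_sign R ?us (i # js)) =
          (sign (int (length ?us) * sh B (hd (i # js)) + (\<Sum>j=1..<length ?us. sh (fst (?us ! j)) ((i # js) ! j))) :: 'a forms)"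
        by (intro trace_sign_path[OF ne ch ok])
      also have "(\<Sum>j=1..<length ?us. sh (fst (?us ! j)) ((i # js) ! j)) = (\<Sum>j<?n. sh (fst (snd (zs ! j))) (js ! j))"
        by (rule sum.reindex_bij_witness[of _ Suc "\<lambda>j. j - 1"]) (auto simp: nth_Cons')
      finally have "sign (trace_sign R ?us (i # js)) =
          sign ((int ?n + 1) * sh B i) * (sign (\<Sum>j<?n. sh (fst (snd (zs ! j))) (js ! j)) :: 'a forms)"
        by (simp add: sign_add add.commute)
      moreover have "of_fn ?x * (sign m * Y) = sign m * (of_fn ?x * Y)" for m Y
        by (auto simp: sign_def)
      ultimately show ?thesis by (simp add: mult.assoc)
    next
      case vanishing: False
      have "of_fn ?x * prod_list (map dform ?fs) = 0"
      proof (cases "?x = 0")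
        case False
        then have "0 \<in> set (map dform ?fs)" using vanishing by force
        then show ?thesis by (simp add: prod_list_0_member)
      qed simp
      then have "of_fn ?x * (sign m * prod_list (map dform ?fs)) = 0" for m
        by (auto simp: sign_def)
      then show ?thesis using \<open>of_fn ?x * prod_list (map dform ?fs) = 0\<close> by simp
    qed
  qed
  finally have "T ?n (fn_mat (blk B K M) * ?P) = (\<Sum>i<rk B. \<Sum>js\<in>paths ?us'. sign (trace_sign R ?us (i # js)) *
      (of_fn (M $$ (i, hd (js @ [i]))) * prod_list (map dform (entries ?us' js i))))" .
  then show ?thesis
    unfolding phi_trace_forget[OF ne] sum_paths_Cons by (simp add: dims mat_item_def form_scale_sum)
qed

lemma composite_term_trace:
  assumes w: "w \<in> words wt sc W" and S: "finite S" "S \<subseteq> Br" "src ` set w \<subseteq> S" and len: "length s = length w"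
  shows "composite_term R w s = form_scale (1 / fact (length w - 1 + sum_list s))
    (matrix_factorization.T par (index_set S) (length w - 1 + sum_list s)
      (matrix_factorization.summand par D0 (mats w) (rotate1 s)))"
proof -
  interpret matrix_factorization par E D0 W "index_set S" "Suc CARD('n)"
    by (rule matrix_factorization[OF S(1,2)])
  define t where "t = rotate1 s"
  have t: "length t = length w" by (simp add: t_def len)
  have ne: "w \<noteq> []" using w by (simp add: words_def)
  then obtain k where k: "length w = Suc k" by (cases w) auto
  let ?D = "\<lambda>i. (tgt w i, tgt w i, 1, dif_mat (R (tgt w i)))"
  let ?B = "\<lambda>i. (src (w ! i), tgt w i, deg (w ! i), arrow_mat R w i)"
  let ?z = "\<lambda>i. (A (fst (mats w ! i)), ?B i) # replicate (t ! i) (eta, ?D i)"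
  \<comment> \<open>Each matrix of one-forms is paired with the letter it comes from. The first
    letter is left out because it is not differentiated.\<close>
  define zs where "zs = replicate (t ! 0) (eta, ?D 0) @ concat (map ?z [1..<length w])"
  have up: "[0..<length w] = 0 # [1..<length w]" using k by (simp add: upt_conv_Cons)
  have items: "items R w t = ?B 0 # map snd zs"
    unfolding items_def zs_def up by (simp add: map_concat o_def)
  have lz: "length zs = length w - 1 + sum_list s"
  proof -
    have "sum_list t = sum_list s" unfolding t_def by (cases s) auto
    moreover have "length (items R w t) = Suc (length zs)" unfolding items by simp
    ultimately show ?thesis using length_items[OF t, of R] k by simp
  qed
  have z0: "(A (fst (mats w ! 0)), ?B 0) # zs = concat (map ?z [0..<length w])"
    unfolding zs_def up by simp
  have X: "mats w ! i = (blk (src (w ! i)) (tgt w i) (arrow_mat R w i), deg (w ! i))" if "i < length w" for i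
    using that by (simp add: mats_nth mat_of_def arrow_data_def arrow_mat_def)
  have rows: "ent Y p q = (if fst q = fst (snd u) \<and> snd p < dim_row (mat_item u) \<and> snd q < dim_col (mat_item u)
       then sign (sh (fst p) (snd p)) * dform (mat_item u $$ (snd p, snd q)) else 0)"
    if "(Y, u) \<in> set zs" "fst p = fst u" for Y u p q
  proof -
    have "(Y, u) \<in> set (concat (map ?z [0..<length w]))" using that(1) by (simp flip: z0)
    then obtain i where i: "i < length w" "(Y, u) = (A (fst (mats w ! i)), ?B i) \<or> (Y, u) = (eta, ?D i)"
      by auto
    from i(2) show ?thesis
    proof
      assume "(Y, u) = (A (fst (mats w ! i)), ?B i)"
      then show ?thesis
        using that(2) by (auto simp: A_def eps_def X[OF i(1)] ent_blk mat_item_def par_def)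
    next
      assume "(Y, u) = (eta, ?D i)"
      then show ?thesis
        using that(2) words_nth(2)[OF w i(1)] by (auto simp: eta_def eps_def ent_D0 E_def mat_item_def par_def)
    qed
  qed
  have prod: "summand (mats w) t = fn_mat (fst (mats w ! 0)) * prod_list (map fst zs)"
  proof -
    have m: "map2 (\<lambda>c j. c * eta ^ j) (map (\<lambda>y. A (fst y)) (tl (mats w))) (tl t) =
        map (\<lambda>i. A (fst (mats w ! i)) * eta ^ (t ! i)) [1..<length w]"
      by (rule nth_equalityI) (auto simp: t nth_tl)
    obtain t0 ts where t0: "t = t0 # ts" using t k by (cases t) auto
    have hd: "hd (mats w) = mats w ! 0" using k by (intro hd_conv_nth) (metis length_0_conv length_mats nat.simps(3))
    have c: "prod_list (concat (map f ys)) = prod_list (map (\<lambda>y. prod_list (f y)) ys)"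
      for f :: "nat \<Rightarrow> ('m brane \<times> nat, 'a forms) rfm list" and ys
      by (induction ys) auto
    have z: "map fst zs = replicate (t ! 0) eta @
        concat (map (\<lambda>i. A (fst (mats w ! i)) # replicate (t ! i) eta) [1..<length w])"
      unfolding zs_def by (simp add: map_concat o_def)
    have p: "prod_list (map fst zs) = eta ^ (t ! 0) *
        prod_list (map (\<lambda>i. A (fst (mats w ! i)) * eta ^ (t ! i)) [1..<length w])"
      unfolding z prod_list.append c by (simp add: prod_list_replicate)
    have "summand (mats w) t = fn_mat (fst (hd (mats w))) * eta ^ (t ! 0) *
        prod_list (map2 (\<lambda>c j. c * eta ^ j) (map (\<lambda>y. A (fst y)) (tl (mats w))) (tl t))"
      unfolding summand_def t0 by simp
    then show ?thesis unfolding m hd p by (simp only: mult.assoc)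
  qed
  have "phi (generalized_trace (map (forget R) (?B 0 # map snd zs))) =
    form_scale (1 / fact (length zs)) (T (length zs) (fn_mat (blk (src (w ! 0)) (tgt w 0) (arrow_mat R w 0)) * prod_list (map fst zs)))"
  proof (rule T_paths[symmetric, OF S(1,2) _ _ _ rows])
    have "w ! 0 \<in> set w" using k by simp
    then show "src (w ! 0) \<in> S" using S(3) by blast
    show "chain (src (w ! 0)) (?B 0 # map snd zs) (src (w ! 0))"
      using chain_items[OF ne, of R t] unfolding items .
    show "item_ok u" if "u \<in> set (?B 0 # map snd zs)" for u
      by (rule items_ok[OF w, of _ t]) (use that in \<open>simp only: items\<close>)
  qed
  moreover have "composite_term R w s = phi (generalized_trace (map (forget R) (?B 0 # map snd zs)))"
    unfolding composite_term_def Td_word_items[OF len] t_def[symmetric] items ..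
  moreover have "fst (mats w ! 0) = blk (src (w ! 0)) (tgt w 0) (arrow_mat R w 0)"
    using X[of 0] k by simp
  ultimately show ?thesis unfolding prod t_def[symmetric] lz by simp
qed

lemma composite_term_closed_states:
  assumes w: "w \<in> words wt sc W" and len: "length s = length w"
  shows "composite_term R w s \<in> closed_states wt (sum_list (map deg w) - (int (length w) - 1))"
proof -
  have ne: "w \<noteq> []" using w by (simp add: words_def)
  have t: "length (rotate1 s) = length w" by (simp add: len)
  let ?us = "items R w (rotate1 s)"
  have nz: "?us \<noteq> []" using ne length_items[OF t, of R] by (metis add_eq_0_iff_both_eq_0 length_0_conv)
  have "(\<Sum>j<length ?us. deg_item (?us ! j)) = sum_list (map deg w) + int (sum_list s)"
  proof -
    have "(\<Sum>j<length ?us. deg_item (?us ! j)) = sum_list (map deg_item ?us)"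
      by (simp add: sum_list_sum_nth atLeast0LessThan)
    then show ?thesis by (simp only: sum_list_items[OF t] sum_list_rotate1)
  qed
  moreover have "int (length ?us - 1) = int (length w) - 1 + int (sum_list s)"
    using ne length_items[OF t, of R] by (cases w) (auto simp: sum_list_rotate1)
  ultimately have "(\<Sum>j<length ?us. deg_item (?us ! j)) - int (length ?us - 1) = sum_list (map deg w) - (int (length w) - 1)"
    by simp
  then show ?thesis
    using phi_trace_closed_states[OF nz chain_items[OF ne] items_ok[OF w]]
    by (simp add: composite_term_def Td_word_items[OF len])
qed

lemma composite_term_vanish:
  assumes "w \<noteq> []" "length s = length w" "length w - 1 + sum_list s > Suc CARD('n)"
  shows "composite_term R w s = 0"
proof -
  have t: "length (rotate1 s) = length w" by (simp add: assms)
  have nz: "items R w (rotate1 s) \<noteq> []"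
    using assms(1) length_items[OF t, of R] by (metis add_eq_0_iff_both_eq_0 length_0_conv)
  have "length (items R w (rotate1 s)) - 1 = length w - 1 + sum_list s"
    using assms(1) length_items[OF t, of R] by (cases w) (auto simp: sum_list_rotate1)
  then show ?thesis
    using phi_trace_form_degree[OF nz, of R] assms(3) form_degree_ge_vanish[OF form_degree_vanish]
    by (simp add: composite_term_def Td_word_items[OF assms(2)])
qed

definition word_value :: "'m arrow list \<Rightarrow> 'a forms" where
  "word_value w = (\<Sum>s\<in>{s. length s = length w \<and> length w - 1 + sum_list s \<le> Suc CARD('n)}. composite_term R w s)"

lemma finite_sum_composite:
  assumes "w \<in> words wt sc W"
  shows "finite_sum_is (length w) (composite_term R w) (word_value w)"
proof -
  let ?A = "{s. length s = length w \<and> length w - 1 + sum_list s \<le> Suc CARD('n)}"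
  let ?Z = "{s. length s = length w \<and> composite_term R w s \<noteq> 0}"
  have "w \<noteq> []" using assms by (simp add: words_def)
  \<comment> \<open>The finite range of summation contains all exponents with a nonzero term,
    because larger exponents give forms whose degree exceeds the bound.\<close>
  then have sub: "?Z \<subseteq> ?A" using composite_term_vanish[of w] by force
  have fin: "finite ?A"
    by (rule finite_subset[OF _ finite_compositions_le[of "length w" "Suc CARD('n)"]]) auto
  have "word_value w = (\<Sum>s\<in>?Z. composite_term R w s)"
    unfolding word_value_def using fin sub by (intro sum.mono_neutral_right) auto
  then show ?thesis
    unfolding finite_sum_is_def using finite_subset[OF sub fin] by simp
qed

text \<open>The right-hand side does not mention \<open>S\<close>. Hence the values of a word and of
  all terms of its differential can be computed in the same matrix factorization.\<close>

lemma val_word_value: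
  assumes w: "w \<in> words wt sc W" and S: "finite S" "S \<subseteq> Br" "src ` set w \<subseteq> S"
  shows "matrix_factorization.val par D0 (index_set S) (Suc CARD('n)) (mats w) = word_value w"
proof -
  interpret matrix_factorization par E D0 W "index_set S" "Suc CARD('n)"
    by (rule matrix_factorization[OF S(1,2)])
  have ne: "w \<noteq> []" using w by (simp add: words_def)
  then have "mats w \<noteq> []" by (metis length_0_conv length_mats)
  then have "val (mats w) = (\<Sum>t\<in>{t. length t = length w \<and> length w - 1 + sum_list t \<le> Suc CARD('n)}.
    form_scale (1 / fact (length w - 1 + sum_list t)) (T (length w - 1 + sum_list t) (summand (mats w) t)))"
    by (simp add: val_sum)
  also have "\<dots> = word_value w"
    unfolding word_value_def
  proof (rule sum.reindex_bij_witness[of _ rotate1 "\<lambda>t. last t # butlast t"])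
    fix s assume s: "s \<in> {s. length s = length w \<and> length w - 1 + sum_list s \<le> Suc CARD('n)}"
    then show "last (rotate1 s) # butlast (rotate1 s) = s" "rotate1 s \<in> {s. length s = length w \<and> length w - 1 + sum_list s \<le> Suc CARD('n)}"
      using ne by (cases s; auto)+
  next
    fix t assume t: "t \<in> {t. length t = length w \<and> length w - 1 + sum_list t \<le> Suc CARD('n)}"
    then have nt: "t \<noteq> []" using ne by auto
    then show eq: "rotate1 (last t # butlast t) = t" by simp
    have "sum_list (last t # butlast t) = sum_list t"
      using nt by (metis add.commute append_butlast_last_id sum_list.Cons sum_list.append sum_list.Nil add.right_neutral)
    then show mem: "last t # butlast t \<in> {s. length s = length w \<and> length w - 1 + sum_list s \<le> Suc CARD('n)}"
      using t nt ne by (cases w) auto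
    show "composite_term R w (last t # butlast t) =
      form_scale (1 / fact (length w - 1 + sum_list t)) (T (length w - 1 + sum_list t) (summand (mats w) t))"
      using composite_term_trace[OF w S, of "last t # butlast t"] mem eq \<open>sum_list (last t # butlast t) = sum_list t\<close>
      by simp
  qed
  finally show ?thesis .
qed

end

section \<open>The signs of the explicit formula\<close>

lemma ceiling_half: "\<lceil>real n / 2\<rceil> = int ((n + 1) div 2)"
proof (cases "even n")
  case True
  then obtain m where "n = 2 * m" by (rule evenE)
  then show ?thesis by simp
next
  case False
  then obtain m where n: "n = 2 * m + 1" by (rule oddE)
  have "\<lceil>real n / 2\<rceil> = int m + 1" by (rule ceiling_unique) (auto simp: n field_simps)
  then show ?thesis by (simp add: n)
qed

text \<open>Modulo 2, \<lceil>n/2\<rceil> is the triangular number n (n + 1) / 2, which grows by n +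
  1 from n to n + 1. So the first summand of \<tau> counts 1 + 2 + ... + n.\<close>

lemma sign_half_Suc: "sign (int ((n + 1) div 2)) = (sign (int ((n + 2) div 2)) * sign (int n + 1) :: 'b::ring_1)"
proof (cases "even n")
  case True
  then obtain m where "n = 2 * m" by (rule evenE)
  then show ?thesis by (simp add: sign_def)
next
  case False
  then obtain m where "n = 2 * m + 1" by (rule oddE)
  then show ?thesis by (simp add: sign_def)
qed

lemma blk_one: "dim_col M = n \<Longrightarrow> blk B C M * blk C C (1\<^sub>m n) = blk B C M"
  by (subst blk_mult) auto

context brane_category
begin

lemma blk_d_mat_D0:
  assumes "C \<in> Br" "dim_col M = rk C"
  shows "blk B C M * d_mat D0 = blk B C M * blk C C (map_mat dform (dif_mat (R C)))"
  by (rule rfm_eqI) (use assms in \<open>auto simp: ent_blk_times ent_D0 ent_blk E_def intro!: sum.cong\<close>)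

text \<open>In \<open>summand\<close> each differentiated factor brings one \<open>eps\<close>. When
  they are collected at the right end, m copies pass the m-th of these factors, which costs m times
  its degree. For odd factors only, this would add up to 1 + 2 + ... + n, the first part of \<tau>.
  The factor d\<alpha>_i stands at place s_1 + ... + s_i + i and corrects this by its place times
  |\<alpha>_i| + 1, the second part of \<tau>.\<close>

lemma explicit_term_trace:
  assumes w: "w \<in> words wt sc W" and S: "finite S" "S \<subseteq> Br" "src ` set w \<subseteq> S" and len: "length s = length w"
  shows "explicit_term R w s = form_scale (1 / fact (length w - 1 + sum_list s))
    (matrix_factorization.T par (index_set S) (length w - 1 + sum_list s)
      (matrix_factorization.summand par D0 (mats w) (rotate1 s)))"
proof -
  interpret matrix_factorization par E D0 W "index_set S" "Suc CARD('n)"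
    by (rule matrix_factorization[OF S(1,2)])
  have ne: "w \<noteq> []" using w by (simp add: words_def)
  then obtain k where k: "length w = Suc k" by (cases w) auto
  let ?h = "\<lambda>n :: nat. int ((n + 1) div 2)"
  let ?B0 = "src (w ! 0)"
  define dD where "dD i = map_mat dform (dif_mat (R (src (w ! i))))" for i
  define da where "da i = map_mat dform (arrow_mat R w i)" for i
  define P where "P i = foldl (\<lambda>P i. P * (dD i ^\<^sub>m (s ! i)) * da i) (map_mat of_fn (arrow_mat R w 0)) [1..<Suc i]" for i
  define rho where "rho i = (\<Sum>j=1..i. (int (\<Sum>l=1..j. s ! l) + int j) * (deg (w ! j) + 1))" for i
  define n where "n i = i + (\<Sum>l=1..i. s ! l)" for i
  define Q where "Q i = fn_mat (fst (mats w ! 0)) * prod_list (map (\<lambda>j. eta ^ (s ! j) * A (fst (mats w ! j))) [1..<Suc i])" for i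
  have X: "mats w ! i = (blk (src (w ! i)) (tgt w i) (arrow_mat R w i), deg (w ! i))" if "i \<le> k" for i
    using that k by (simp add: mats_nth mat_of_def arrow_data_def arrow_mat_def)
  have src_Suc: "src (w ! Suc i) = tgt w i" if "i < k" for i
    using that k by (simp add: tgt_eq)
  have in_Br: "src (w ! i) \<in> Br" "tgt w i \<in> Br" if "i \<le> k" for i
    using words_nth[OF w, of i] that k by auto
  have dims: "dim_row (arrow_mat R w i) = rk (src (w ! i))" "dim_col (arrow_mat R w i) = rk (tgt w i)" for i
    by (simp_all add: arrow_mat_def)
  have dDd: "dim_row (dD i) = rk (src (w ! i))" "dim_col (dD i) = rk (src (w ! i))" for i
    by (simp_all add: dD_def)
  have pow_dims: "dim_row (dD i ^\<^sub>m j) = rk (src (w ! i))" "dim_col (dD i ^\<^sub>m j) = rk (src (w ! i))" for i j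
    by (induction j) (simp_all add: dD_def)
  have homog_i: "homog par (deg (w ! i)) (fst (mats w ! i))" if "i \<le> k" for i
  proof -
    have "mats w ! i \<in> set (mats w)" using that k by simp
    then have "good (mats w ! i)" by (rule mats_good[OF w S(3,1,2)])
    then show ?thesis using X[OF that] by (simp add: good_def)
  qed
  have eps_power: "eps ^ m * Y = sign (int m * a) * (Y * eps ^ m)" if "homog par a Y" for m a and Y :: "('m brane \<times> nat, 'a forms) rfm"
  proof (induction m)
    case (Suc m)
    have "eps * Y = sign a * (Y * eps)" using eps_commute[OF that] by (simp add: sign_sign)
    from mult_assoc_eq[OF this]
    have "eps * (Y * Z) = sign a * (Y * (eps * Z))" for Z by (simp add: mult.assoc)
    moreover have "eps * (sign m' * Z) = sign m' * (eps * Z)" for m' Z by (auto simp: sign_def)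
    ultimately have "eps ^ Suc m * Y = sign (int m * a) * (sign a * (Y * (eps * eps ^ m)))"
      by (simp add: mult.assoc Suc)
    then show ?case by (simp add: sign_add ring_distribs mult.assoc) (auto simp: sign_def)
  qed simp
  have pw: "eps ^ m * (eps * Y) = eps ^ Suc m * Y" for m and Y :: "('m brane \<times> nat, 'a forms) rfm"
    by (simp only: power_Suc2 mult.assoc)
  \<comment> \<open>With \<open>m\<close> factors \<open>eps\<close> already at the right end,
    \<open>j\<close> factors \<open>eta\<close> add m + 1, ..., m + j to the exponent, that is, the
    difference of two triangular numbers.\<close>
  have eta_power: "blk B (src (w ! i)) M * eps ^ m * eta ^ j =
      sign (?h m + ?h (m + j)) * (blk B (src (w ! i)) M * blk (src (w ! i)) (src (w ! i)) (dD i ^\<^sub>m j) * eps ^ (m + j))"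
    if "i \<le> k" "dim_col M = rk (src (w ! i))" for B i M m j
  proof (induction j)
    case 0
    have "blk B (src (w ! i)) M * blk (src (w ! i)) (src (w ! i)) (dD i ^\<^sub>m 0) = blk B (src (w ! i)) M"
      unfolding pow_mat.simps by (rule blk_one) (simp add: that(2) dD_def)
    then show ?case by (simp add: sign_def)
  next
    case (Suc j)
    let ?C = "src (w ! i)"
    let ?Y = "blk B ?C M * blk ?C ?C (dD i ^\<^sub>m j)"
    have e: "eps ^ m' * eta = sign (int m' + 1) * (d_mat D0 * eps ^ Suc m')" for m'
      unfolding eta_def pw eps_power[OF homog_rmap[of dform, OF dform_0 D0_homog]] by (simp add: add.commute)
    have D: "blk ?C ?C (dD i ^\<^sub>m j) * d_mat D0 = blk ?C ?C (dD i ^\<^sub>m Suc j)"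
      unfolding blk_d_mat_D0[OF in_Br(1)[OF that(1)] pow_dims(2)] dD_def[symmetric] pow_mat.simps
      by (rule blk_mult) (simp add: dDd)
    have "blk B ?C M * eps ^ m * eta ^ Suc j = blk B ?C M * eps ^ m * eta ^ j * eta"
      by (simp add: mult.assoc power_commutes)
    also have "\<dots> = sign (?h m + ?h (m + j)) * (?Y * (eps ^ (m + j) * eta))"
      unfolding Suc.IH by (simp add: mult.assoc)
    also have "\<dots> = sign (?h m + ?h (m + j)) * (sign (int (m + j) + 1) * (?Y * d_mat D0 * eps ^ Suc (m + j)))"
      unfolding e by (auto simp: sign_def mult.assoc)
    also have "?Y * d_mat D0 = blk B ?C M * blk ?C ?C (dD i ^\<^sub>m Suc j)"
      unfolding D[symmetric] by (simp add: mult.assoc)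
    also have "sign (?h m + ?h (m + j)) * (sign (int (m + j) + 1) * Z) = sign (?h m + ?h (m + Suc j)) * Z"
      for Z :: "('m brane \<times> nat, 'a forms) rfm"
    proof -
      have "sign (?h m + ?h (m + j)) * sign (int (m + j) + 1) = (sign (?h m + ?h (m + Suc j)) :: ('m brane \<times> nat, 'a forms) rfm)"
        unfolding sign_add[of "?h m"] sign_half_Suc[of "m + j"] by (simp add: mult.assoc)
      then show ?thesis by (simp flip: mult.assoc)
    qed
    finally show ?case by simp
  qed

  have main: "Q i = sign (?h (n i) + rho i) * (blk ?B0 (tgt w i) (P i) * eps ^ n i) \<and>
      dim_row (P i) = rk ?B0 \<and> dim_col (P i) = rk (tgt w i)" if "i \<le> k" for i
    using that
  proof (induction i)
    case 0
    then show ?case using X[of 0] by (simp add: Q_def P_def n_def rho_def rmap_blk dims)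
  next
    case (Suc i)
    let ?C = "src (w ! Suc i)" and ?s = "s ! Suc i" and ?a = "deg (w ! Suc i)"
    have ik: "i < k" "i \<le> k" "Suc i \<le> k" using Suc.prems by auto
    have IH: "Q i = sign (?h (n i) + rho i) * (blk ?B0 ?C (P i) * eps ^ n i)"
      "dim_row (P i) = rk ?B0" "dim_col (P i) = rk ?C"
      using Suc.IH ik src_Suc[OF ik(1)] by auto
    have PS: "P (Suc i) = P i * (dD (Suc i) ^\<^sub>m ?s) * da (Suc i)" by (simp add: P_def)
    have nS: "n (Suc i) = Suc (n i + ?s)" by (simp add: n_def)
    have rS: "rho (Suc i) = rho i + int (n (Suc i)) * (?a + 1)"
      by (simp add: rho_def n_def ring_distribs)
    have h: "homog par ?a (d_mat (fst (mats w ! Suc i)))"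
      by (intro homog_rmap homog_i ik) simp
    have AX: "eps ^ m * A (fst (mats w ! Suc i)) = sign (int (Suc m) * ?a) * (d_mat (fst (mats w ! Suc i)) * eps ^ Suc m)" for m
      unfolding A_def pw by (rule eps_power[OF h])
    let ?Y = "blk ?B0 ?C (P i) * blk ?C ?C (dD (Suc i) ^\<^sub>m ?s)"
    have "Q (Suc i) = Q i * eta ^ ?s * A (fst (mats w ! Suc i))"
      by (simp add: Q_def mult.assoc)
    also have "\<dots> = sign (?h (n i) + rho i) * (blk ?B0 ?C (P i) * eps ^ n i * eta ^ ?s * A (fst (mats w ! Suc i)))"
      unfolding IH(1) by (simp add: mult.assoc)
    also have "\<dots> = sign (?h (n i) + rho i) * (sign (?h (n i) + ?h (n i + ?s)) *
        (?Y * (eps ^ (n i + ?s) * A (fst (mats w ! Suc i)))))"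
      unfolding eta_power[OF ik(3) IH(3)] by (simp add: mult.assoc)
    also have "\<dots> = sign (?h (n i) + rho i) * (sign (?h (n i) + ?h (n i + ?s)) * (sign (int (n (Suc i)) * ?a) *
        (?Y * d_mat (fst (mats w ! Suc i)) * eps ^ n (Suc i))))"
      unfolding AX nS by (auto simp: sign_def mult.assoc)
    also have "?Y * d_mat (fst (mats w ! Suc i)) = blk ?B0 (tgt w (Suc i)) (P (Suc i))"
      using X[OF ik(3)] by (simp add: PS rmap_blk blk_mult IH dDd dims da_def)
    also have "sign (?h (n i) + rho i) * (sign (?h (n i) + ?h (n i + ?s)) * (sign (int (n (Suc i)) * ?a) * Z)) =
        sign (?h (n (Suc i)) + rho (Suc i)) * Z" for Z :: "('m brane \<times> nat, 'a forms) rfm"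
    proof -
      have "sign (?h (n i) + rho i) * (sign (?h (n i) + ?h (n i + ?s)) * sign (int (n (Suc i)) * ?a)) =
          (sign (rho i) * sign (?h (n i + ?s)) * sign (int (n (Suc i)) * ?a) :: ('m brane \<times> nat, 'a forms) rfm)"
        by (auto simp: sign_def)
      also have "\<dots> = sign (?h (n (Suc i)) + rho (Suc i))"
        unfolding rS sign_half_Suc[of "n i + ?s"] by (auto simp: sign_def nS)
      finally show ?thesis by (simp flip: mult.assoc)
    qed
    finally show ?case by (simp add: PS IH dims da_def)
  qed

  define Bm where "Bm = P k * (dD 0 ^\<^sub>m (s ! 0))"
  have tk: "tgt w k = ?B0" using k by (simp add: tgt_eq)
  have Bdims: "dim_row Bm = rk ?B0" "dim_col Bm = rk ?B0"
    using main[of k] by (simp_all add: Bm_def dDd)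
  have sums: "n k + s ! 0 = k + sum_list s" "(\<Sum>i\<le>k. s ! i) = sum_list s"
  proof -
    have "sum_list s = (\<Sum>i<Suc k. s ! i)" using len k by (simp add: sum_list_sum_nth atLeast0LessThan)
    also have "\<dots> = s ! 0 + (\<Sum>i<k. s ! Suc i)" by (rule sum.lessThan_Suc_shift)
    also have "(\<Sum>i<k. s ! Suc i) = (\<Sum>i=1..k. s ! i)"
      by (rule sum.reindex_bij_witness[of _ "\<lambda>i. i - 1" Suc]) auto
    finally show "n k + s ! 0 = k + sum_list s" by (simp add: n_def)
    show "(\<Sum>i\<le>k. s ! i) = sum_list s" using len k
      by (simp add: sum_list_sum_nth atLeast0LessThan lessThan_Suc_atMost)
  qed
  let ?n = "k + sum_list s"
  have "summand (mats w) (rotate1 s) = Q k * eta ^ (s ! 0)"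
  proof -
    obtain s0 ss where s0: "s = s0 # ss" using len k by (cases s) auto
    have lss: "length ss = k" using len k s0 by simp
    obtain x xs where xs: "mats w = x # xs" using k by (cases "mats w") (auto dest: arg_cong[of _ _ length])
    have lxs: "length xs = k" using xs k by (metis Suc_inject length_Cons length_mats)
    have shift: "x' * prod_list (map (\<lambda>(c, j). eta ^ j * c) (zip cs js)) * eta ^ j0 =
        prod_list (map2 (\<lambda>c j. c * eta ^ j) (x' # cs) (js @ [j0]))" if "length cs = length js" for x' cs js j0
      using that by (induction cs js arbitrary: x' rule: list_induct2) (auto simp: mult.assoc)
    have m: "map (\<lambda>j. eta ^ (s ! j) * A (fst (mats w ! j))) [1..<Suc k] =
        map (\<lambda>(c, j). eta ^ j * c) (zip (map (\<lambda>y. A (fst y)) xs) ss)"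
      by (rule nth_equalityI) (auto simp: lxs lss xs s0 simp del: upt_Suc)
    have "Q k * eta ^ (s ! 0) = fn_mat (fst x) * prod_list (map (\<lambda>(c, j). eta ^ j * c) (zip (map (\<lambda>y. A (fst y)) xs) ss)) * eta ^ s0"
      unfolding Q_def m by (simp add: xs s0)
    also have "\<dots> = summand (mats w) (rotate1 s)"
      unfolding summand_def xs s0 by (subst shift) (simp_all add: lxs lss)
    finally show ?thesis ..
  qed
  also have "\<dots> = sign (?h ?n + rho k) * (blk ?B0 ?B0 Bm * eps ^ ?n)"
  proof -
    have "Q k * eta ^ (s ! 0) = sign (?h (n k) + rho k) * (blk ?B0 ?B0 (P k) * eps ^ n k * eta ^ (s ! 0))"
      using main[of k] tk by (simp add: mult.assoc)
    also have "blk ?B0 ?B0 (P k) * eps ^ n k * eta ^ (s ! 0) = sign (?h (n k) + ?h ?n) * (blk ?B0 ?B0 Bm * eps ^ ?n)"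
      using eta_power[of 0 "P k" ?B0 "n k" "s ! 0"] main[of k] tk
      by (simp add: sums blk_mult dDd Bm_def)
    finally show ?thesis by (auto simp: sign_def)
  qed
  finally have summand: "summand (mats w) (rotate1 s) = sign (?h ?n + rho k) * (blk ?B0 ?B0 Bm * eps ^ ?n)" .
  have eps_n: "eps ^ m = diag (\<lambda>p. sign (int m * par p))" for m
  proof (induction m)
    case (Suc m)
    then show ?case
      by (intro rfm_eqI) (auto simp: eps_def ent_diag sign_add[symmetric] ring_distribs)
  qed (auto intro!: rfm_eqI simp: ent_diag ent_one)
  \<comment> \<open>The collected factors contribute \<open>n * par p\<close>; with the exponent
    \<open>(n + 1) * par p\<close> in \<open>T\<close> there remains \<open>par p\<close>, the sign
    of the supertrace.\<close>
  have "T ?n (blk ?B0 ?B0 Bm * eps ^ ?n) = (\<Sum>p\<in>index_set S. sign (par p) * ent (blk ?B0 ?B0 Bm) p p)"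
    unfolding T_def eps_n
  proof (rule sum.cong[OF HOL.refl])
    fix p
    show "sign ((int ?n + 1) * par p) * ent (blk ?B0 ?B0 Bm * diag (\<lambda>p. sign (int ?n * par p))) p p =
        sign (par p) * ent (blk ?B0 ?B0 Bm) p p"
      by (auto simp: sign_def)
  qed
  also have "\<dots> = (\<Sum>p\<in>Pair ?B0 ` {..<rk ?B0}. sign (par p) * ent (blk ?B0 ?B0 Bm) p p)"
  proof (rule sum.mono_neutral_right)
    have "w ! 0 \<in> set w" using k by simp
    then show "Pair ?B0 ` {..<rk ?B0} \<subseteq> index_set S" using S(3) by (auto simp: index_set_def)
    show "\<forall>p\<in>index_set S - Pair ?B0 ` {..<rk ?B0}. sign (par p) * ent (blk ?B0 ?B0 Bm) p p = 0"
    proof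
      fix p assume p: "p \<in> index_set S - Pair ?B0 ` {..<rk ?B0}"
      have "fst p \<noteq> ?B0"
      proof
        assume "fst p = ?B0"
        then have "p \<in> Pair ?B0 ` {..<rk ?B0}"
          using p by (intro image_eqI[of _ _ "snd p"]) (auto simp: prod_eq_iff index_set_def)
        then show False using p by simp
      qed
      then show "sign (par p) * ent (blk ?B0 ?B0 Bm) p p = 0" by (simp add: ent_blk)
    qed
  qed (rule finite_I)
  also have "\<dots> = (\<Sum>i<rk ?B0. sign (sh ?B0 i) * Bm $$ (i, i))"
    by (subst sum.reindex) (auto simp: inj_on_def o_def par_def ent_blk Bdims intro!: sum.cong)
  also have "\<dots> = supertrace (sh ?B0) Bm"
    by (simp add: supertrace_def Bdims)
  finally have T: "T ?n (summand (mats w) (rotate1 s)) = sign (?h ?n + rho k) * supertrace (sh ?B0) Bm"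
    unfolding summand T_sign by simp
  have tau: "tau w s = ?h ?n + rho k"
    unfolding tau_def Let_def rho_def by (simp add: k sums ceiling_half del: of_nat_add of_nat_sum)
  have "explicit_term R w s = form_scale (sign (tau w s) / fact ?n) (supertrace (sh ?B0) Bm)"
    unfolding explicit_term_def Let_def Bm_def P_def dD_def da_def by (simp add: k sums)
  also have "\<dots> = form_scale (1 / fact ?n) (sign (tau w s) * supertrace (sh ?B0) Bm)"
    by (simp add: form_scale_sign[symmetric] form_scale_scale)
  finally show ?thesis unfolding tau T[symmetric] by (simp add: k)
qed

lemma explicit_term_composite:
  assumes w: "w \<in> words wt sc W" and len: "length s = length w"
  shows "explicit_term R w s = composite_term R w s"
proof -
  have S: "finite (src ` set w)" "src ` set w \<subseteq> Br"
    using words_nth(1)[OF w] by (auto simp: in_set_conv_nth)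
  show ?thesis
    using explicit_term_trace[OF w S subset_refl len] composite_term_trace[OF w S subset_refl len] by simp
qed

lemma finite_sum_explicit:
  assumes "w \<in> words wt sc W"
  shows "finite_sum_is (length w) (explicit_term R w) (word_value w)"
proof -
  have eq: "{s. length s = length w \<and> explicit_term R w s \<noteq> 0} = {s. length s = length w \<and> composite_term R w s \<noteq> 0}"
    using explicit_term_composite[OF assms] by auto
  have "(\<Sum>s | length s = length w \<and> explicit_term R w s \<noteq> 0. explicit_term R w s) =
      (\<Sum>s | length s = length w \<and> composite_term R w s \<noteq> 0. composite_term R w s)"
    unfolding eq by (rule sum.cong) (simp_all add: explicit_term_composite[OF assms])
  then show ?thesis
    using finite_sum_composite[OF assms] unfolding finite_sum_is_def eq by simp
qed

end

section \<open>Passage to the Hochschild complex\<close>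

lemma lookup_chain_scale [simp]: "Poly_Mapping.lookup (chain_scale c x) k = c * Poly_Mapping.lookup x k"
  by (simp add: chain_scale_def Poly_Mapping.map.rep_eq when_def)

lemma chain_scale_add: "chain_scale c (x + y) = chain_scale c x + chain_scale c y"
  and chain_scale_minus: "chain_scale c (x - y) = chain_scale c x - chain_scale c y"
  and chain_scale_add_left: "chain_scale (c + d) x = chain_scale c x + chain_scale d x"
  and chain_scale_scale: "chain_scale c (chain_scale d x) = chain_scale (c * d) x"
  and chain_scale_0 [simp]: "chain_scale 0 x = 0"
  and chain_scale_zero [simp]: "chain_scale c 0 = 0"
  by (rule poly_mapping_eqI; simp add: lookup_add lookup_minus ring_distribs)+

lemma chain_scale_uminus: "chain_scale (- 1) x = - x"
  by (rule poly_mapping_eqI) simp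

lemma chain_scale_sum: "chain_scale c (sum f S) = (\<Sum>s\<in>S. chain_scale c (f s))"
  by (induction S rule: infinite_finite_induct) (auto simp: chain_scale_add)

lemma lin_scale: "lin g (chain_scale c x) = form_scale c (lin g x)"
  unfolding chain_scale_def by (rule lin_map_times)

lemma lin_tens: "lin g (tens w) = g w"
  by (simp add: lin_single)

lemma lin_minus: "lin g (x - y) = lin g x - lin g y"
  using lin_add[of g "x - y" y] by simp

lemma chain_d_superset:
  "finite K \<Longrightarrow> Poly_Mapping.keys x \<subseteq> K \<Longrightarrow>
    chain_d sc x = (\<Sum>w\<in>K. chain_scale (Poly_Mapping.lookup x w) (hoch_d2 w + hoch_d1 sc w))"
  unfolding chain_d_def by (rule sum.mono_neutral_left) (auto simp: in_keys_iff)

lemma chain_d_add: "chain_d sc (x + y) = chain_d sc x + chain_d sc y"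
proof -
  let ?K = "Poly_Mapping.keys x \<union> Poly_Mapping.keys y"
  have K: "finite ?K" "Poly_Mapping.keys (x + y) \<subseteq> ?K" by (auto simp: Poly_Mapping.keys_add)
  show ?thesis
    unfolding chain_d_superset[OF K] chain_d_superset[OF K(1) Un_upper1] chain_d_superset[OF K(1) Un_upper2]
    by (simp add: lookup_add chain_scale_add_left sum.distrib)
qed

lemma chain_d_minus: "chain_d sc (x - y) = chain_d sc x - chain_d sc y"
  using chain_d_add[of sc "x - y" y] by simp

lemma chain_d_scale: "chain_d sc (chain_scale c x) = chain_scale c (chain_d sc x)"
proof -
  have "Poly_Mapping.keys (chain_scale c x) \<subseteq> Poly_Mapping.keys x" by (auto simp: in_keys_iff)
  from chain_d_superset[OF _ this] show ?thesis
    by (simp add: chain_d_def chain_scale_sum chain_scale_scale)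
qed

lemma chain_d_tens: "chain_d sc (tens w) = hoch_d2 w + hoch_d1 sc w"
proof -
  have "chain_scale 1 x = x" for x :: "'m hchain" by (rule poly_mapping_eqI) simp
  then show ?thesis by (subst chain_d_superset[of "{w}"]) auto
qed

lemma hoch_d2_eq:
  "hoch_d2 w = (\<Sum>i<length w - 1. chain_scale (sign ((\<Sum>j\<le>i. deg (w ! j)) + int i + 1)) (tens (merge_at i w))) +
    (if length w - 1 = 0 then 0 else chain_scale
      (sign (((\<Sum>j<length w - 1. deg (w ! j)) + int (length w - 1) + 1) * (deg (w ! (length w - 1)) + 1)))
      (tens (wrap w)))"
  by (simp only: hoch_d2_def Let_def merge_at_def wrap_def)

lemma hoch_d1_eq:
  "hoch_d1 sc w = (\<Sum>i<length w. chain_scale (sign ((\<Sum>j<i. deg (w ! j)) + int i))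
     (tens (set_mor i (deg (w ! i) + 1) (brane_delta sc (src (w ! i)) (tgt w i) (deg (w ! i)) (mor (w ! i))) w)))"
  by (simp only: hoch_d1_def set_mor_def)

lemma set_mor_split: "p < length w \<Longrightarrow> set_mor p n f w = take p w @ Arrow (src (w ! p)) n f # drop (Suc p) w"
  by (simp add: set_mor_def upd_conv_take_nth_drop)

lemma length_set_mor [simp]: "length (set_mor p n f w) = length w"
  by (simp add: set_mor_def)

lemma nth_set_mor: "p < length w \<Longrightarrow> set_mor p n f w ! i = (if i = p then Arrow (src (w ! p)) n f else w ! i)"
  by (simp add: set_mor_def nth_list_update)

lemma src_set_mor: "p < length w \<Longrightarrow> src (set_mor p n f w ! i) = src (w ! i)"
  by (simp add: nth_set_mor)

lemma tgt_set_mor: "p < length w \<Longrightarrow> tgt (set_mor p n f w) i = tgt w i"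
  by (simp add: tgt_def src_set_mor)

lemma set_mor_set_mor: "p < length w \<Longrightarrow> set_mor p n f (set_mor p m g w) = set_mor p n f w"
  by (simp add: set_mor_def)

text \<open>Merging depends on a single entry again through a single entry: the new one is the old
  one, composed with its neighbour if it takes part in the merge. Positions behind the merged pair
  move down by one.\<close>

lemma merge_at_set_mor:
  assumes "p < length w" "Suc i < length w" "n = deg (w ! p)"
  shows "merge_at i (set_mor p n h w) =
    set_mor (if p \<le> i then p else p - 1) (deg (merge_at i w ! (if p \<le> i then p else p - 1)))
      (if p = i then mor (w ! Suc i) \<circ> h else if p = Suc i then h \<circ> mor (w ! i) else h) (merge_at i w)"
proof -
  consider "p < i" | "p = i" | "p = Suc i" | "p > Suc i" by linarith
  then show ?thesis
  proof cases
    case 1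
    then show ?thesis using assms
      by (simp add: merge_at_def set_mor_def nth_append list_update_append take_update_swap)
  next
    case 2
    then show ?thesis using assms
      by (simp add: merge_at_def set_mor_def nth_append list_update_append)
  next
    case 3
    then show ?thesis using assms
      by (simp add: merge_at_def set_mor_def nth_append list_update_append)
  next
    case 4
    then obtain q where q: "p = i + 2 + q" by (metis add_2_eq_Suc' le_Suc_ex less_eq_Suc_le)
    then show ?thesis using assms
      by (simp add: merge_at_def set_mor_def nth_append list_update_append drop_update_swap)
  qed
qed

lemma wrap_set_mor:
  assumes "p < length w" "length w = Suc k" "k > 0" "n = deg (w ! p)"
  shows "wrap (set_mor p n h w) =
    set_mor (if p = k then 0 else p) (deg (wrap w ! (if p = k then 0 else p)))
      (if p = k then mor (w ! 0) \<circ> h else if p = 0 then h \<circ> mor (w ! k) else h) (wrap w)"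
proof (rule nth_equalityI)
  have len: "length (wrap v) = k" if "length v = Suc k" for v :: "'a arrow list" using that assms(3) by (simp add: wrap_def Let_def)
  then show "length (wrap (set_mor p n h w)) = length (set_mor (if p = k then 0 else p) (deg (wrap w ! (if p = k then 0 else p)))
      (if p = k then mor (w ! 0) \<circ> h else if p = 0 then h \<circ> mor (w ! k) else h) (wrap w))"
    using assms by simp
  fix l assume "l < length (wrap (set_mor p n h w))"
  then have l: "l < k" using len assms(2) by simp
  have nth: "wrap v ! l = (if l = 0 then
      Arrow (src (v ! k)) (deg (v ! k) + deg (v ! 0)) (mor (v ! 0) \<circ> mor (v ! k)) else v ! l)"
    if "length v = Suc k" "l < k" for v :: "'a arrow list" and l
    using assms(3) that by (auto simp: wrap_def Let_def nth_Cons' nth_butlast nth_tl)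
  show "wrap (set_mor p n h w) ! l = set_mor (if p = k then 0 else p) (deg (wrap w ! (if p = k then 0 else p)))
      (if p = k then mor (w ! 0) \<circ> h else if p = 0 then h \<circ> mor (w ! k) else h) (wrap w) ! l"
    using assms l len[of w] by (auto simp: nth nth_set_mor)
qed

section \<open>Multilinearity of the value in each entry\<close>

context matrix_factorization
begin

lemma H_update:
  assumes "p < length xs"
  shows "H (xs[p := (x, a)]) = (if p = 0 then 1 else H (take p xs)) *
    (fps_const (if p = 0 then fn_mat x else A x) * (G * TL (drop (Suc p) xs)))"
proof (cases "p = 0")
  case True
  then show ?thesis using assms by (cases xs) (auto simp: H_Cons mult.assoc)
next
  case False
  then have "take p xs \<noteq> []" using assms by (cases xs) auto
  then show ?thesis using False assms
    by (simp add: upd_conv_take_nth_drop H_append TL_Cons mult.assoc)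
qed

lemma val_update_add:
  assumes "p < length xs"
  shows "val (xs[p := (x + y, a)]) = val (xs[p := (x, a)]) + val (xs[p := (y, a)])"
proof -
  have "A (x + y) = A x + A y" by (simp add: A_def d_mat_add ring_distribs)
  then have "H (xs[p := (x + y, a)]) = H (xs[p := (x, a)]) + H (xs[p := (y, a)])"
    unfolding H_update[OF assms] by (simp add: fn_mat_add ring_distribs flip: fps_const_add)
  then show ?thesis by (simp add: val_def Psi_add)
qed

text \<open>A constant has zero differential, so scaling commutes with \<open>A\<close> as well as
  with \<open>fn_mat\<close>. The scalar matrix is central and can be moved to the front of the
  product.\<close>

lemma val_update_scale:
  assumes "p < length xs"
  shows "val (xs[p := (diag (\<lambda>_. of_complex c) * x, a)]) = form_scale c (val (xs[p := (x, a)]))"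
proof -
  define K where "K = diag (\<lambda>_ :: 'i. of_fn (of_complex c :: 'a))"
  have A: "A (diag (\<lambda>_. of_complex c) * x) = K * A x"
    by (rule rfm_eqI) (simp add: A_def eps_def K_def dform_mult of_fn_left_commute)
  have fn: "fn_mat (diag (\<lambda>_. of_complex c) * x) = K * fn_mat x"
    by (rule rfm_eqI) (simp add: K_def of_fn_mult)
  have KZ: "Z * K = K * Z" for Z
    by (rule rfm_eqI) (simp add: K_def of_fn_central)
  then have KF: "F * fps_const K = fps_const K * F" for F
    by (intro fps_ext) simp
  have "H (xs[p := (diag (\<lambda>_. of_complex c) * x, a)]) = fps_const K * H (xs[p := (x, a)])"
    unfolding H_update[OF assms] A fn if_distrib[of "\<lambda>z. K * z", symmetric]
    by (simp add: mult.assoc mult_assoc_eq[OF KF] flip: fps_const_mult)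
  moreover have "Psi k (fps_const K * F) = form_scale c (Psi k F)" for k F
  proof -
    have "T n (K * Y) = form_scale c (T n Y)" for n Y
      by (simp add: T_def K_def form_scale_def of_fn_left_commute sum_distrib_left)
    then show ?thesis
      by (simp add: Psi_def form_scale_sum form_scale_scale mult.commute)
  qed
  ultimately show ?thesis by (simp add: val_def)
qed

end

section \<open>The Hochschild differential respects the multilinearity relations\<close>

context brane_category
begin

abbreviation rel :: "'m hchain set" where "rel \<equiv> multilinear_rel wt sc W"
abbreviation Words :: "'m arrow list set" where "Words \<equiv> words wt sc W"
abbreviation Hchains :: "'m hchain set" where "Hchains \<equiv> hchains wt sc W"

lemma rel_uminus: "x \<in> rel \<Longrightarrow> - x \<in> rel"
  using multilinear_rel.scale[of x wt sc W "- 1"] by (simp add: chain_scale_uminus)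

lemma rel_minus: "x \<in> rel \<Longrightarrow> y \<in> rel \<Longrightarrow> x - y \<in> rel"
  unfolding diff_conv_add_uminus by (intro multilinear_rel.add rel_uminus)

lemma Hchains_add: "x \<in> Hchains \<Longrightarrow> y \<in> Hchains \<Longrightarrow> x + y \<in> Hchains"
  using Poly_Mapping.keys_add[of x y] by (auto simp: hchains_def)

lemma Hchains_scale: "x \<in> Hchains \<Longrightarrow> chain_scale c x \<in> Hchains"
  by (auto simp: hchains_def in_keys_iff)

lemma Hchains_0: "0 \<in> Hchains"
  by (simp add: hchains_def)

lemma Hchains_sum: "(\<And>s. s \<in> S \<Longrightarrow> f s \<in> Hchains) \<Longrightarrow> sum f S \<in> Hchains"
  by (induction S rule: infinite_finite_induct) (auto intro: Hchains_0 Hchains_add)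

lemma Hchains_tens: "w \<in> Words \<Longrightarrow> tens w \<in> Hchains"
  by (simp add: hchains_def)

lemma set_mor_hom:
  assumes "set_mor p n f w \<in> Words" "p < length w"
  shows "f \<in> hom (src (w ! p)) (tgt w p) n"
  using words_nth(3)[OF assms(1), of p] assms(2) by (simp add: src_set_mor tgt_set_mor) (simp add: nth_set_mor)

lemma set_mor_in_words_iff:
  assumes "w \<in> Words" "p < length w"
  shows "set_mor p n f w \<in> Words \<longleftrightarrow> f \<in> hom (src (w ! p)) (tgt w p) n"
  using set_mor_hom[OF _ assms(2)] set_mor_words(1)[OF assms] by blast

lemma hom_add: "C \<in> Br \<Longrightarrow> f \<in> hom B C n \<Longrightarrow> g \<in> hom B C n \<Longrightarrow> (\<lambda>x. f x + g x) \<in> hom B C n"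
  using brane_closed[of C] by (auto simp: graded_hom_def scale.scale_right_distrib intro: pieces_closed_add)

lemma hom_scale: "C \<in> Br \<Longrightarrow> f \<in> hom B C n \<Longrightarrow> (\<lambda>x. sc (of_complex c) (f x)) \<in> hom B C n"
proof -
  assume C: "C \<in> Br" and f: "f \<in> hom B C n"
  have "sc (of_complex c) y \<in> piece C i" if "y \<in> piece C i" for y i
    using brane_graded[OF C] wt_const[of c] that unfolding graded_module_def by (metis add.right_neutral)
  then show ?thesis
    using f by (auto simp: graded_hom_def scale.scale_right_distrib scale.scale_left_commute mult.commute)
qed

definition linear_on :: "('m \<Rightarrow> 'm) set \<Rightarrow> (('m \<Rightarrow> 'm) \<Rightarrow> 'm \<Rightarrow> 'm) \<Rightarrow> bool" where
  "linear_on U L \<longleftrightarrow> (\<forall>f\<in>U. \<forall>g\<in>U. L (\<lambda>x. f x + g x) = (\<lambda>x. L f x + L g x)) \<and>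
     (\<forall>f\<in>U. \<forall>c. L (\<lambda>x. sc (of_complex c) (f x)) = (\<lambda>x. sc (of_complex c) (L f x)))"

lemma linear_on_id: "linear_on U (\<lambda>h. h)"
  by (simp add: linear_on_def)

lemma linear_on_precomp: "linear_on U (\<lambda>h. h \<circ> g)"
  by (auto simp: linear_on_def)

lemma linear_on_postcomp:
  assumes "B \<in> Br" "C \<in> Br" "g \<in> hom C K m"
  shows "linear_on (hom B C n) (\<lambda>h. g \<circ> h)"
proof -
  \<comment> \<open>Membership also holds for \<open>x\<close> outside the module of
    \<open>B\<close>, where the value is 0. This matters because linearity of \<open>g\<close> is
    known only on its module, while equality of functions concerns all arguments.\<close>
  have m: "f x \<in> module_of (piece C)" if "f \<in> hom B C n" for f x
    using graded_hom_module[OF that brane_closed[OF assms(2)], of x] graded_hom_outside[OF that, of x] module_of_0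
    by (cases "x \<in> module_of (piece B)") auto
  show ?thesis
    unfolding linear_on_def using graded_hom_add[OF assms(3)] graded_hom_scale[OF assms(3)] m
    by (auto simp: fun_eq_iff)
qed

lemma linear_on_delta:
  assumes "B \<in> Br" "C \<in> Br"
  shows "linear_on (hom B C n) (brane_delta sc B C n)"
proof -
  have m: "f x \<in> module_of (piece C)" if "f \<in> hom B C n" for f x
    using graded_hom_module[OF that brane_closed[OF assms(2)], of x] graded_hom_outside[OF that, of x] module_of_0
    by (cases "x \<in> module_of (piece B)") auto
  show ?thesis
    unfolding linear_on_def brane_delta_def
    using graded_hom_add[OF brane_dif[OF assms(2)]] graded_hom_scale[OF brane_dif[OF assms(2)]] m
    by (cases "even n") (auto simp: fun_eq_iff sign_def scale.scale_right_diff_distrib scale.scale_right_distrib)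
qed

text \<open>If an operation on words acts on the entry in one slot by a linear map, then it is compatible
  with the multilinearity relations in that slot.\<close>

lemma rel_operation:
  assumes w: "w \<in> Words" and p: "p < length w"
    and op: "\<And>h. op (set_mor p n h w) = set_mor p' n' (L h) v" and p': "p' < length v"
    and op_words: "\<And>f. f \<in> hom (src (w ! p)) (tgt w p) n \<Longrightarrow> op (set_mor p n f w) \<in> Words"
    and L: "linear_on (hom (src (w ! p)) (tgt w p) n) L"
    and f: "f \<in> hom (src (w ! p)) (tgt w p) n"
  shows "g \<in> hom (src (w ! p)) (tgt w p) n \<Longrightarrow>
      tens (op (set_mor p n (\<lambda>x. f x + g x) w)) - tens (op (set_mor p n f w)) - tens (op (set_mor p n g w)) \<in> rel"
    and "tens (op (set_mor p n (\<lambda>x. sc (of_complex c) (f x)) w)) - chain_scale c (tens (op (set_mor p n f w))) \<in> rel"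
proof -
  have fw: "take p' v @ Arrow (src (v ! p')) n' (L h) # drop (Suc p') v \<in> Words"
    if "h \<in> hom (src (w ! p)) (tgt w p) n" for h
    using op_words[OF that] by (simp add: op set_mor_split p')
  show "tens (op (set_mor p n (\<lambda>x. f x + g x) w)) - tens (op (set_mor p n f w)) - tens (op (set_mor p n g w)) \<in> rel"
    if g: "g \<in> hom (src (w ! p)) (tgt w p) n"
  proof -
    have "L (\<lambda>x. f x + g x) = (\<lambda>x. L f x + L g x)" using L f g by (simp add: linear_on_def)
    then show ?thesis
      using multilinear_rel.additive[OF fw[OF f] fw[OF g]] by (simp only: op set_mor_split[OF p'])
  qed
  have "L (\<lambda>x. sc (of_complex c) (f x)) = (\<lambda>x. sc (of_complex c) (L f x))" using L f by (simp add: linear_on_def)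
  then show "tens (op (set_mor p n (\<lambda>x. sc (of_complex c) (f x)) w)) - chain_scale c (tens (op (set_mor p n f w))) \<in> rel"
    using multilinear_rel.homogeneous[OF fw[OF f]] by (simp only: op set_mor_split[OF p'])
qed

text \<open>The failure of additivity and the failure of homogeneity of \<open>\<theta>\<close> in
  slot \<open>p\<close>, gathered in one set so that both are treated at once. That the set lies in
  \<open>rel\<close> means that \<open>\<theta>\<close> is linear in this slot modulo the
  relations.\<close>

definition defect :: "('m arrow list \<Rightarrow> 'm hchain) \<Rightarrow> 'm arrow list \<Rightarrow> nat \<Rightarrow> ('m \<Rightarrow> 'm) \<Rightarrow> ('m \<Rightarrow> 'm) \<Rightarrow> complex \<Rightarrow> 'm hchain set" where
  "defect \<theta> w p f g c = {\<theta> (set_mor p (deg (w ! p)) (\<lambda>x. f x + g x) w) - \<theta> (set_mor p (deg (w ! p)) f w) -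
       \<theta> (set_mor p (deg (w ! p)) g w),
     \<theta> (set_mor p (deg (w ! p)) (\<lambda>x. sc (of_complex c) (f x)) w) - chain_scale c (\<theta> (set_mor p (deg (w ! p)) f w))}"

context
  fixes w p f g and c :: complex
  assumes w: "w \<in> Words" and p: "p < length w"
    and f: "f \<in> hom (src (w ! p)) (tgt w p) (deg (w ! p))" and g: "g \<in> hom (src (w ! p)) (tgt w p) (deg (w ! p))"
begin

lemma merge_at_defect:
  assumes i: "Suc i < length w"
  shows "defect (\<lambda>v. tens (merge_at i v)) w p f g c \<subseteq> rel"
proof -
  let ?n = "deg (w ! p)"
  let ?L = "\<lambda>h. if p = i then mor (w ! Suc i) \<circ> h else if p = Suc i then h \<circ> mor (w ! i) else h"
  note op = merge_at_set_mor[OF p i HOL.refl]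
  have len: "(if p \<le> i then p else p - 1) < length (merge_at i w)"
    using p i by (auto simp: merge_at_def)
  have words: "merge_at i (set_mor p ?n h w) \<in> Words" if "h \<in> hom (src (w ! p)) (tgt w p) ?n" for h
    using set_mor_in_words_iff[OF w p] that i by (intro merge_words(1)) auto
  have L: "linear_on (hom (src (w ! p)) (tgt w p) ?n) ?L"
  proof (cases "p = i")
    case True
    have "mor (w ! Suc i) \<in> hom (tgt w p) (tgt w (Suc i)) (deg (w ! Suc i))"
      using words_nth(3)[OF w i] i True by (simp add: tgt_eq)
    from linear_on_postcomp[OF words_nth(1,2)[OF w p] this] show ?thesis using True by simp
  next
    case False
    then show ?thesis by (cases "p = Suc i") (simp_all add: linear_on_id linear_on_precomp)
  qed
  show ?thesis
    unfolding defect_def using rel_operation[OF w p op len words L f] g by auto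
qed

lemma wrap_defect:
  assumes k: "length w = Suc k" "k > 0"
  shows "defect (\<lambda>v. tens (wrap v)) w p f g c \<subseteq> rel"
proof -
  let ?n = "deg (w ! p)"
  let ?L = "\<lambda>h. if p = k then mor (w ! 0) \<circ> h else if p = 0 then h \<circ> mor (w ! k) else h"
  note op = wrap_set_mor[OF p k HOL.refl]
  have len: "(if p = k then 0 else p) < length (wrap w)"
    using p k by (auto simp: wrap_def Let_def)
  have words: "wrap (set_mor p ?n h w) \<in> Words" if "h \<in> hom (src (w ! p)) (tgt w p) ?n" for h
    using set_mor_in_words_iff[OF w p] that k by (intro wrap_words(1)) auto
  have L: "linear_on (hom (src (w ! p)) (tgt w p) ?n) ?L"
  proof (cases "p = k")
    case True
    have "mor (w ! 0) \<in> hom (tgt w p) (tgt w 0) (deg (w ! 0))"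
      using words_nth(3)[OF w, of 0] k True by (simp add: tgt_eq[of k])
    from linear_on_postcomp[OF words_nth(1,2)[OF w p] this] show ?thesis using True by simp
  next
    case False
    then show ?thesis by (cases "p = 0") (simp_all add: linear_on_id linear_on_precomp)
  qed
  show ?thesis
    unfolding defect_def using rel_operation[OF w p op len words L f] g by auto
qed

lemma delta_defect:
  assumes i: "i < length w"
  shows "defect (\<lambda>v. tens (set_mor i (deg (v ! i) + 1)
    (brane_delta sc (src (v ! i)) (tgt v i) (deg (v ! i)) (mor (v ! i))) v)) w p f g c \<subseteq> rel"
proof -
  let ?n = "deg (w ! p)"
  let ?D = "\<lambda>v. brane_delta sc (src (v ! i)) (tgt v i) (deg (v ! i)) (mor (v ! i))"
  let ?op = "\<lambda>v. set_mor i (deg (v ! i) + 1) (?D v) v"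
  have op: "?op (set_mor p ?n h w) = set_mor p (if p = i then ?n + 1 else ?n)
      ((if p = i then brane_delta sc (src (w ! p)) (tgt w p) ?n else (\<lambda>h. h)) h) (?op w)" for h
    using p i by (auto simp: nth_set_mor tgt_set_mor set_mor_set_mor)
      (simp add: set_mor_def list_update_swap nth_list_update)
  have words: "?op (set_mor p ?n h w) \<in> Words" if "h \<in> hom (src (w ! p)) (tgt w p) ?n" for h
  proof -
    have v: "set_mor p ?n h w \<in> Words" using set_mor_in_words_iff[OF w p] that by blast
    have i': "i < length (set_mor p ?n h w)" using i by simp
    show ?thesis
      by (rule set_mor_words(1)[OF v i']) (rule brane_delta_hom[OF words_nth[OF v i']])
  qed
  have L: "linear_on (hom (src (w ! p)) (tgt w p) ?n)
      (if p = i then brane_delta sc (src (w ! p)) (tgt w p) ?n else (\<lambda>h. h))"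
  proof (cases "p = i")
    case True
    show ?thesis unfolding if_P[OF True] by (rule linear_on_delta[OF words_nth(1,2)[OF w p]])
  next
    case False
    show ?thesis unfolding if_not_P[OF False] by (rule linear_on_id)
  qed
  have len: "p < length (?op w)" using p by simp
  show ?thesis
    unfolding defect_def using rel_operation[OF w p op len words L f] g by auto
qed

lemma defect_add: "defect \<theta> w p f g c \<subseteq> rel \<Longrightarrow> defect \<theta>' w p f g c \<subseteq> rel \<Longrightarrow> defect (\<lambda>v. \<theta> v + \<theta>' v) w p f g c \<subseteq> rel"
proof -
  assume 1: "defect \<theta> w p f g c \<subseteq> rel" and 2: "defect \<theta>' w p f g c \<subseteq> rel"
  let ?s = "\<lambda>h. set_mor p (deg (w ! p)) h w"
  let ?h = "\<lambda>x. f x + g x" and ?k = "\<lambda>x. sc (of_complex c) (f x)"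
  have a: "\<theta> (?s ?h) - \<theta> (?s f) - \<theta> (?s g) \<in> rel" "\<theta> (?s ?k) - chain_scale c (\<theta> (?s f)) \<in> rel"
    using 1 by (simp_all add: defect_def)
  have b: "\<theta>' (?s ?h) - \<theta>' (?s f) - \<theta>' (?s g) \<in> rel" "\<theta>' (?s ?k) - chain_scale c (\<theta>' (?s f)) \<in> rel"
    using 2 by (simp_all add: defect_def)
  show ?thesis
    using multilinear_rel.add[OF a(1) b(1)] multilinear_rel.add[OF a(2) b(2)]
    by (simp add: defect_def chain_scale_add algebra_simps)
qed

text \<open>The signs of the differential depend on degrees only, and these do not change when the
  morphism in a slot is replaced by another one of the same degree.\<close>

lemma defect_scale: "defect \<theta> w p f g c \<subseteq> rel \<Longrightarrow> (\<And>h. s (set_mor p (deg (w ! p)) h w) = s0) \<Longrightarrow>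
   defect (\<lambda>v. chain_scale (s v) (\<theta> v)) w p f g c \<subseteq> rel"
proof -
  assume 1: "defect \<theta> w p f g c \<subseteq> rel" and s: "\<And>h. s (set_mor p (deg (w ! p)) h w) = s0"
  let ?s = "\<lambda>h. set_mor p (deg (w ! p)) h w"
  let ?h = "\<lambda>x. f x + g x" and ?k = "\<lambda>x. sc (of_complex c) (f x)"
  have a: "\<theta> (?s ?h) - \<theta> (?s f) - \<theta> (?s g) \<in> rel" "\<theta> (?s ?k) - chain_scale c (\<theta> (?s f)) \<in> rel"
    using 1 by (simp_all add: defect_def)
  show ?thesis
    using multilinear_rel.scale[OF a(1), of s0] multilinear_rel.scale[OF a(2), of s0]
    by (simp add: defect_def s chain_scale_minus chain_scale_scale mult.commute)
qed

lemma defect_zero: "defect (\<lambda>v. 0) w p f g c \<subseteq> rel"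
  by (simp add: defect_def multilinear_rel.zero)

lemma defect_sum: "(\<And>i. i \<in> S \<Longrightarrow> defect (\<theta> i) w p f g c \<subseteq> rel) \<Longrightarrow> defect (\<lambda>v. \<Sum>i\<in>S. \<theta> i v) w p f g c \<subseteq> rel"
proof (induction S rule: infinite_finite_induct)
  case (insert i S)
  have "defect (\<lambda>v. \<theta> i v + (\<Sum>j\<in>S. \<theta> j v)) w p f g c \<subseteq> rel"
    using insert by (intro defect_add) auto
  then show ?case using insert.hyps by simp
qed (simp_all add: defect_zero)

lemma differential_defect: "defect (\<lambda>v. hoch_d2 v + hoch_d1 sc v) w p f g c \<subseteq> rel"
proof -
  let ?k = "length w - 1"
  have deg: "deg (set_mor p (deg (w ! p)) h w ! j) = deg (w ! j)" for h j
    by (simp add: nth_set_mor p)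
  have "defect (\<lambda>v. (\<Sum>i<?k. chain_scale (sign ((\<Sum>j\<le>i. deg (v ! j)) + int i + 1)) (tens (merge_at i v))) +
    (if ?k = 0 then 0 else chain_scale
      (sign (((\<Sum>j<?k. deg (v ! j)) + int ?k + 1) * (deg (v ! ?k) + 1))) (tens (wrap v))) +
    (\<Sum>i<length w. chain_scale (sign ((\<Sum>j<i. deg (v ! j)) + int i))
     (tens (set_mor i (deg (v ! i) + 1) (brane_delta sc (src (v ! i)) (tgt v i) (deg (v ! i)) (mor (v ! i))) v)))) w p f g c \<subseteq> rel"
  proof (intro defect_add defect_sum)
    show "defect (\<lambda>v. chain_scale (sign ((\<Sum>j\<le>i. deg (v ! j)) + int i + 1)) (tens (merge_at i v))) w p f g c \<subseteq> rel"
      if "i \<in> {..<?k}" for i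
      by (rule defect_scale[OF merge_at_defect]) (use that deg in auto)
    show "defect (\<lambda>v. chain_scale (sign ((\<Sum>j<i. deg (v ! j)) + int i))
     (tens (set_mor i (deg (v ! i) + 1) (brane_delta sc (src (v ! i)) (tgt v i) (deg (v ! i)) (mor (v ! i))) v))) w p f g c \<subseteq> rel"
      if "i \<in> {..<length w}" for i
      by (rule defect_scale[OF delta_defect]) (use that deg in auto)
    show "defect (\<lambda>v. if ?k = 0 then 0 else chain_scale
      (sign (((\<Sum>j<?k. deg (v ! j)) + int ?k + 1) * (deg (v ! ?k) + 1))) (tens (wrap v))) w p f g c \<subseteq> rel"
    proof (cases "?k = 0")
      case True
      show ?thesis unfolding if_P[OF True] by (rule defect_zero)
    next
      case False
      then have k: "length w = Suc ?k" "?k > 0" by auto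
      have "defect (\<lambda>v. chain_scale (sign (((\<Sum>j<?k. deg (v ! j)) + int ?k + 1) * (deg (v ! ?k) + 1))) (tens (wrap v))) w p f g c \<subseteq> rel"
        by (rule defect_scale[OF wrap_defect[OF k]]) (simp add: deg)
      then show ?thesis unfolding if_not_P[OF False] .
    qed
  qed
  then show ?thesis unfolding defect_def hoch_d2_eq hoch_d1_eq length_set_mor .
qed

end

end

lemma closed_states_scale:
  assumes wt_scale: "\<And>f n. wt f n \<Longrightarrow> wt (of_complex c * f) n"
    and "\<omega> \<in> closed_states wt n"
  shows "form_scale c \<omega> \<in> closed_states wt n"
  using assms(2)
proof induction
  case zero
  then show ?case by (simp add: form_scale_def closed_states.zero)
next
  case (add \<omega> \<eta>)
  then show ?case by (simp add: form_scale_def ring_distribs closed_states.add)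
next
  case (monomial f w fs ws)
  then have "of_fn (of_complex c * f) * prod_list (map dform fs) \<in> closed_states wt n"
    by (intro closed_states.monomial wt_scale)
  then show ?case by (simp add: form_scale_def of_fn_mult mult.assoc)
qed

lemma sources_merge: "Suc i < length w \<Longrightarrow> src ` set (merge_at i w) \<subseteq> src ` set w"
  by (auto simp: merge_at_def dest: in_set_takeD in_set_dropD)

lemma sources_wrap: "length w = Suc k \<Longrightarrow> src ` set (wrap w) \<subseteq> src ` set w"
proof -
  assume "length w = Suc k"
  then have "w ! k \<in> set w" by simp
  moreover have "set (butlast (tl w)) \<subseteq> set w" by (cases w) (auto dest: in_set_butlastD)
  ultimately show ?thesis using \<open>length w = Suc k\<close> by (auto simp: wrap_def Let_def)
qed

lemma sources_set_mor: "p < length w \<Longrightarrow> src ` set (set_mor p n f w) \<subseteq> src ` set w"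
  by (auto simp: set_mor_def dest!: set_update_subset_insert[THEN subsetD])

section \<open>The chain map on classes\<close>

context brane_category
begin

lemma sources: "w \<in> Words \<Longrightarrow> finite (src ` set w) \<and> src ` set w \<subseteq> Br"
  using words_nth(1)[of w] by (auto simp: in_set_conv_nth)

text \<open>No term of the differential involves a brane that does not occur in \<open>w\<close>. So
  all values are taken with the set of sources of \<open>w\<close>, and the identity becomes
  \<open>val_differential\<close>.\<close>

lemma word_value_differential:
  assumes w: "w \<in> Words"
  shows "lin word_value (hoch_d2 w + hoch_d1 sc w) = dform W * word_value w"
proof -
  define S where "S = src ` set w"
  have S: "finite S" "S \<subseteq> Br" "src ` set w \<subseteq> S" using sources[OF w] by (simp_all add: S_def)
  interpret matrix_factorization par E D0 W "index_set S" "Suc CARD('n)"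
    by (rule matrix_factorization[OF S(1,2)])
  have val: "word_value v = val (mats v)" if "v \<in> Words" "src ` set v \<subseteq> S" for v
    using val_word_value[OF that(1) S(1,2) that(2)] by simp
  have "length (mats w) \<noteq> 0" using w by (simp add: words_def)
  then have ne: "mats w \<noteq> []" by blast
  have deg: "snd (mats w ! j) = deg (w ! j)" if "j < length w" for j
    using that by (simp add: mats_nth mat_of_def arrow_data_def)
  have len: "0 < length w" using w by (simp add: words_def)
  have merge: "word_value (merge_at i w) = val (take i (mats w) @ (fst (mats w ! i) * fst (mats w ! Suc i),
      snd (mats w ! i) + snd (mats w ! Suc i)) # drop (i + 2) (mats w))" if "Suc i < length w" for i
    using val[OF merge_words(1)[OF w that]] sources_merge[OF that] unfolding merge_words(2)[OF w that] S_def by blast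
  have wrap: "word_value (wrap w) = val ((fst (mats w ! (length w - 1)) * fst (mats w ! 0),
      snd (mats w ! (length w - 1)) + snd (mats w ! 0)) # butlast (tl (mats w)))" if "length w - 1 \<noteq> 0"
  proof -
    have k: "length w = Suc (length w - 1)" "length w - 1 > 0" using that by auto
    show ?thesis
      using val[OF wrap_words(1)[OF w k]] sources_wrap[OF k(1)] unfolding wrap_words(2)[OF w k] S_def by blast
  qed
  have delta: "word_value (set_mor i (deg (w ! i) + 1)
      (brane_delta sc (src (w ! i)) (tgt w i) (deg (w ! i)) (mor (w ! i))) w) =
    val ((mats w)[i := (delta (fst (mats w ! i)) (snd (mats w ! i)), snd (mats w ! i) + 1)])" if "i < length w" for i
    using val[OF set_mor_words(1)[OF w that brane_delta_hom[OF words_nth[OF w that]]]] sources_set_mor[OF that]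
    unfolding set_mor_words(2)[OF w that brane_delta_hom[OF words_nth[OF w that]]] set_mor_delta[OF w that S(1,2)] S_def
    by blast
  have good: "good y" if "y \<in> set (mats w)" for y
    by (rule mats_good[OF w S(3,1,2) that])
  have "dform W * word_value w =
    (\<Sum>i<length w - 1. sign ((\<Sum>j\<le>i. snd (mats w ! j)) + int i + 1) * word_value (merge_at i w)) +
    (if length w - 1 = 0 then 0 else
      sign (((\<Sum>j<length w - 1. snd (mats w ! j)) + int (length w - 1) + 1) * (snd (mats w ! (length w - 1)) + 1)) *
       word_value (wrap w)) +
    (\<Sum>i<length w. sign ((\<Sum>j<i. snd (mats w ! j)) + int i) * word_value (set_mor i (deg (w ! i) + 1)
      (brane_delta sc (src (w ! i)) (tgt w i) (deg (w ! i)) (mor (w ! i))) w))"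
    unfolding val[OF w S(3)]
    by (subst val_differential[OF ne good], assumption, unfold length_mats)
     (intro arg_cong2[of _ _ _ _ "(+)"] sum.cong if_cong HOL.refl; simp add: merge wrap delta)
  also have "\<dots> = lin word_value (hoch_d2 w + hoch_d1 sc w)"
    unfolding hoch_d2_eq hoch_d1_eq lin_add lin_sum if_distrib[of "lin word_value"] lin_scale lin_tens lin_0 form_scale_sign
    using len by (intro arg_cong2[of _ _ _ _ "(+)"] sum.cong if_cong arg_cong2[of _ _ _ _ "(*)"] arg_cong[of _ _ sign] HOL.refl)
      (auto simp: deg)
  finally show ?thesis by simp
qed

lemma mor_mat_add:
  assumes "B \<in> Br" "C \<in> Br" "f \<in> hom B C n" "g \<in> hom B C n"
  shows "mor_mat (R B) (R C) (\<lambda>x. f x + g x) = mor_mat (R B) (R C) f + mor_mat (R B) (R C) g"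
  using graded_hom_module[OF assms(3) brane_closed[OF assms(2)] proj_unit_row[OF assms(1)]]
    graded_hom_module[OF assms(4) brane_closed[OF assms(2)] proj_unit_row[OF assms(1)]]
    graded_hom_add[OF realization(1)[OF assms(2)]]
  by (intro eq_matI) (auto simp: mor_mat_def)

lemma mor_mat_scale:
  assumes "B \<in> Br" "C \<in> Br" "f \<in> hom B C n"
  shows "mor_mat (R B) (R C) (\<lambda>x. sc a (f x)) = a \<cdot>\<^sub>m mor_mat (R B) (R C) f"
  using graded_hom_module[OF assms(3) brane_closed[OF assms(2)] proj_unit_row[OF assms(1)]]
    graded_hom_scale[OF realization(1)[OF assms(2)]]
  by (intro eq_matI) (auto simp: mor_mat_def vec_scale_def)

lemma word_value_multilinear:
  assumes w: "w \<in> Words" and p: "p < length w"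
    and f: "f \<in> hom (src (w ! p)) (tgt w p) n"
  shows "g \<in> hom (src (w ! p)) (tgt w p) n \<Longrightarrow> word_value (set_mor p n (\<lambda>x. f x + g x) w) =
      word_value (set_mor p n f w) + word_value (set_mor p n g w)"
    and "word_value (set_mor p n (\<lambda>x. sc (of_complex c) (f x)) w) = form_scale c (word_value (set_mor p n f w))"
proof -
  define S where "S = src ` set w"
  have S: "finite S" "S \<subseteq> Br" using sources[OF w] by (simp_all add: S_def)
  interpret matrix_factorization par E D0 W "index_set S" "Suc CARD('n)"
    by (rule matrix_factorization[OF S(1,2)])
  let ?B = "src (w ! p)" and ?C = "tgt w p"
  note BC = words_nth(1,2)[OF w p]
  have val: "word_value (set_mor p n h w) = val ((mats w)[p := (blk ?B ?C (mor_mat (R ?B) (R ?C) h), n)])"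
    if "h \<in> hom ?B ?C n" for h
    using val_word_value[OF set_mor_words(1)[OF w p that] S] sources_set_mor[OF p]
    unfolding set_mor_words(2)[OF w p that] S_def by (simp add: mat_of_def)
  have len: "p < length (mats w)" using p by simp
  show "word_value (set_mor p n (\<lambda>x. f x + g x) w) =
      word_value (set_mor p n f w) + word_value (set_mor p n g w)"
    if g: "g \<in> hom (src (w ! p)) (tgt w p) n"
    unfolding val[OF hom_add[OF BC(2) f g]] val[OF f] val[OF g]
    by (simp add: mor_mat_add[OF BC f g] blk_add val_update_add[OF len])
  have "blk B C (a \<cdot>\<^sub>m M) = diag (\<lambda>_. a) * blk B C M" for B C :: "'m brane" and a and M :: "'a mat"
    by (rule rfm_eqI) (auto simp: ent_blk)
  then show "word_value (set_mor p n (\<lambda>x. sc (of_complex c) (f x)) w) = form_scale c (word_value (set_mor p n f w))"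
    unfolding val[OF hom_scale[OF BC(2) f]] val[OF f]
    by (simp add: mor_mat_scale[OF BC f] val_update_scale[OF len])
qed

text \<open>The generators are restated with \<open>set_mor\<close> at a position of a word, the
  form in which the operations on words are known to be linear.\<close>

lemma rel_induct [consumes 1, case_names zero add scale additive homogeneous]:
  assumes "x \<in> rel"
    and "P 0" "\<And>x y. P x \<Longrightarrow> P y \<Longrightarrow> P (x + y)" "\<And>c x. P x \<Longrightarrow> P (chain_scale c x)"
    and additive: "\<And>w p f g. w \<in> Words \<Longrightarrow> p < length w \<Longrightarrow>
      f \<in> hom (src (w ! p)) (tgt w p) (deg (w ! p)) \<Longrightarrow> g \<in> hom (src (w ! p)) (tgt w p) (deg (w ! p)) \<Longrightarrow>
      P (tens (set_mor p (deg (w ! p)) (\<lambda>x. f x + g x) w) - tens (set_mor p (deg (w ! p)) f w) -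
        tens (set_mor p (deg (w ! p)) g w))"
    and homogeneous: "\<And>w p f c. w \<in> Words \<Longrightarrow> p < length w \<Longrightarrow>
      f \<in> hom (src (w ! p)) (tgt w p) (deg (w ! p)) \<Longrightarrow>
      P (tens (set_mor p (deg (w ! p)) (\<lambda>x. sc (of_complex c) (f x)) w) -
        chain_scale c (tens (set_mor p (deg (w ! p)) f w)))"
  shows "P x"
  using assms(1)
proof induction
  case (additive u a n f v g)
  let ?w = "u @ Arrow a n f # v" and ?p = "length u"
  have s: "set_mor ?p n h ?w = u @ Arrow a n h # v" for h by (simp add: set_mor_def)
  have p: "?p < length ?w" "deg (?w ! ?p) = n" by simp_all
  show ?case
    using assms(5)[OF additive(1) p(1), unfolded p(2), OF set_mor_hom set_mor_hom, of f g] additive p(1)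
    by (simp only: s)
next
  case (homogeneous u a n f v c)
  let ?w = "u @ Arrow a n f # v" and ?p = "length u"
  have s: "set_mor ?p n h ?w = u @ Arrow a n h # v" for h by (simp add: set_mor_def)
  have p: "?p < length ?w" "deg (?w ! ?p) = n" by simp_all
  show ?case
    using assms(6)[OF homogeneous p(1), unfolded p(2), OF set_mor_hom, of f c] homogeneous p(1)
    by (simp only: s)
qed (use assms in auto)

lemma chain_d_rel: "x \<in> rel \<Longrightarrow> chain_d sc x \<in> rel"
proof (induction rule: rel_induct)
  case zero
  then show ?case by (simp add: chain_d_def multilinear_rel.zero)
next
  case (additive w p f g)
  from differential_defect[OF additive, of undefined] show ?case
    by (simp add: chain_d_minus chain_d_tens defect_def)
next
  case (homogeneous w p f c)
  from differential_defect[OF homogeneous homogeneous(3), of c] show ?case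
    by (simp add: chain_d_minus chain_d_scale chain_d_tens defect_def)
qed (simp_all add: chain_d_add chain_d_scale multilinear_rel.add multilinear_rel.scale)

lemma lin_rel: "x \<in> rel \<Longrightarrow> lin word_value x = 0"
proof (induction rule: rel_induct)
  case (additive w p f g)
  then show ?case by (simp add: lin_minus lin_tens word_value_multilinear)
next
  case (homogeneous w p f c)
  then show ?case by (simp add: lin_minus lin_scale lin_tens word_value_multilinear)
qed (simp_all add: lin_add lin_scale form_scale_def)

lemma chain_d_Hchains:
  assumes "x \<in> Hchains"
  shows "chain_d sc x \<in> Hchains" and "lin word_value (chain_d sc x) = dform W * lin word_value x"
proof -
  have w: "w \<in> Words" if "w \<in> Poly_Mapping.keys x" for w using assms that by (auto simp: hchains_def)
  have "hoch_d2 w + hoch_d1 sc w \<in> Hchains" if w: "w \<in> Words" for w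
  proof -
    have "chain_scale c (tens (merge_at i w)) \<in> Hchains" if "i \<in> {..<length w - 1}" for c i
      using that by (intro Hchains_scale Hchains_tens merge_words(1)[OF w]) auto
    moreover have "chain_scale c (tens (wrap w)) \<in> Hchains" if "length w - 1 \<noteq> 0" for c
      using that by (intro Hchains_scale Hchains_tens wrap_words(1)[OF w, of "length w - 1"]) auto
    moreover have "chain_scale c (tens (set_mor i (deg (w ! i) + 1)
        (brane_delta sc (src (w ! i)) (tgt w i) (deg (w ! i)) (mor (w ! i))) w)) \<in> Hchains"
      if "i \<in> {..<length w}" for c i
    proof -
      have i: "i < length w" using that by simp
      show ?thesis
        by (intro Hchains_scale Hchains_tens set_mor_words(1)[OF w i] brane_delta_hom[OF words_nth[OF w i]])
    qed
    ultimately show ?thesis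
      unfolding hoch_d2_eq hoch_d1_eq by (intro Hchains_add Hchains_sum) (simp_all add: Hchains_0)
  qed
  then show "chain_d sc x \<in> Hchains"
    unfolding chain_d_def by (intro Hchains_sum Hchains_scale) (use w in auto)
  show "lin word_value (chain_d sc x) = dform W * lin word_value x"
    unfolding chain_d_def lin_sum lin_scale lin_def[of word_value x] sum_distrib_left form_scale_mult_right
    by (intro sum.cong HOL.refl arg_cong[of _ _ "form_scale _"] word_value_differential w)
qed

definition trace_map :: "'m hchain set \<Rightarrow> 'a forms" where
  "trace_map C = lin word_value (SOME x. x \<in> C)"

lemma hoch_class_eq:
  assumes "x \<in> Hchains" "y \<in> Hchains" "x - y \<in> rel"
  shows "hoch_class wt sc W x = hoch_class wt sc W y"
proof -
  have "x - z \<in> rel \<longleftrightarrow> y - z \<in> rel" for z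
    using rel_minus[OF _ assms(3), of "x - z"] multilinear_rel.add[OF _ assms(3), of "y - z"] by auto
  then show ?thesis using assms(1,2) by (auto simp: hoch_class_def hoch_rel_def)
qed

lemma mem_hoch_class: "y \<in> hoch_class wt sc W x \<longleftrightarrow> x \<in> Hchains \<and> y \<in> Hchains \<and> x - y \<in> rel"
  by (auto simp: hoch_class_def hoch_rel_def)

lemma trace_map_class:
  assumes "x \<in> Hchains"
  shows "trace_map (hoch_class wt sc W x) = lin word_value x"
proof -
  have "x \<in> hoch_class wt sc W x" by (simp add: mem_hoch_class assms multilinear_rel.zero)
  then have "(SOME y. y \<in> hoch_class wt sc W x) \<in> hoch_class wt sc W x" by (rule someI)
  then have "lin word_value (x - (SOME y. y \<in> hoch_class wt sc W x)) = 0"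
    unfolding mem_hoch_class[of "SOME y. y \<in> hoch_class wt sc W x"] by (intro lin_rel) blast
  then show ?thesis unfolding trace_map_def lin_minus by simp
qed

text \<open>The differential of a class is a union over all representatives; since the differential
  maps relations to relations, all of them contribute the same class.\<close>

lemma hoch_d_class:
  assumes "x \<in> Hchains"
  shows "hoch_d wt sc W (hoch_class wt sc W x) = hoch_class wt sc W (chain_d sc x)"
proof -
  have "hoch_class wt sc W (chain_d sc y) = hoch_class wt sc W (chain_d sc x)" if "y \<in> hoch_class wt sc W x" for y
    using that chain_d_rel[of "x - y"] chain_d_Hchains(1)
    by (intro hoch_class_eq[symmetric]) (auto simp: mem_hoch_class chain_d_minus)
  moreover have "x \<in> hoch_class wt sc W x" by (simp add: mem_hoch_class assms multilinear_rel.zero)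
  ultimately show ?thesis unfolding hoch_d_def by blast
qed

lemma hoch_chain_map_trace: "hoch_chain_map wt sc W trace_map"
  unfolding hoch_chain_map_def
proof (intro conjI ballI allI)
  fix x y assume "x \<in> Hchains" "y \<in> Hchains"
  then show "trace_map (hoch_class wt sc W (x + y)) = trace_map (hoch_class wt sc W x) + trace_map (hoch_class wt sc W y)"
    by (simp add: trace_map_class Hchains_add lin_add)
next
  fix c x assume "x \<in> Hchains"
  then show "trace_map (hoch_class wt sc W (chain_scale c x)) = form_scale c (trace_map (hoch_class wt sc W x))"
    by (simp add: trace_map_class Hchains_scale lin_scale)
next
  fix n x assume x: "x \<in> hchains_deg wt sc W n"
  then have "x \<in> Hchains" by (simp add: hchains_deg_def)
  moreover have "form_scale (Poly_Mapping.lookup x w) (word_value w) \<in> closed_states wt n"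
    if "w \<in> Poly_Mapping.keys x" for w
  proof -
    have w: "w \<in> Words" "sum_list (map deg w) - (int (length w) - 1) = n"
      using x that by (auto simp: hchains_deg_def hchains_def)
    show ?thesis
      unfolding word_value_def
      by (intro closed_states_scale closed_states_sum wt_scale) (use composite_term_closed_states[OF w(1)] w(2) in auto)
  qed
  ultimately show "trace_map (hoch_class wt sc W x) \<in> closed_states wt n"
    by (simp add: trace_map_class lin_def closed_states_sum)
next
  fix C assume "C \<in> hochschild wt sc W"
  then obtain x where x: "x \<in> Hchains" "C = hoch_class wt sc W x"
    by (auto simp: hochschild_def hoch_class_def elim: quotientE)
  show "hoch_d wt sc W C \<in> hochschild wt sc W"
    unfolding x(2) hoch_d_class[OF x(1)] using chain_d_Hchains(1)[OF x(1)]
    by (simp add: hochschild_def hoch_class_def quotientI)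
  show "trace_map (hoch_d wt sc W C) = dform W * trace_map C"
    unfolding x(2) hoch_d_class[OF x(1)] by (simp add: trace_map_class x(1) chain_d_Hchains)
qed

lemma trace_map_tens:
  "w \<in> Words \<Longrightarrow> trace_map (hoch_class wt sc W (tens w)) = word_value w"
  by (simp add: trace_map_class Hchains_tens lin_tens)

end

section \<open>Existence of realizations\<close>

lemma vec_scale_diff: "vec_scale a (u - v) = vec_scale a u - vec_scale a v"
  by (auto simp: vec_scale_def fun_diff_def ring_distribs)

lemma vec_scale_0: "vec_scale a 0 = 0"
  by (simp add: vec_scale_def zero_fun_def)

lemma vec_scale_mult: "vec_scale a (vec_scale b v) = vec_scale (a * b) v"
  by (simp add: vec_scale_def mult.assoc)

text \<open>A pair of vectors of length \<open>r\<close> as one vector of length \<open>2 r\<close>.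
  A vector of length \<open>r\<close> is padded by zeros, so it literally equals its join with
  0.\<close>

definition join :: "nat \<Rightarrow> (nat \<Rightarrow> 'a::comm_ring_1) \<Rightarrow> (nat \<Rightarrow> 'a) \<Rightarrow> nat \<Rightarrow> 'a" where
  "join r a b = (\<lambda>j. if j < r then a j else if j < r + r then b (j - r) else 0)"

definition lower :: "nat \<Rightarrow> (nat \<Rightarrow> 'a::comm_ring_1) \<Rightarrow> nat \<Rightarrow> 'a" where
  "lower r v = (\<lambda>j. if j < r then v j else 0)"

definition upper :: "nat \<Rightarrow> (nat \<Rightarrow> 'a::comm_ring_1) \<Rightarrow> nat \<Rightarrow> 'a" where
  "upper r v = (\<lambda>j. if j < r then v (j + r) else 0)"

lemma join_linear:
  "join r (a + a') (b + b') = join r a b + join r a' b'"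
  "join r (vec_scale x a) (vec_scale x b) = vec_scale x (join r a b)"
  "join r 0 0 = 0"
  by (auto simp: join_def vec_scale_def plus_fun_def zero_fun_def)

lemma lower_linear:
  "lower r (a + b) = lower r a + lower r b" "lower r (vec_scale x a) = vec_scale x (lower r a)" "lower r 0 = 0"
  by (auto simp: lower_def vec_scale_def plus_fun_def zero_fun_def)

lemma upper_linear:
  "upper r (a + b) = upper r a + upper r b" "upper r (vec_scale x a) = vec_scale x (upper r a)" "upper r 0 = 0"
  by (auto simp: upper_def vec_scale_def plus_fun_def zero_fun_def)

lemma lower_join: "(\<And>j. j \<ge> r \<Longrightarrow> a j = 0) \<Longrightarrow> lower r (join r a b) = a"
  by (auto simp: lower_def join_def)

lemma upper_join: "(\<And>j. j \<ge> r \<Longrightarrow> b j = 0) \<Longrightarrow> upper r (join r a b) = b"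
  by (auto simp: upper_def join_def)

section \<open>Doubling a free module\<close>

context affine_LG_model
begin

text \<open>The shifts of \<open>F \<oplus> F[1]\<close>: a vector in degree \<open>i\<close> has
  its second half in degree \<open>i + 1\<close> of \<open>F\<close>.\<close>

abbreviation shift_join :: "nat \<Rightarrow> (nat \<Rightarrow> int) \<Rightarrow> nat \<Rightarrow> int" where
  "shift_join r \<sigma> \<equiv> \<lambda>j. if j < r then \<sigma> j else \<sigma> (j - r) + 1"

lemma join_piece:
  assumes "a \<in> free_module wt r \<sigma> i" "b \<in> free_module wt r \<sigma> (i + 1)"
  shows "join r a b \<in> free_module wt (r + r) (shift_join r \<sigma>) i"
  unfolding free_module_def
proof (intro CollectI conjI allI impI)
  fix j assume "j < r + r"
  then show "wt (join r a b j) (i + shift_join r \<sigma> j)"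
    using assms by (auto simp: free_module_def join_def algebra_simps)
qed (auto simp: join_def)

lemma lower_piece:
  assumes "v \<in> free_module wt (r + r) (shift_join r \<sigma>) i"
  shows "lower r v \<in> free_module wt r \<sigma> i"
  unfolding free_module_def
proof (intro CollectI conjI allI impI)
  fix j assume j: "j < r"
  then have "j < r + r" by simp
  then have "wt (v j) (i + shift_join r \<sigma> j)" using assms unfolding free_module_def by blast
  then show "wt (lower r v j) (i + \<sigma> j)" using j by (simp add: lower_def)
qed (auto simp: lower_def)

lemma upper_piece:
  assumes "v \<in> free_module wt (r + r) (shift_join r \<sigma>) i"
  shows "upper r v \<in> free_module wt r \<sigma> (i + 1)"
  unfolding free_module_def
proof (intro CollectI conjI allI impI)
  fix j assume j: "j < r"
  then have "j + r < r + r" by simp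
  then have "wt (v (j + r)) (i + shift_join r \<sigma> (j + r))"
    using assms unfolding free_module_def by blast
  then show "wt (upper r v j) (i + 1 + \<sigma> j)" using j by (simp add: upper_def algebra_simps)
qed (auto simp: upper_def)

lemma lower_upper_module:
  assumes "v \<in> module_of (free_module wt (r + r) (shift_join r \<sigma>))"
  shows "lower r v \<in> module_of (free_module wt r \<sigma>) \<and> upper r v \<in> module_of (free_module wt r \<sigma>)"
  using assms
proof (induction rule: module_of_induct)
  case (add x y i)
  have "lower r x \<in> module_of (free_module wt r \<sigma>)" "upper r x \<in> module_of (free_module wt r \<sigma>)"
    by (rule module_of_piece, rule lower_piece[OF add(1)]) (rule module_of_piece, rule upper_piece[OF add(1)])
  then show ?case
    unfolding lower_linear upper_linear using add(3) by (blast intro: module_of_add[OF free_closed])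
qed (unfold lower_linear upper_linear, blast intro: module_of_0)

lemma free_module_support: "v \<in> module_of (free_module wt r \<sigma>) \<Longrightarrow> j \<ge> r \<Longrightarrow> v j = 0"
  by (induction rule: module_of_induct) (auto simp: free_module_def)

text \<open>If \<open>M\<close> is a summand of the free module \<open>F\<close> and \<open>q\<close> is the projection of \<open>F\<close> onto the
  complement, then adding to \<open>M\<close> the matrix factorization \<open>(1, W)\<close> of the complement
  gives a brane on \<open>F \<oplus> F[1]\<close>.\<close>

theorem realization_exists:
  fixes sc :: "'a \<Rightarrow> 'm::ab_group_add \<Rightarrow> 'm"
  assumes B: "B \<in> branes wt sc W"
  shows "\<exists>\<rho>. realizes wt sc W \<rho> B"
proof -
  let ?M = "piece B"
  have gm: "graded_module wt sc ?M" and d: "dif B \<in> graded_hom sc sc ?M ?M 1"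
    and dd: "\<And>x. x \<in> module_of ?M \<Longrightarrow> dif B (dif B x) = sc W x"
    using B by (auto simp: branes_def fg_projective_def)
  have M: "pieces_closed ?M" using gm by (simp add: graded_module_def pieces_closed_def)
  obtain r \<sigma> \<iota> \<pi> where i: "\<iota> \<in> graded_hom sc vec_scale ?M (free_module wt r \<sigma>) 0"
    and p: "\<pi> \<in> graded_hom vec_scale sc (free_module wt r \<sigma>) ?M 0"
    and pi: "\<And>x. x \<in> module_of ?M \<Longrightarrow> \<pi> (\<iota> x) = x"
    using B by (auto simp: branes_def fg_projective_def)
  define F where "F = free_module wt r \<sigma>"
  define G where "G = free_module wt (r + r) (shift_join r \<sigma>)"
  have F: "pieces_closed F" and G: "pieces_closed G" by (simp_all add: F_def G_def free_closed)
  note i = i[folded F_def] and p = p[folded F_def]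
  have lowG: "lower r v \<in> module_of F" "upper r v \<in> module_of F" if "v \<in> module_of G" for v
    using that by (simp_all add: F_def G_def lower_upper_module)
  have scaleF: "vec_scale a v \<in> module_of F" if "v \<in> module_of F" for a v
    using that by (simp add: F_def module_of_free_scale)
  have scaleG: "vec_scale a v \<in> module_of G" if "v \<in> module_of G" for a v
    using that by (simp add: G_def module_of_free_scale)
  note addF = module_of_add[OF F] and addG = module_of_add[OF G]
  have minusF: "x - y \<in> module_of F" if "x \<in> module_of F" "y \<in> module_of F" for x y
  proof -
    have "x + vec_scale (- 1) y \<in> module_of F" by (intro addF that scaleF)
    then show ?thesis by (simp add: vec_scale_def plus_fun_def fun_diff_def)
  qed
  have joinG: "join r a b \<in> G n" if "a \<in> F n" "b \<in> F (n + 1)" for a b n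
    using that by (simp add: F_def G_def join_piece)
  have join0: "join r a 0 = a" if "a \<in> module_of F" for a
    using free_module_support[of a r \<sigma>] that by (auto simp: F_def join_def fun_eq_iff)
  have lj: "lower r (join r a b) = a" if "a \<in> module_of F" for a b
    using free_module_support[of a r \<sigma>] that by (intro lower_join) (auto simp: F_def)
  have uj: "upper r (join r a b) = b" if "b \<in> module_of F" for a b
    using free_module_support[of b r \<sigma>] that by (intro upper_join) (auto simp: F_def)

  \<comment> \<open>\<open>h\<close> is the differential extended by zero and squares to
    \<open>W\<close> times the idempotent \<open>e\<close>. What is lacking is \<open>W\<close>
    times the complementary idempotent \<open>q\<close>.\<close>
  define h where "h = \<iota> \<circ> (dif B \<circ> \<pi>)"
  define e where "e = \<iota> \<circ> \<pi>"
  define q where "q v = v - e v" for v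
  have h: "h \<in> graded_hom vec_scale vec_scale F F 1"
    using graded_hom_comp[OF graded_hom_comp[OF p d M] i M] by (simp add: h_def)
  have e: "e \<in> graded_hom vec_scale vec_scale F F 0"
    using graded_hom_comp[OF p i M] by (simp add: e_def)
  note hF = graded_hom_module[OF h F] and eF = graded_hom_module[OF e F] and pM = graded_hom_module[OF p M]
    and iF = graded_hom_module[OF i F] and dM = graded_hom_module[OF d M]
  have qF: "q v \<in> module_of F" if "v \<in> module_of F" for v
    unfolding q_def by (intro minusF eF that)
  have q_add: "q (x + y) = q x + q y" if "x \<in> module_of F" "y \<in> module_of F" for x y
    using that by (simp add: q_def graded_hom_add[OF e])
  have q_scale: "q (vec_scale a x) = vec_scale a (q x)" if "x \<in> module_of F" for a x
    using that by (simp add: q_def graded_hom_scale[OF e] vec_scale_diff)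
  have q_piece: "q x \<in> F n" if "x \<in> F n" for x n
    using graded_hom_piece[OF e that] that F by (simp add: q_def pieces_closed_def)
  have ee: "e (e v) = e v" if "v \<in> module_of F" for v using that by (simp add: e_def pi pM)
  have e_minus: "e (x - y) = e x - e y" if "x \<in> module_of F" "y \<in> module_of F" for x y
    using graded_hom_add[OF e minusF[OF that] that(2)] by simp
  have eh: "e (h v) = h v" if "v \<in> module_of F" for v using that by (simp add: e_def h_def pi pM dM)
  have he: "h (e v) = h v" if "v \<in> module_of F" for v using that by (simp add: e_def h_def pi pM)
  have h_minus: "h (x - y) = h x - h y" if "x \<in> module_of F" "y \<in> module_of F" for x y
    using graded_hom_add[OF h minusF[OF that] that(2)] by simp
  have qh: "q (h v) = 0" if "v \<in> module_of F" for v using that by (simp add: q_def eh)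
  have hq: "h (q v) = 0" if "v \<in> module_of F" for v using that by (simp add: q_def h_minus eF he)
  have qq: "q (q v) = q v" if "v \<in> module_of F" for v using that by (simp add: q_def e_minus eF ee)
  have hh: "h (h v) = vec_scale W (e v)" if "v \<in> module_of F" for v
    using that by (simp add: h_def e_def pi pM dM dd graded_hom_scale[OF i])
  have pq: "\<pi> (q v) = 0" if "v \<in> module_of F" for v
    using that graded_hom_add[OF p minusF[OF that eF[OF that]] eF[OF that]] by (simp add: q_def e_def pi pM)
  have ph: "\<pi> (h v) = dif B (\<pi> v)" if "v \<in> module_of F" for v using that by (simp add: h_def pi pM dM)

  define b where "b v = (if v \<in> module_of G then
    join r (h (lower r v) + q (upper r v)) (vec_scale W (q (lower r v)) + h (upper r v)) else 0)" for v
  have b: "b \<in> graded_hom vec_scale vec_scale G G 1"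
    unfolding graded_hom_def
  proof (intro CollectI conjI ballI allI impI)
    fix x y assume xy: "x \<in> module_of G" "y \<in> module_of G"
    show "b (x + y) = b x + b y"
      using xy by (simp add: b_def addG lower_linear upper_linear lowG q_add graded_hom_add[OF h] vec_scale_add
          flip: join_linear(1)) (simp add: add_ac)
  next
    fix a x assume x: "x \<in> module_of G"
    show "b (vec_scale a x) = vec_scale a (b x)"
      using x by (simp add: b_def scaleG lower_linear upper_linear lowG q_scale graded_hom_scale[OF h]
          vec_scale_add vec_scale_mult mult.commute flip: join_linear(2))
  next
    fix n x assume x: "x \<in> G n"
    then have l: "lower r x \<in> F n" "upper r x \<in> F (n + 1)"
      by (simp_all add: F_def G_def lower_piece upper_piece)
    have W: "vec_scale W v \<in> F (k + 2)" if "v \<in> F k" for v k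
      using free_scale_homogeneous[OF _ W_weight] that by (simp add: F_def)
    have "h (lower r x) + q (upper r x) \<in> F (n + 1)"
      by (intro pieces_closed_add[OF F] graded_hom_piece[OF h] q_piece l)
    moreover have "vec_scale W (q (lower r x)) + h (upper r x) \<in> F (n + 1 + 1)"
      using W[OF q_piece[OF l(1)]] graded_hom_piece[OF h l(2)]
      by (intro pieces_closed_add[OF F]) (simp_all add: add.assoc)
    ultimately show "b x \<in> G (n + 1)"
      using module_of_piece[of x G, OF x] by (simp add: b_def joinG)
  qed (simp add: b_def)
  define P where "P v = (if v \<in> module_of G then \<pi> (lower r v) else 0)" for v
  have lb: "lower r (b v) = h (lower r v) + q (upper r v)"
    and ub: "upper r (b v) = vec_scale W (q (lower r v)) + h (upper r v)" if "v \<in> module_of G" for v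
    using that by (simp_all add: b_def lj uj addF hF qF lowG scaleF)
  have "realizes wt sc W \<lparr>rank = r + r, shift = shift_join r \<sigma>, incl = \<iota>, proj = P, bigD = b\<rparr> B"
    unfolding realizes_def Let_def realization.simps G_def[symmetric]
  proof (intro conjI ballI b)
    \<comment> \<open>Vectors of \<open>F\<close> are padded by zeros, so \<open>F\<close> is a
      subset of the doubled module and the inclusion of the brane can stay the same
      function.\<close>
    have sub: "v \<in> G n" if "v \<in> F n" for v n
      using joinG[OF that, of 0] join0[OF module_of_piece[of v F, OF that]] F by (simp add: pieces_closed_def)
    show "\<iota> \<in> graded_hom sc vec_scale ?M G 0"
      using i sub by (auto simp: graded_hom_def)
    have FG: "v \<in> module_of G" if "v \<in> module_of F" for v
      using that sub unfolding module_of_def by blast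
    show "P \<in> graded_hom vec_scale sc G ?M 0"
      unfolding graded_hom_def
    proof (intro CollectI conjI ballI allI impI)
      fix n x assume x: "x \<in> G n"
      then have "lower r x \<in> F n" by (simp add: F_def G_def lower_piece)
      then show "P x \<in> ?M (n + 0)" using graded_hom_piece[OF p] module_of_piece[of x G, OF x] by (simp add: P_def)
    qed (simp_all add: P_def addG scaleG lower_linear lowG graded_hom_add[OF p] graded_hom_scale[OF p])
    have li: "lower r (\<iota> x) = \<iota> x" "upper r (\<iota> x) = 0" if "x \<in> module_of ?M" for x
      using lj[OF iF[OF that], of 0] uj[OF module_of_0, of "\<iota> x"] unfolding join0[OF iF[OF that]] .
    show "P (\<iota> x) = x" if "x \<in> module_of ?M" for x
      using that by (simp add: P_def FG iF li pi)
    show "b (b v) = vec_scale W v" if v: "v \<in> module_of G" for v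
    proof -
      have bv: "b v \<in> module_of G" using graded_hom_module[OF b G v] .
      have "v = join r (lower r v) (upper r v)"
        using free_module_support[of v "r + r"] v by (auto simp: G_def join_def lower_def upper_def fun_eq_iff)
      moreover have "b (b v) = join r (vec_scale W (lower r v)) (vec_scale W (upper r v))"
      proof -
        have 1: "vec_scale W (e x) + vec_scale W (q x) = vec_scale W x" for x
          by (simp add: q_def flip: vec_scale_add)
        have "h (lower r (b v)) + q (upper r (b v)) = vec_scale W (lower r v)"
          using v by (simp add: lb ub lowG hF qF scaleF graded_hom_add[OF h] q_add q_scale hh hq qh qq 1)
        moreover have "vec_scale W (q (lower r (b v))) + h (upper r (b v)) = vec_scale W (upper r v)"
          using v 1[of "upper r v"] by (simp add: lb ub lowG hF qF scaleF graded_hom_add[OF h] graded_hom_scale[OF h] q_add hh hq qh qq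
             vec_scale_add vec_scale_0 add.commute)
        ultimately show ?thesis using bv by (simp add: b_def)
      qed
      ultimately show ?thesis by (simp add: join_linear(2))
    qed
    show "b (\<iota> x) = \<iota> (dif B x)" if x: "x \<in> module_of ?M" for x
    proof -
      have "h (\<iota> x) = \<iota> (dif B x)" "q (\<iota> x) = 0" using x by (simp_all add: h_def q_def e_def pi)
      moreover have "q 0 = 0" "h 0 = 0" using graded_hom_0[OF e] graded_hom_0[OF h] by (simp_all add: q_def)
      ultimately show ?thesis using x by (simp add: b_def FG iF li join0 dM iF vec_scale_0)
    qed
    show "P (b v) = dif B (P v)" if v: "v \<in> module_of G" for v
      using v graded_hom_module[OF b G v] by (simp add: P_def lb lowG hF qF graded_hom_add[OF p] ph pq)
  qed
  then show ?thesis by blast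
qed

end

text \<open>The first conjunct ensures that the second is not vacuous: by choice there is a function
  \<open>R\<close> that realizes every brane. The map \<open>\<Phi>\<close> is obtained for each
  such \<open>R\<close>.\<close>

theorem mainTheorem3:
  fixes X :: "(complex^'n) set"
    and ev :: "'a::complex_comm_algebra \<Rightarrow> complex^'n \<Rightarrow> complex"
    and act :: "complex \<Rightarrow> complex^'n \<Rightarrow> complex^'n"
    and W :: 'a
    and wt :: "'a \<Rightarrow> int \<Rightarrow> bool"
    and sc :: "'a \<Rightarrow> 'm::ab_group_add \<Rightarrow> 'm"
  assumes "affine_LG_model X ev act W"
    and "wt = has_weight X ev act"
    and "Modules.module sc"
  shows "(\<forall>B \<in> branes wt sc W. \<exists>\<rho>. realizes wt sc W \<rho> B) \<and>
    (\<forall>R. (\<forall>B \<in> branes wt sc W. realizes wt sc W (R B) B) \<longrightarrow>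
      (\<exists>\<Phi>. hoch_chain_map wt sc W \<Phi> \<and>
        (\<forall>w \<in> words wt sc W.
          finite_sum_is (length w) (explicit_term R w) (\<Phi> (hoch_class wt sc W (tens w))) \<and>
          finite_sum_is (length w) (composite_term R w) (\<Phi> (hoch_class wt sc W (tens w))))))"
proof -
  interpret affine_LG_model X ev act W by fact
  have "\<exists>\<Phi>. hoch_chain_map wt sc W \<Phi> \<and> (\<forall>w \<in> words wt sc W.
      finite_sum_is (length w) (explicit_term R w) (\<Phi> (hoch_class wt sc W (tens w))) \<and>
      finite_sum_is (length w) (composite_term R w) (\<Phi> (hoch_class wt sc W (tens w))))"
    if R: "\<forall>B \<in> branes wt sc W. realizes wt sc W (R B) B" for R
  proof -
    interpret brane_category X ev act W sc R
      by (intro brane_category.intro brane_category_axioms.intro assms(1,3)) (use R assms(2) in blast)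
    show ?thesis
      unfolding assms(2)
      by (intro exI[of _ trace_map] conjI ballI hoch_chain_map_trace)
        (simp_all add: trace_map_tens finite_sum_explicit finite_sum_composite)
  qed
  moreover have "\<exists>\<rho>. realizes wt sc W \<rho> B" if "B \<in> branes wt sc W" for B
    using realization_exists that unfolding assms(2) .
  ultimately show ?thesis by blast
qed

end
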